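(* Suppose $X=(X_1,\ldots,X_n)$ is a vector of independent standard gaussian random variables, and $g:\mathbb{R}^n\to\mathbb{R}$ is an absolutely continuous function. Let $W=g(X)$, and suppose that $\mathbb{E}(W)=0$ and $\mathbb{E}(W^2)=1$. Suppose $h$ is a function satisfying $$\mathbb{E}(\varphi(W)W)=\mathbb{E}(\varphi'(W)h(W))$$ for all Lipschitz $\varphi$. Then $h(W)=\mathbb{E}(T(X)\mid W)$, where $$T(x):=\int_0^1\frac{1}{2\sqrt{t}}\,\mathbb{E}\biggl(\sum_{i=1}^n\frac{\partial g}{\partial x_i}(x)\,\frac{\partial g}{\partial x_i}\bigl(\sqrt{t}\,x+\sqrt{1-t}\,X\bigr)\biggr)dt .$$
   Context: In the definition of $T(x)$ the point $x\in\mathbb{R}^n$ is fixed and the expectation is over $X$. The functions $\varphi$ and $h$ are real-valued functions on $\mathbb{R}$.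
   Formalization: It is additionally assumed that the integrals defining T(x) exist for almost every value x of X and that T(X) is integrable; otherwise T and E(T(X)|W) may be undefined, e.g. for n=1 and g a normalization of sin(exp(x^4)). *)

theory Defs
  imports "HOL-Probability.Probability"
begin

definition abs_cont_on :: "real set \<Rightarrow> (real \<Rightarrow> real) \<Rightarrow> bool" where
  "abs_cont_on S f \<longleftrightarrow>
     (\<forall>\<epsilon>>0. \<exists>\<delta>>0. \<forall>(N::nat) p q.
        (\<forall>k<N. p k \<le> q k \<and> {p k..q k} \<subseteq> S) \<and>
        disjoint_family_on (\<lambda>k. {p k<..<q k}) {..<N} \<and>
        (\<Sum>k<N. q k - p k) < \<delta> \<longrightarrow>
        (\<Sum>k<N. \<bar>f (q k) - f (p k)\<bar>) < \<epsilon>)"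

text \<open>
  Where the partial derivative does not exist, \<^const>\<open>deriv\<close> gives an unspecified
  fixed real number. For the functions considered below this is a Lebesgue null set.
\<close>

definition partial_deriv :: "(real ^ 'n \<Rightarrow> real) \<Rightarrow> 'n::finite \<Rightarrow> real ^ 'n \<Rightarrow> real" where
  "partial_deriv g i x = deriv (\<lambda>s. g (x + s *\<^sub>R axis i 1)) 0"

text \<open>
  Absolute continuity of a function of several variables is understood in the sense of
  Tonelli: the function is continuous, it is absolutely continuous on every compact
  segment of almost every line parallel to a coordinate axis, and its partial
  derivatives are locally integrable. In dimension one this is ordinary absolute
  continuity on every compact interval.
\<close>

definition absolutely_continuous_fun :: "(real ^ 'n::finite \<Rightarrow> real) \<Rightarrow> bool" where
  "absolutely_continuous_fun g \<longleftrightarrow>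
     continuous_on UNIV g \<and>
     (\<forall>i. AE x in lborel. \<forall>a b. abs_cont_on {a..b} (\<lambda>s. g (x + s *\<^sub>R axis i 1))) \<and>
     (\<forall>i K. compact K \<longrightarrow> set_integrable lborel K (partial_deriv g i))"

definition std_gaussian_vector :: "'a measure \<Rightarrow> ('a \<Rightarrow> real ^ 'n::finite) \<Rightarrow> bool" where
  "std_gaussian_vector M X \<longleftrightarrow>
     prob_space.indep_vars M (\<lambda>_. borel) (\<lambda>i \<omega>. X \<omega> $ i) UNIV \<and>
     (\<forall>i. distributed M lborel (\<lambda>\<omega>. X \<omega> $ i) (\<lambda>y. ennreal (std_normal_density y)))"

definition grad_prod ::
    "(real ^ 'n::finite \<Rightarrow> real) \<Rightarrow> real ^ 'n \<Rightarrow> real \<Rightarrow> real ^ 'n \<Rightarrow> real" where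
  "grad_prod g x t y =
     (\<Sum>i\<in>UNIV. partial_deriv g i x * partial_deriv g i (sqrt t *\<^sub>R x + sqrt (1 - t) *\<^sub>R y))"

definition T_fun ::
    "'a measure \<Rightarrow> ('a \<Rightarrow> real ^ 'n::finite) \<Rightarrow> (real ^ 'n \<Rightarrow> real) \<Rightarrow> real ^ 'n \<Rightarrow> real" where
  "T_fun M X g x =
     (LINT t:{0<..<1}|lborel. 1 / (2 * sqrt t) * (LINT \<omega>|M. grad_prod g x t (X \<omega>)))"

text \<open>
  Bochner integrals of non-integrable functions are \<open>0\<close> by convention; the following
  says that the two integrals in the definition of \<^const>\<open>T_fun\<close> exist at \<open>x\<close>.
\<close>

definition T_exists ::
    "'a measure \<Rightarrow> ('a \<Rightarrow> real ^ 'n::finite) \<Rightarrow> (real ^ 'n \<Rightarrow> real) \<Rightarrow> real ^ 'n \<Rightarrow> bool" where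
  "T_exists M X g x \<longleftrightarrow>
     (AE t in lborel. t \<in> {0<..<1} \<longrightarrow> integrable M (\<lambda>\<omega>. grad_prod g x t (X \<omega>))) \<and>
     set_integrable lborel {0<..<1}
       (\<lambda>t. 1 / (2 * sqrt t) * (LINT \<omega>|M. grad_prod g x t (X \<omega>)))"

end

theory Submission
  imports Defs
begin

text \<open>
  For independent standard Gaussian \<open>Z\<close>, \<open>Z'\<close> let \<open>m\<^sub>t(x, z)\<close> be the joint density of
  \<open>(\<surd>t Z + \<surd>(1 - t) Z', Z)\<close>. It satisfies the continuity equation
  \<open>\<partial>\<^sub>t m = - div\<^sub>x J\<close> with \<open>J = (z - \<surd>t x) / (2 \<surd>t (1 - t)) m\<close>. Integrating by parts in \<open>z\<close>, the
  Gaussian density times \<open>T(x)\<close> is \<open>\<nabla>g(x) \<cdot> \<integral>\<integral> J g(z) dz dt\<close>. Hence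
  \<open>E (\<phi>'(W) T(X)) = \<integral>\<integral>\<integral> \<nabla>(\<phi> \<circ> g)(x) \<cdot> J g(z) dx dz dt\<close>, and integrating by parts in \<open>x\<close> turns this into
  \<open>\<integral>\<integral>\<integral> \<phi>(g(x)) g(z) \<partial>\<^sub>t m dt dx dz\<close>. Since \<open>m\<^sub>0\<close> is a product density and \<open>m\<^sub>1\<close> lives on the diagonal,
  the result is \<open>E (\<phi>(W) W) - E \<phi>(W) E W = E (\<phi>(W) W)\<close>. Comparing with the hypothesis on \<open>h\<close> for \<open>\<phi>'\<close>
  increasing to the indicator of an interval identifies \<open>h(W)\<close> with the conditional expectation.

  The gradient of \<open>g\<close> is only locally integrable, so cutoffs are needed, and
  \<open>\<integral>\<integral> |J g(z)| dz dt\<close> must be locally bounded in \<open>x\<close>; near \<open>t = 1\<close> this rests on the continuity of \<open>g\<close>.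
  The integrations by parts use the fundamental theorem of calculus on almost every line, where \<open>g\<close>
  is an indefinite integral by the Radon-Nikodym theorem applied to its positive variation.
\<close>

section \<open>Absolutely continuous functions\<close>

text \<open>The gradient carries no global estimate, and this dictates where each derivative goes.
  While it stands at \<open>x\<close> it is multiplied by a cutoff of radius R, and its partner
  needs a bound uniform over a ball. Once the derivative has passed to the cutoff the gradient is
  gone, so a bound over the whole space is affordable; together with a factor 1/R from the cutoff
  this makes the error vanish. The singularities of the flux at times 0 and 1 are of inverse square
  root type, hence integrable, while its divergence is estimated on compact subintervals of the open
  unit interval. Time is therefore truncated as well, and its two ends are reached by a limit of
  expectations, because at time 1 there is no density. The test functions \<phi> are C1 with
  compactly supported derivative: then \<phi> is bounded, the chain rule holds wherever
  \<open>g\<close> has a partial derivative, and \<open>deriv \<phi>\<close> has its ordinary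
  meaning everywhere. Integrability of \<open>h (W \<omega>)\<close> comes from the identity as test
  function: a non-integrable function would have integral 0 instead of 1.\<close>

definition nonoverlapping_in :: "real \<Rightarrow> real \<Rightarrow> 'i set \<Rightarrow> ('i \<Rightarrow> real) \<Rightarrow> ('i \<Rightarrow> real) \<Rightarrow> bool" where
  "nonoverlapping_in a b I p q \<longleftrightarrow> finite I \<and> (\<forall>k\<in>I. a \<le> p k \<and> p k \<le> q k \<and> q k \<le> b) \<and>
     disjoint_family_on (\<lambda>k. {p k<..<q k}) I"

lemma nonoverlapping_in_length:
  assumes "nonoverlapping_in a b I p q" "a \<le> b"
  shows "(\<Sum>k\<in>I. q k - p k) \<le> b - a"
proof -
  have fin: "finite I" and bd: "\<And>k. k \<in> I \<Longrightarrow> a \<le> p k \<and> p k \<le> q k \<and> q k \<le> b"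
    and dis: "disjoint_family_on (\<lambda>k. {p k<..<q k}) I"
    using assms by (auto simp: nonoverlapping_in_def)
  have "ennreal (\<Sum>k\<in>I. q k - p k) = (\<Sum>k\<in>I. emeasure lborel {p k<..<q k})"
    using bd by (subst sum_ennreal[symmetric]) (auto intro!: sum.cong)
  also have "\<dots> = emeasure lborel (\<Union>k\<in>I. {p k<..<q k})"
    by (rule sum_emeasure) (use fin dis in auto)
  also have "\<dots> \<le> emeasure lborel {a..b}"
    by (rule emeasure_mono) (use bd in force)+
  also have "\<dots> = ennreal (b - a)" using assms by simp
  finally show ?thesis using assms by (simp add: ennreal_le_iff)
qed

text \<open>Clamping both endpoints at \<open>x\<close> replaces a case distinction: an interval on
  the wrong side collapses to a point and contributes nothing.\<close>

lemma nonoverlapping_in_split: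
  assumes "nonoverlapping_in a b I p q" "a \<le> x" "x \<le> b"
  shows "nonoverlapping_in a x I (\<lambda>k. min x (p k)) (\<lambda>k. min x (q k))"
    and "nonoverlapping_in x b I (\<lambda>k. max x (p k)) (\<lambda>k. max x (q k))"
proof -
  have dis: "disjoint_family_on (\<lambda>k. {p k<..<q k}) I"
    using assms(1) by (simp add: nonoverlapping_in_def)
  have sub: "{min x (p k)<..<min x (q k)} \<subseteq> {p k<..<q k}"
    "{max x (p k)<..<max x (q k)} \<subseteq> {p k<..<q k}" for k
    by auto
  have A: "disjoint_family_on (\<lambda>k. {min x (p k)<..<min x (q k)}) I"
    unfolding disjoint_family_on_def
  proof (intro ballI impI)
    fix m n assume "m \<in> I" "n \<in> I" "m \<noteq> n"
    then have "{p m<..<q m} \<inter> {p n<..<q n} = {}"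
      using dis unfolding disjoint_family_on_def by blast
    then show "{min x (p m)<..<min x (q m)} \<inter> {min x (p n)<..<min x (q n)} = {}"
      using sub by blast
  qed
  have B: "disjoint_family_on (\<lambda>k. {max x (p k)<..<max x (q k)}) I"
    unfolding disjoint_family_on_def
  proof (intro ballI impI)
    fix m n assume "m \<in> I" "n \<in> I" "m \<noteq> n"
    then have "{p m<..<q m} \<inter> {p n<..<q n} = {}"
      using dis unfolding disjoint_family_on_def by blast
    then show "{max x (p m)<..<max x (q m)} \<inter> {max x (p n)<..<max x (q n)} = {}"
      using sub by blast
  qed
  show "nonoverlapping_in a x I (\<lambda>k. min x (p k)) (\<lambda>k. min x (q k))"
    "nonoverlapping_in x b I (\<lambda>k. max x (p k)) (\<lambda>k. max x (q k))"
    using assms A B by (auto simp: nonoverlapping_in_def)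
qed

text \<open>As \<open>min x y\<close> and \<open>max x y\<close> are \<open>x\<close> and
  \<open>y\<close> in some order, each term merely gains \<open>F x - F x\<close>; the order of the
  endpoints does not enter.\<close>

lemma sum_increments_split:
  fixes F :: "real \<Rightarrow> real"
  shows "(\<Sum>k\<in>I. F (q k) - F (p k)) =
    (\<Sum>k\<in>I. F (min x (q k)) - F (min x (p k))) + (\<Sum>k\<in>I. F (max x (q k)) - F (max x (p k)))"
  by (subst sum.distrib[symmetric], rule sum.cong) (auto simp: min_def max_def)

lemma abs_cont_on_iff:
  "abs_cont_on {a..b} F \<longleftrightarrow> (\<forall>\<epsilon>>0. \<exists>\<delta>>0. \<forall>(N::nat) p q. nonoverlapping_in a b {..<N} p q \<longrightarrow>
     (\<Sum>k<N. q k - p k) < \<delta> \<longrightarrow> (\<Sum>k<N. \<bar>F (q k) - F (p k)\<bar>) < \<epsilon>)"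
proof -
  have "(p \<le> q \<and> {p..q} \<subseteq> {a..b}) = (a \<le> p \<and> p \<le> q \<and> q \<le> b)" for p q :: real
    by auto
  then have "((\<forall>k<N. p k \<le> q k \<and> {p k..q k} \<subseteq> {a..b}) \<and> disjoint_family_on (\<lambda>k. {p k<..<q k}) {..<N})
      = nonoverlapping_in a b {..<N} p q" for N :: nat and p q
    by (simp add: nonoverlapping_in_def Ball_def)
  then show ?thesis by (simp add: abs_cont_on_def conj_assoc[symmetric] imp_conjL)
qed

lemma abs_cont_on_finite_index:
  assumes "abs_cont_on {a..b} F" "\<epsilon> > 0"
  obtains \<delta> where "\<delta> > 0"
    "\<And>(I::'i set) p q. nonoverlapping_in a b I p q \<Longrightarrow> (\<Sum>k\<in>I. q k - p k) < \<delta> \<Longrightarrow>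
        (\<Sum>k\<in>I. \<bar>F (q k) - F (p k)\<bar>) < \<epsilon>"
proof -
  from assms(1)[unfolded abs_cont_on_iff, rule_format, OF assms(2)]
  obtain \<delta> where d: "\<delta> > 0" "\<forall>(N::nat) p q. nonoverlapping_in a b {..<N} p q \<longrightarrow>
     (\<Sum>k<N. q k - p k) < \<delta> \<longrightarrow> (\<Sum>k<N. \<bar>F (q k) - F (p k)\<bar>) < \<epsilon>"
    by blast
  show thesis
  proof (rule that[OF d(1)])
    fix I :: "'i set" and p q
    assume *: "nonoverlapping_in a b I p q" "(\<Sum>k\<in>I. q k - p k) < \<delta>"
    then have fin: "finite I" by (simp add: nonoverlapping_in_def)
    obtain h where h: "bij_betw h {..<card I} I"
      using ex_bij_betw_nat_finite[OF fin] by (auto simp: atLeast0LessThan)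
    have hI: "k < card I \<Longrightarrow> h k \<in> I" for k using h by (auto simp: bij_betw_def)
    have "nonoverlapping_in a b {..<card I} (p \<circ> h) (q \<circ> h)"
      unfolding nonoverlapping_in_def
    proof (intro conjI ballI)
      show "disjoint_family_on (\<lambda>k. {(p \<circ> h) k<..<(q \<circ> h) k}) {..<card I}"
        unfolding disjoint_family_on_def
      proof (intro ballI impI)
        fix m n assume mn: "m \<in> {..<card I}" "n \<in> {..<card I}" "m \<noteq> n"
        then have "h m \<noteq> h n" using h by (auto simp: bij_betw_def inj_on_def)
        then show "{(p \<circ> h) m<..<(q \<circ> h) m} \<inter> {(p \<circ> h) n<..<(q \<circ> h) n} = {}"
          using * hI[of m] hI[of n] mn unfolding nonoverlapping_in_def disjoint_family_on_def o_def by blast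
      qed
    qed (use * hI in \<open>auto simp: nonoverlapping_in_def\<close>)
    then show "(\<Sum>k\<in>I. \<bar>F (q k) - F (p k)\<bar>) < \<epsilon>"
      using d(2)[rule_format, of "card I" "p \<circ> h" "q \<circ> h"] *
        sum.reindex_bij_betw[OF h, of "\<lambda>k. q k - p k"]
        sum.reindex_bij_betw[OF h, of "\<lambda>k. \<bar>F (q k) - F (p k)\<bar>"] by simp
  qed
qed

lemma abs_cont_on_subset:
  "abs_cont_on T F \<Longrightarrow> S \<subseteq> T \<Longrightarrow> abs_cont_on S F"
  unfolding abs_cont_on_def by (meson order_trans)

text \<open>The interval is consumed in pieces of length \<delta>/2. The last piece has total length
  below \<delta> and contributes less than 1, and induction treats the rest; so the number of pieces
  is a bound.\<close>

lemma abs_cont_on_bounded_variation: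
  assumes ac: "abs_cont_on {a..b} F" and "a \<le> b"
  obtains B where "\<And>(I::'i set) p q. nonoverlapping_in a b I p q \<Longrightarrow> (\<Sum>k\<in>I. F (q k) - F (p k)) \<le> B"
proof -
  obtain \<delta> where d: "\<delta> > 0" and small:
    "\<And>(I::'i set) p q. nonoverlapping_in a b I p q \<Longrightarrow> (\<Sum>k\<in>I. q k - p k) < \<delta> \<Longrightarrow>
        (\<Sum>k\<in>I. \<bar>F (q k) - F (p k)\<bar>) < 1"
    using abs_cont_on_finite_index[OF ac, of 1, where 'i='i] by auto
  have "(\<Sum>k\<in>I. F (q k) - F (p k)) \<le> real j"
    if "nonoverlapping_in a x I p q" "a \<le> x" "x \<le> b" "x \<le> a + real j * (\<delta>/2)"
    for j x and I :: "'i set" and p q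
    using that
  proof (induction j arbitrary: x I p q)
    case 0
    then have "x = a" by simp
    with 0 have "p k = a" "q k = a" if "k \<in> I" for k
      using that by (auto simp: nonoverlapping_in_def intro: antisym order_trans)
    then show ?case by simp
  next
    case (Suc j)
    \<comment> \<open>Half of \<delta>, because the length of the last piece has to be strictly
      below \<delta>; the maximum keeps the cut inside the interval.\<close>
    define y where "y = max a (x - \<delta>/2)"
    have y: "a \<le> y" "y \<le> x" "x - y \<le> \<delta>/2" "y \<le> a + real j * (\<delta>/2)"
      using Suc.prems d mult_nonneg_nonneg[of "real j" \<delta>] by (auto simp: y_def max_def field_simps)
    note sp = nonoverlapping_in_split[OF Suc.prems(1) y(1,2)]
    have 1: "(\<Sum>k\<in>I. F (min y (q k)) - F (min y (p k))) \<le> real j"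
      by (rule Suc.IH[OF sp(1)]) (use y Suc.prems in auto)
    have "(\<Sum>k\<in>I. max y (q k) - max y (p k)) < \<delta>"
      using nonoverlapping_in_length[OF sp(2) y(2)] y d by linarith
    moreover have "nonoverlapping_in a b I (\<lambda>k. max y (p k)) (\<lambda>k. max y (q k))"
      using sp(2) y Suc.prems unfolding nonoverlapping_in_def by fastforce
    ultimately have "(\<Sum>k\<in>I. \<bar>F (max y (q k)) - F (max y (p k))\<bar>) < 1" by (rule small[rotated])
    moreover have "(\<Sum>k\<in>I. F (max y (q k)) - F (max y (p k))) \<le> (\<Sum>k\<in>I. \<bar>F (max y (q k)) - F (max y (p k))\<bar>)"
      by (rule sum_mono) auto
    ultimately show ?case
      using 1 sum_increments_split[of F q p I y] by simp
  qed
  from this[of b _ _ _ "nat \<lceil>(b - a) / (\<delta>/2)\<rceil>"]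
  have "\<And>(I::'i set) p q. nonoverlapping_in a b I p q \<Longrightarrow> (\<Sum>k\<in>I. F (q k) - F (p k)) \<le> real (nat \<lceil>(b - a) / (\<delta>/2)\<rceil>)"
  proof -
    fix I :: "'i set" and p q assume *: "nonoverlapping_in a b I p q"
    have "(b - a) / (\<delta>/2) \<le> real (nat \<lceil>(b - a) / (\<delta>/2)\<rceil>)" by linarith
    then have "b - a \<le> real (nat \<lceil>(b - a) / (\<delta>/2)\<rceil>) * (\<delta>/2)"
      by (subst (asm) pos_divide_le_eq) (use d in auto)
    then show "(\<Sum>k\<in>I. F (q k) - F (p k)) \<le> real (nat \<lceil>(b - a) / (\<delta>/2)\<rceil>)"
      using \<open>\<And>q p I. \<lbrakk>nonoverlapping_in a b I p q; a \<le> b; b \<le> b; b \<le> a + real (nat \<lceil>(b - a) / (\<delta>/2)\<rceil>) * (\<delta>/2)\<rbrakk> \<Longrightarrow> _ \<close>[OF *] assms by linarith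
  qed
  then show thesis by (rule that)
qed

section \<open>Positive variation and the Jordan decomposition\<close>

text \<open>Signed increments instead of absolute values: this is the increasing part P in the
  Jordan decomposition F = P - (P - F). The empty family contributes 0.\<close>

definition positive_variation :: "(real \<Rightarrow> real) \<Rightarrow> real \<Rightarrow> real \<Rightarrow> real" where
  "positive_variation F a b =
     Sup {\<Sum>k\<in>I. F (q k) - F (p k) | (I::nat set) p q. nonoverlapping_in a b I p q}"

context
  fixes F :: "real \<Rightarrow> real" and a b :: real
  assumes ac: "abs_cont_on {a..b} F" and ab: "a \<le> b"
begin

lemma positive_variation_upper:
  assumes "a \<le> x" "x \<le> y" "y \<le> b" "nonoverlapping_in x y (I::nat set) p q"
  shows "(\<Sum>k\<in>I. F (q k) - F (p k)) \<le> positive_variation F x y"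
  unfolding positive_variation_def
proof (rule cSup_upper)
  obtain B where B: "\<And>(I::nat set) p q. nonoverlapping_in x y I p q \<Longrightarrow> (\<Sum>k\<in>I. F (q k) - F (p k)) \<le> B"
    using abs_cont_on_bounded_variation[of x y F, where 'i=nat] assms abs_cont_on_subset[OF ac, of "{x..y}"] by fastforce
  show "bdd_above {\<Sum>k\<in>I. F (q k) - F (p k) | (I::nat set) p q. nonoverlapping_in x y I p q}"
    using B by (auto simp: bdd_above_def)
qed (use assms in blast)

lemma positive_variation_least:
  assumes "\<And>(I::nat set) p q. nonoverlapping_in x y I p q \<Longrightarrow> (\<Sum>k\<in>I. F (q k) - F (p k)) \<le> c"
  shows "positive_variation F x y \<le> c"
  unfolding positive_variation_def
proof (rule cSup_least)
  have "nonoverlapping_in x y ({}::nat set) (\<lambda>_. 0) (\<lambda>_. 0)" by (simp add: nonoverlapping_in_def disjoint_family_on_def)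
  then show "{\<Sum>k\<in>I. F (q k) - F (p k) | (I::nat set) p q. nonoverlapping_in x y I p q} \<noteq> {}" by blast
qed (use assms in blast)

lemma positive_variation_approx:
  assumes "e > 0"
  obtains I p q where "nonoverlapping_in x y (I::nat set) p q"
    "(\<Sum>k\<in>I. F (q k) - F (p k)) > positive_variation F x y - e"
  using positive_variation_least[of x y "positive_variation F x y - e"] assms
  by (meson diff_less_eq less_add_same_cancel1 not_le)

text \<open>A family in [a, x] may be continued by the interval [x, y] or by nothing. The two
  options inside \<open>max\<close> say that P - F and P increase, so one inequality yields both
  monotonicities.\<close>

lemma positive_variation_append:
  assumes "a \<le> x" "x \<le> y" "y \<le> b"
  shows "positive_variation F a x + max 0 (F y - F x) \<le> positive_variation F a y"
proof -
  have "positive_variation F a x \<le> positive_variation F a y - max 0 (F y - F x)"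
  proof (rule positive_variation_least)
    fix I :: "nat set" and p q assume *: "nonoverlapping_in a x I p q"
    show "(\<Sum>k\<in>I. F (q k) - F (p k)) \<le> positive_variation F a y - max 0 (F y - F x)"
    proof (cases "F y \<le> F x")
      case True
      have "nonoverlapping_in a y I p q" using * assms unfolding nonoverlapping_in_def by fastforce
      from positive_variation_upper[OF _ _ _ this] show ?thesis using True assms by simp
    next
      case False
      obtain j where j: "j \<notin> I" using * unfolding nonoverlapping_in_def by (metis ex_new_if_finite infinite_UNIV_nat)
      have "disjoint_family_on (\<lambda>k. {(p(j := x)) k<..<(q(j := y)) k}) (insert j I)"
        unfolding disjoint_family_on_insert[OF j]
      proof
        have "q k \<le> x" if "k \<in> I" for k using * that by (auto simp: nonoverlapping_in_def)
        then show "{(p(j := x)) j<..<(q(j := y)) j} \<inter> (\<Union>k\<in>I. {(p(j := x)) k<..<(q(j := y)) k}) = {}"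
          using j by (auto simp: disjoint_iff) (metis less_le_trans not_less_iff_gr_or_eq)
        have "disjoint_family_on (\<lambda>k. {p k<..<q k}) I" using * by (simp add: nonoverlapping_in_def)
        then show "disjoint_family_on (\<lambda>k. {(p(j := x)) k<..<(q(j := y)) k}) I"
          unfolding disjoint_family_on_def using j by (metis fun_upd_other)
      qed
      then have "nonoverlapping_in a y (insert j I) (p(j := x)) (q(j := y))"
        using * assms unfolding nonoverlapping_in_def by fastforce
      from positive_variation_upper[OF _ _ _ this] assms
      have "(\<Sum>k\<in>insert j I. F ((q(j := y)) k) - F ((p(j := x)) k)) \<le> positive_variation F a y" by simp
      moreover have "(\<Sum>k\<in>I. F ((q(j := y)) k) - F ((p(j := x)) k)) = (\<Sum>k\<in>I. F (q k) - F (p k))"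
        using j by (intro sum.cong) auto
      ultimately show ?thesis using False j * by (simp add: nonoverlapping_in_def)
    qed
  qed
  then show ?thesis by simp
qed

lemma positive_variation_split:
  assumes "a \<le> x" "x \<le> y" "y \<le> b"
  shows "positive_variation F a y \<le> positive_variation F a x + positive_variation F x y"
proof (rule positive_variation_least)
  fix I :: "nat set" and p q assume *: "nonoverlapping_in a y I p q"
  note sp = nonoverlapping_in_split[OF this assms(1,2)]
  show "(\<Sum>k\<in>I. F (q k) - F (p k)) \<le> positive_variation F a x + positive_variation F x y"
    using positive_variation_upper[OF _ _ _ sp(1)] positive_variation_upper[OF _ _ _ sp(2)] assms
      sum_increments_split[of F q p I x] by simp
qed

text \<open>Each interval of a short family is replaced by a family inside it that almost attains
  its positive variation. Together they form one family, indexed by pairs, of no greater length, to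
  which the absolute continuity of \<open>F\<close> applies.\<close>

lemma abs_cont_on_positive_variation: "abs_cont_on {a..b} (positive_variation F a)"
  unfolding abs_cont_on_iff
proof (intro allI impI)
  fix \<epsilon> :: real assume e: "\<epsilon> > 0"
  obtain \<delta> where d: "\<delta> > 0" and small:
    "\<And>(I::(nat \<times> nat) set) p q. nonoverlapping_in a b I p q \<Longrightarrow> (\<Sum>k\<in>I. q k - p k) < \<delta> \<Longrightarrow>
        (\<Sum>k\<in>I. \<bar>F (q k) - F (p k)\<bar>) < \<epsilon>/2"
    using abs_cont_on_finite_index[OF ac, of "\<epsilon>/2", where 'i="nat \<times> nat"] e by auto
  show "\<exists>\<delta>>0. \<forall>(N::nat) p q. nonoverlapping_in a b {..<N} p q \<longrightarrow> (\<Sum>k<N. q k - p k) < \<delta> \<longrightarrow>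
        (\<Sum>k<N. \<bar>positive_variation F a (q k) - positive_variation F a (p k)\<bar>) < \<epsilon>"
  proof (intro exI[of _ \<delta>] conjI allI impI d)
    fix N :: nat and p q :: "nat \<Rightarrow> real"
    assume N: "nonoverlapping_in a b {..<N} p q" and len: "(\<Sum>k<N. q k - p k) < \<delta>"
    then have pq: "\<And>k. k < N \<Longrightarrow> a \<le> p k \<and> p k \<le> q k \<and> q k \<le> b"
      by (simp add: nonoverlapping_in_def)
    \<comment> \<open>N suprema are approximated, so the errors add up to at most \<epsilon>/2; the
      summand 1 covers N = 0.\<close>
    define \<eta> where "\<eta> = \<epsilon> / (2 * (real N + 1))"
    have eta: "\<eta> > 0" using e by (simp add: \<eta>_def)
    have "\<exists>I r s. nonoverlapping_in (p k) (q k) (I::nat set) r s \<and>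
        (\<Sum>i\<in>I. F (s i) - F (r i)) > positive_variation F (p k) (q k) - \<eta>" for k
      using positive_variation_approx[OF eta, of "p k" "q k"] by metis
    then obtain I r s where Irs: "\<And>k. nonoverlapping_in (p k) (q k) (I k :: nat set) (r k) (s k)"
      "\<And>k. (\<Sum>i\<in>I k. F (s k i) - F (r k i)) > positive_variation F (p k) (q k) - \<eta>"
      by metis
    define J where "J = Sigma {..<N} I"
    have Ik: "finite (I k)" "i \<in> I k \<Longrightarrow> p k \<le> r k i \<and> r k i \<le> s k i \<and> s k i \<le> q k" for k i
      using Irs(1)[of k] by (auto simp: nonoverlapping_in_def)
    have sumJ: "(\<Sum>x\<in>J. h (fst x) (snd x)) = (\<Sum>k<N. \<Sum>i\<in>I k. h k i)" for h :: "nat \<Rightarrow> nat \<Rightarrow> real"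
      unfolding J_def by (subst sum.Sigma) (auto simp: Ik split_def)
    have "nonoverlapping_in a b J (\<lambda>x. r (fst x) (snd x)) (\<lambda>x. s (fst x) (snd x))"
      unfolding nonoverlapping_in_def
    proof (intro conjI ballI)
      show "finite J" by (auto simp: J_def Ik)
      fix x assume "x \<in> J"
      then show "a \<le> r (fst x) (snd x)" "r (fst x) (snd x) \<le> s (fst x) (snd x)" "s (fst x) (snd x) \<le> b"
        using Ik(2)[of "snd x" "fst x"] pq[of "fst x"] by (auto simp: J_def)
    next
      show "disjoint_family_on (\<lambda>x. {r (fst x) (snd x)<..<s (fst x) (snd x)}) J"
        unfolding disjoint_family_on_def
      proof (intro ballI impI)
        fix x y assume xy: "x \<in> J" "y \<in> J" "x \<noteq> y"
        show "{r (fst x) (snd x)<..<s (fst x) (snd x)} \<inter> {r (fst y) (snd y)<..<s (fst y) (snd y)} = {}"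
        proof (cases "fst x = fst y")
          case True
          then have "snd x \<noteq> snd y" using xy by (auto simp: prod_eq_iff)
          moreover have "snd x \<in> I (fst x)" "snd y \<in> I (fst x)" using xy True by (auto simp: J_def)
          ultimately show ?thesis using Irs(1)[of "fst x"] True
            unfolding nonoverlapping_in_def disjoint_family_on_def by auto
        next
          case False
          have "{r (fst x) (snd x)<..<s (fst x) (snd x)} \<subseteq> {p (fst x)<..<q (fst x)}"
            "{r (fst y) (snd y)<..<s (fst y) (snd y)} \<subseteq> {p (fst y)<..<q (fst y)}"
            using xy Ik(2)[of "snd x" "fst x"] Ik(2)[of "snd y" "fst y"] by (auto simp: J_def)
          moreover have "{p (fst x)<..<q (fst x)} \<inter> {p (fst y)<..<q (fst y)} = {}"
            using N False xy unfolding nonoverlapping_in_def disjoint_family_on_def J_def by (metis mem_Sigma_iff prod.collapse)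
          ultimately show ?thesis by blast
        qed
      qed
    qed
    moreover have "(\<Sum>x\<in>J. s (fst x) (snd x) - r (fst x) (snd x)) < \<delta>"
    proof -
      have "(\<Sum>x\<in>J. s (fst x) (snd x) - r (fst x) (snd x)) \<le> (\<Sum>k<N. q k - p k)"
        unfolding sumJ[of "\<lambda>k i. s k i - r k i"]
        by (rule sum_mono, rule nonoverlapping_in_length[OF Irs(1)]) (use pq in auto)
      with len show ?thesis by simp
    qed
    ultimately have "(\<Sum>x\<in>J. \<bar>F (s (fst x) (snd x)) - F (r (fst x) (snd x))\<bar>) < \<epsilon>/2" by (rule small)
    moreover have "(\<Sum>x\<in>J. F (s (fst x) (snd x)) - F (r (fst x) (snd x))) \<le> (\<Sum>x\<in>J. \<bar>F (s (fst x) (snd x)) - F (r (fst x) (snd x))\<bar>)"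
      by (rule sum_mono) auto
    ultimately have 1: "(\<Sum>k<N. \<Sum>i\<in>I k. F (s k i) - F (r k i)) < \<epsilon>/2"
      using sumJ[of "\<lambda>k i. F (s k i) - F (r k i)"] by simp
    have "(\<Sum>k<N. \<bar>positive_variation F a (q k) - positive_variation F a (p k)\<bar>)
        \<le> (\<Sum>k<N. (\<Sum>i\<in>I k. F (s k i) - F (r k i)) + \<eta>)"
    proof (rule sum_mono)
      fix k assume "k \<in> {..<N}"
      then have k: "a \<le> p k" "p k \<le> q k" "q k \<le> b" using pq by auto
      show "\<bar>positive_variation F a (q k) - positive_variation F a (p k)\<bar> \<le> (\<Sum>i\<in>I k. F (s k i) - F (r k i)) + \<eta>"
        using positive_variation_split[OF k] positive_variation_append[OF k] Irs(2)[of k] by linarith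
    qed
    also have "\<dots> = (\<Sum>k<N. \<Sum>i\<in>I k. F (s k i) - F (r k i)) + real N * \<eta>" by (simp add: sum.distrib)
    also have "real N * \<eta> \<le> \<epsilon>/2"
      using e by (simp add: \<eta>_def field_simps)
    finally show "(\<Sum>k<N. \<bar>positive_variation F a (q k) - positive_variation F a (p k)\<bar>) < \<epsilon>"
      using 1 by linarith
  qed
qed

end

lemma abs_cont_on_imp_continuous_on:
  assumes "abs_cont_on {a..b} F"
  shows "continuous_on {a..b} F"
  unfolding continuous_on_iff dist_real_def
proof (intro ballI allI impI)
  fix x e :: real assume x: "x \<in> {a..b}" and e: "e > 0"
  obtain \<delta> where d: "\<delta> > 0" and small:
    "\<And>(I::unit set) p q. nonoverlapping_in a b I p q \<Longrightarrow> (\<Sum>k\<in>I. q k - p k) < \<delta> \<Longrightarrow>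
        (\<Sum>k\<in>I. \<bar>F (q k) - F (p k)\<bar>) < e"
    using abs_cont_on_finite_index[OF assms e, where 'i=unit] by auto
  show "\<exists>d>0. \<forall>x'\<in>{a..b}. \<bar>x' - x\<bar> < d \<longrightarrow> \<bar>F x' - F x\<bar> < e"
  proof (intro exI[of _ \<delta>] conjI d ballI impI)
    fix y assume y: "y \<in> {a..b}" "\<bar>y - x\<bar> < \<delta>"
    have "nonoverlapping_in a b {()} (\<lambda>_. min x y) (\<lambda>_. max x y)"
      using x y by (auto simp: nonoverlapping_in_def disjoint_family_on_def)
    moreover have "max x y - min x y < \<delta>" using y by (auto simp: max_def min_def)
    ultimately have "\<bar>F (max x y) - F (min x y)\<bar> < e"
      using small[of "{()}" "\<lambda>_. min x y" "\<lambda>_. max x y"] by simp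
    then show "\<bar>F y - F x\<bar> < e" by (auto simp: max_def min_def split: if_splits)
  qed
qed

section \<open>Closure properties of absolute continuity\<close>

text \<open>A common source for differences, Lipschitz functions, compositions and products, by
  suitable choices of \<open>A\<close>, \<open>B\<close> and \<open>K\<close>.\<close>

lemma abs_cont_on_increment_bound:
  fixes A B C :: "real \<Rightarrow> real"
  assumes A: "abs_cont_on {a..b} A" and B: "abs_cont_on {a..b} B"
    and le: "\<And>x y. x \<in> {a..b} \<Longrightarrow> y \<in> {a..b} \<Longrightarrow> \<bar>C y - C x\<bar> \<le> K * \<bar>A y - A x\<bar> + K * \<bar>B y - B x\<bar>"
  shows "abs_cont_on {a..b} C"
  unfolding abs_cont_on_iff
proof (intro allI impI)
  fix e :: real assume e: "e > 0"
  \<comment> \<open>\<open>K\<close> may be zero or negative, whereas K' can serve as a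
    denominator.\<close>
  define K' where "K' = max 1 K"
  have K': "K' > 0" "K \<le> K'" by (auto simp: K'_def)
  have e2: "e/(2*K') > 0" using e K' by simp
  obtain d1 where d1: "d1 > 0" and
    s1: "\<And>I p q. nonoverlapping_in a b (I :: nat set) p q \<Longrightarrow> (\<Sum>k\<in>I. q k - p k) < d1 \<Longrightarrow>
          (\<Sum>k\<in>I. \<bar>A (q k) - A (p k)\<bar>) < e/(2*K')"
    using abs_cont_on_finite_index[OF A e2, where 'i=nat] by auto
  obtain d2 where d2: "d2 > 0" and
    s2: "\<And>I p q. nonoverlapping_in a b (I :: nat set) p q \<Longrightarrow> (\<Sum>k\<in>I. q k - p k) < d2 \<Longrightarrow>
          (\<Sum>k\<in>I. \<bar>B (q k) - B (p k)\<bar>) < e/(2*K')"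
    using abs_cont_on_finite_index[OF B e2, where 'i=nat] by auto
  show "\<exists>\<delta>>0. \<forall>(N::nat) p q. nonoverlapping_in a b {..<N} p q \<longrightarrow> (\<Sum>k<N. q k - p k) < \<delta> \<longrightarrow>
        (\<Sum>k<N. \<bar>C (q k) - C (p k)\<bar>) < e"
  proof (intro exI[of _ "min d1 d2"] conjI allI impI)
    fix N :: nat and p q
    assume N: "nonoverlapping_in a b {..<N} p q" and len: "(\<Sum>k<N. q k - p k) < min d1 d2"
    have "(\<Sum>k<N. \<bar>C (q k) - C (p k)\<bar>)
        \<le> (\<Sum>k<N. K' * \<bar>A (q k) - A (p k)\<bar> + K' * \<bar>B (q k) - B (p k)\<bar>)"
    proof (rule sum_mono)
      fix k assume "k \<in> {..<N}"
      then have "a \<le> p k \<and> p k \<le> q k \<and> q k \<le> b" using N by (simp add: nonoverlapping_in_def)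
      then have k: "p k \<in> {a..b}" "q k \<in> {a..b}" by auto
      have "K * \<bar>A (q k) - A (p k)\<bar> \<le> K' * \<bar>A (q k) - A (p k)\<bar>"
        "K * \<bar>B (q k) - B (p k)\<bar> \<le> K' * \<bar>B (q k) - B (p k)\<bar>"
        by (auto intro!: mult_right_mono K')
      then show "\<bar>C (q k) - C (p k)\<bar> \<le> K' * \<bar>A (q k) - A (p k)\<bar> + K' * \<bar>B (q k) - B (p k)\<bar>"
        using le[OF k] by linarith
    qed
    also have "\<dots> = K' * ((\<Sum>k<N. \<bar>A (q k) - A (p k)\<bar>) + (\<Sum>k<N. \<bar>B (q k) - B (p k)\<bar>))"
      by (simp add: sum.distrib sum_distrib_left distrib_left)
    also have "\<dots> < K' * (e/(2*K') + e/(2*K'))"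
      using s1[OF N] s2[OF N] len K' by (intro mult_strict_left_mono add_strict_mono) auto
    also have "\<dots> = e" using K' by (simp add: field_simps)
    finally show "(\<Sum>k<N. \<bar>C (q k) - C (p k)\<bar>) < e" .
  qed (use d1 d2 in auto)
qed

lemma abs_cont_on_diff:
  assumes "abs_cont_on {a..b} F" "abs_cont_on {a..b} G"
  shows "abs_cont_on {a..b} (\<lambda>x. F x - G x)"
  by (rule abs_cont_on_increment_bound[OF assms, of _ 1]) simp

lemma abs_cont_on_lipschitz:
  fixes F :: "real \<Rightarrow> real"
  assumes "\<And>x y. x \<in> {a..b} \<Longrightarrow> y \<in> {a..b} \<Longrightarrow> \<bar>F y - F x\<bar> \<le> L * \<bar>y - x\<bar>"
  shows "abs_cont_on {a..b} F"
proof -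
  have id: "abs_cont_on {a..b} (\<lambda>x. x)"
    unfolding abs_cont_on_iff by (auto simp: nonoverlapping_in_def intro!: exI)
  show ?thesis
  proof (rule abs_cont_on_increment_bound[OF id id, of _ "\<bar>L\<bar>"])
    fix x y assume xy: "x \<in> {a..b}" "y \<in> {a..b}"
    have "L * \<bar>y - x\<bar> \<le> \<bar>L\<bar> * \<bar>y - x\<bar>" "0 \<le> \<bar>L\<bar> * \<bar>y - x\<bar>" by (auto intro: mult_right_mono)
    then show "\<bar>F y - F x\<bar> \<le> \<bar>L\<bar> * \<bar>y - x\<bar> + \<bar>L\<bar> * \<bar>y - x\<bar>"
      using assms[OF xy] by linarith
  qed
qed

section \<open>Stieltjes measures and their Radon-Nikodym densities\<close>

text \<open>Clamping makes \<open>G\<close> monotone and continuous on the whole line, as a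
  distribution function has to be. For a null set the condition on finite families is carried over
  to countable ones: the set is covered by nonoverlapping intervals inside an open set of measure
  below \<delta>, and finite subfamilies exhaust the cover.\<close>

lemma interval_measure_absolutely_continuous:
  fixes P :: "real \<Rightarrow> real" and a b :: real
  assumes ac: "abs_cont_on {a..b} P" and ab: "a \<le> b"
    and mono: "\<And>x y. a \<le> x \<Longrightarrow> x \<le> y \<Longrightarrow> y \<le> b \<Longrightarrow> P x \<le> P y"
  defines "G \<equiv> \<lambda>x. P (max a (min b x))"
  shows "absolutely_continuous lborel (interval_measure G)"
    and "x \<le> y \<Longrightarrow> emeasure (interval_measure G) {x..y} = ennreal (G y - G x)"
proof -
  have G_mono: "G x \<le> G y" if "x \<le> y" for x y
    unfolding G_def by (rule mono) (use that ab in auto)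
  have G_cont: "continuous_on UNIV G"
    unfolding G_def
    by (rule continuous_on_compose2[OF abs_cont_on_imp_continuous_on[OF ac]])
      (use ab in \<open>auto intro!: continuous_intros\<close>)
  have Icc: "emeasure (interval_measure G) {x..y} = ennreal (G y - G x)" if "x \<le> y" for x y
    by (rule emeasure_interval_measure_Icc) (use that G_mono G_cont in auto)
  then show "x \<le> y \<Longrightarrow> emeasure (interval_measure G) {x..y} = ennreal (G y - G x)" .
  have small: "emeasure (interval_measure G) (N \<inter> {c..d}) \<le> ennreal e"
    if N: "N \<in> null_sets lborel" and e: "e > 0" and cd: "c < d" for N c d e
  proof -
    obtain \<delta> where d: "\<delta> > 0" and small:
      "\<And>(I::real set set) p q. nonoverlapping_in a b I p q \<Longrightarrow> (\<Sum>k\<in>I. q k - p k) < \<delta> \<Longrightarrow>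
          (\<Sum>k\<in>I. \<bar>P (q k) - P (p k)\<bar>) < e"
      using abs_cont_on_finite_index[OF ac e, where 'i="real set"] by auto
    have Nb: "N \<in> sets borel" "emeasure lborel N = 0" using N by auto
    obtain U where U: "open U" "N \<subseteq> U" "emeasure lborel (U - N) < ennreal \<delta>"
      using outer_regular_lborel[OF Nb(1) d] by auto
    have "emeasure lborel U \<le> emeasure lborel (U - N) + emeasure lborel N"
      using emeasure_subadditive[of "U - N" lborel N] U Nb by (simp add: Un_absorb2)
    then have Ud: "emeasure lborel U < ennreal \<delta>" using U(3) Nb by simp
    \<comment> \<open>Every cell of the covering lemma contains a point of \<open>N\<close>, at
      which this gauge equals \<open>U\<close>; so all cells lie inside \<open>U\<close>.\<close>
    define g where "g x = (if x \<in> U then U else UNIV)" for x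
    have "gauge g" using U by (auto simp: gauge_def g_def)
    moreover have "N \<inter> {c..d} \<subseteq> cbox c d" "box c d \<noteq> {}" using cd by auto
    ultimately obtain \<D> where D: "countable \<D>" "\<And>K. K \<in> \<D> \<Longrightarrow> interior K \<noteq> {} \<and> (\<exists>c d. K = cbox c d)"
      "pairwise (\<lambda>A B. interior A \<inter> interior B = {}) \<D>"
      "\<And>K. K \<in> \<D> \<Longrightarrow> \<exists>x \<in> (N \<inter> {c..d}) \<inter> K. K \<subseteq> g x" "N \<inter> {c..d} \<subseteq> \<Union>\<D>"
      using covering_lemma[of "N \<inter> {c..d}" c d g] by metis
    have DU: "K \<subseteq> U" if "K \<in> \<D>" for K
      using D(4)[OF that] U by (auto simp: g_def split: if_splits)
    have "\<exists>u v. K = {u..v} \<and> u < v" if K: "K \<in> \<D>" for K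
    proof -
      obtain u v where uv: "K = cbox u v" "interior K \<noteq> {}" using D(2)[OF K] by auto
      then have "u < v" by (simp add: interior_cbox box_eq_empty)
      then show ?thesis using uv by auto
    qed
    then obtain u v where uv: "\<And>K. K \<in> \<D> \<Longrightarrow> K = {u K..v K} \<and> u K < v K" by metis
    have fin: "emeasure (interval_measure G) (\<Union>E) \<le> ennreal e" if E: "finite E" "E \<subseteq> \<D>" for E
    proof -
      \<comment> \<open>\<open>G\<close> is constant on either side of [a, b], so clamped endpoints
        give a family in [a, b] with the same increments.\<close>
      define p where "p K = max a (min b (u K))" for K
      define q where "q K = max a (min b (v K))" for K
      have dis0: "{u K<..<v K} \<inter> {u L<..<v L} = {}" if "K \<in> E" "L \<in> E" "K \<noteq> L" for K L
      proof -
        have KL: "K \<in> \<D>" "L \<in> \<D>" using that E by auto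
        have "interior K \<inter> interior L = {}" using D(3) KL that by (auto simp: pairwise_def)
        moreover have "interior K = {u K<..<v K}" "interior L = {u L<..<v L}"
          using uv[OF KL(1)] uv[OF KL(2)] by (metis interior_atLeastAtMost_real)+
        ultimately show ?thesis by simp
      qed
      have no: "nonoverlapping_in a b E p q"
        unfolding nonoverlapping_in_def disjoint_family_on_def
      proof (intro conjI ballI impI)
        fix K assume "K \<in> E"
        then show "a \<le> p K" "p K \<le> q K" "q K \<le> b"
          using uv[of K] E ab by (auto simp: p_def q_def max_def min_def)
      next
        fix K L assume KL: "K \<in> E" "L \<in> E" "K \<noteq> L"
        have "{p K<..<q K} \<subseteq> {u K<..<v K}" "{p L<..<q L} \<subseteq> {u L<..<v L}"
          by (auto simp: p_def q_def)
        then show "{p K<..<q K} \<inter> {p L<..<q L} = {}" using dis0[OF KL] by blast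
      qed (use E in simp)
      have "ennreal (\<Sum>K\<in>E. v K - u K) = (\<Sum>K\<in>E. emeasure lborel {u K<..<v K})"
        using uv E by (subst sum_ennreal[symmetric]) (auto intro!: sum.cong simp: subset_eq less_imp_le)
      also have "\<dots> = emeasure lborel (\<Union>K\<in>E. {u K<..<v K})"
        by (rule sum_emeasure) (use E dis0 in \<open>auto simp: disjoint_family_on_def simp del: greaterThanLessThan_iff\<close>)
      also have "\<dots> \<le> emeasure lborel U"
      proof (rule emeasure_mono)
        show "(\<Union>K\<in>E. {u K<..<v K}) \<subseteq> U"
        proof (rule UN_least)
          fix K assume "K \<in> E"
          then have K: "K \<in> \<D>" using E by auto
          have "{u K<..<v K} \<subseteq> {u K..v K}" by auto
          then show "{u K<..<v K} \<subseteq> U" using DU[OF K] uv[OF K] by blast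
        qed
      qed (use U in auto)
      also have "\<dots> < ennreal \<delta>" by (rule Ud)
      finally have "(\<Sum>K\<in>E. v K - u K) < \<delta>"
        using d by (metis ennreal_leI not_le)
      moreover have "(\<Sum>K\<in>E. q K - p K) \<le> (\<Sum>K\<in>E. v K - u K)"
      proof (rule sum_mono)
        fix K assume "K \<in> E"
        then have "u K < v K" using uv E by auto
        then show "q K - p K \<le> v K - u K" by (auto simp: p_def q_def max_def min_def)
      qed
      ultimately have lt: "(\<Sum>K\<in>E. \<bar>P (q K) - P (p K)\<bar>) < e" by (intro small no) simp
      have "emeasure (interval_measure G) (\<Union>E) = emeasure (interval_measure G) (\<Union>K\<in>E. K)" by simp
      also have "\<dots> \<le> (\<Sum>K\<in>E. emeasure (interval_measure G) K)"
      proof (rule emeasure_subadditive_finite)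
        show "(\<lambda>K. K) ` E \<subseteq> sets (interval_measure G)"
        proof
          fix K assume "K \<in> (\<lambda>K. K) ` E"
          then have "K = {u K..v K}" using uv E by auto
          then show "K \<in> sets (interval_measure G)" by (metis sets_interval_measure atLeastAtMost_borel)
        qed
      qed (use E in auto)
      also have "\<dots> = (\<Sum>K\<in>E. ennreal \<bar>P (q K) - P (p K)\<bar>)"
      proof (rule sum.cong[OF refl])
        fix K assume "K \<in> E"
        then have K: "K = {u K..v K}" "u K < v K" using uv E by auto
        then have "emeasure (interval_measure G) K = ennreal (G (v K) - G (u K))"
          using Icc[of "u K" "v K"] by simp
        moreover have "G (v K) - G (u K) = \<bar>P (q K) - P (p K)\<bar>"
          using G_mono[of "u K" "v K"] K(2) by (simp add: G_def p_def q_def)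
        ultimately show "emeasure (interval_measure G) K = ennreal \<bar>P (q K) - P (p K)\<bar>" by simp
      qed
      also have "\<dots> \<le> ennreal e" using lt by (simp add: ennreal_leI)
      finally show ?thesis .
    qed
    show ?thesis
    proof (cases "\<D> = {}")
      case True then show ?thesis using D(5) by simp
    next
      case False
      \<comment> \<open>Finite initial segments of an enumeration of the cover; continuity from
        below passes the bound on to the whole union.\<close>
      define E where "E n = from_nat_into \<D> ` {..<n}" for n
      have E: "finite (E n)" "E n \<subseteq> \<D>" for n using from_nat_into[OF False] by (auto simp: E_def)
      have Db: "K \<in> sets borel" if "K \<in> \<D>" for K using uv[OF that] by (metis atLeastAtMost_borel)
      have "\<Union>\<D> = (\<Union>n. \<Union>(E n))"
      proof -
        have "\<D> = range (from_nat_into \<D>)" using False D(1) by (simp add: range_from_nat_into)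
        moreover have "(\<Union>n. E n) = range (from_nat_into \<D>)" by (auto simp: E_def)
        ultimately have "\<D> = (\<Union>n. E n)" by simp
        then show ?thesis by blast
      qed
      moreover have "(SUP n. emeasure (interval_measure G) (\<Union>(E n))) = emeasure (interval_measure G) (\<Union>n. \<Union>(E n))"
      proof (rule SUP_emeasure_incseq)
        show "range (\<lambda>n. \<Union>(E n)) \<subseteq> sets (interval_measure G)"
          using E Db by (auto intro!: sets.finite_Union)
        show "incseq (\<lambda>n. \<Union>(E n))" by (auto simp: incseq_def E_def intro: less_le_trans)
      qed
      ultimately have "emeasure (interval_measure G) (\<Union>\<D>) \<le> ennreal e"
        using fin[OF E] by (metis SUP_least)
      moreover have "emeasure (interval_measure G) (N \<inter> {c..d}) \<le> emeasure (interval_measure G) (\<Union>\<D>)"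
        by (rule emeasure_mono[OF D(5)]) (use D(1) Db in \<open>auto intro!: sets.countable_Union\<close>)
      ultimately show ?thesis by simp
    qed
  qed
  show "absolutely_continuous lborel (interval_measure G)"
    unfolding absolutely_continuous_def
  proof
    fix N :: "real set" assume N: "N \<in> null_sets lborel"
    then have Nb: "N \<in> sets borel" by auto
    have "N \<inter> {- real (Suc n)..real (Suc n)} \<in> null_sets (interval_measure G)" for n
    proof (rule null_setsI)
      have "emeasure (interval_measure G) (N \<inter> {- real (Suc n)..real (Suc n)}) \<le> 0"
        by (rule ennreal_le_epsilon, simp, rule small[OF N]) auto
      then show "emeasure (interval_measure G) (N \<inter> {- real (Suc n)..real (Suc n)}) = 0" by simp
    qed (use Nb in simp)
    then have "(\<Union>n. N \<inter> {- real (Suc n)..real (Suc n)}) \<in> null_sets (interval_measure G)"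
      by (rule null_sets_UN)
    moreover have "N = (\<Union>n. N \<inter> {- real (Suc n)..real (Suc n)})"
    proof (safe)
      fix x assume "x \<in> N"
      obtain n where "\<bar>x\<bar> \<le> real n" using real_arch_simple by blast
      then show "x \<in> (\<Union>n. N \<inter> {- real (Suc n)..real (Suc n)})" using \<open>x \<in> N\<close>
        by (auto intro!: exI[of _ n])
    qed
    ultimately show "N \<in> null_sets (interval_measure G)" by simp
  qed
qed

lemma mono_abs_cont_density:
  fixes P :: "real \<Rightarrow> real" and a b :: real
  assumes ac: "abs_cont_on {a..b} P" and ab: "a \<le> b"
    and mono: "\<And>x y. a \<le> x \<Longrightarrow> x \<le> y \<Longrightarrow> y \<le> b \<Longrightarrow> P x \<le> P y"
  obtains f :: "real \<Rightarrow> real" where "integrable lborel f"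
    "\<And>x y. a \<le> x \<Longrightarrow> x \<le> y \<Longrightarrow> y \<le> b \<Longrightarrow> P y - P x = (LINT s:{x..y}|lborel. f s)"
proof -
  define G where "G = (\<lambda>x. P (max a (min b x)))"
  note im = interval_measure_absolutely_continuous[OF ac ab mono, folded G_def]
  obtain f0 where f0: "f0 \<in> borel_measurable lborel" "density lborel f0 = interval_measure G"
    using sigma_finite_measure.Radon_Nikodym[OF sigma_finite_lborel im(1)] by auto
  \<comment> \<open>The conversion changes \<open>f0\<close> only where it is infinite, which within
    [a, b] is a null set; the indicator makes the density integrable on the line.\<close>
  define f where "f s = enn2real (f0 s) * indicator {a..b} s" for s
  have fm[measurable]: "f \<in> borel_measurable borel"
    using f0(1) unfolding f_def by simp
  have Gx: "G x = P x" if "a \<le> x" "x \<le> b" for x using that by (simp add: G_def max_def min_def)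
  have f0_int: "(\<integral>\<^sup>+s. f0 s * indicator {x..y} s \<partial>lborel) = ennreal (P y - P x)"
    if "a \<le> x" "x \<le> y" "y \<le> b" for x y
  proof -
    have "emeasure (density lborel f0) {x..y} = ennreal (P y - P x)"
      unfolding f0(2) using im(2)[of x y] that Gx by simp
    then show ?thesis using f0(1) by (subst (asm) emeasure_density) auto
  qed
  have fin: "AE s in lborel. f0 s * indicator {a..b} s \<noteq> \<infinity>"
    by (rule nn_integral_PInf_AE) (use f0(1) f0_int[of a b] ab in auto)
  have nn: "(\<integral>\<^sup>+s. ennreal (f s * indicator {x..y} s) \<partial>lborel) = ennreal (P y - P x)"
    if xy: "a \<le> x" "x \<le> y" "y \<le> b" for x y
  proof -
    have "(\<integral>\<^sup>+s. ennreal (f s * indicator {x..y} s) \<partial>lborel) = (\<integral>\<^sup>+s. f0 s * indicator {x..y} s \<partial>lborel)"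
    proof (rule nn_integral_cong_AE)
      show "AE s in lborel. ennreal (f s * indicator {x..y} s) = f0 s * indicator {x..y} s"
        using fin
      proof eventually_elim
        case (elim s)
        then show ?case using xy by (auto simp: f_def indicator_def less_top)
      qed
    qed
    then show ?thesis using f0_int[OF xy] by simp
  qed
  have f0': "f s \<ge> 0" "f s * indicator {a..b} s = f s" for s by (auto simp: f_def indicator_def)
  have "(\<integral>\<^sup>+s. ennreal (f s) \<partial>lborel) = ennreal (P b - P a)"
    using nn[of a b] ab unfolding f0' by simp
  then have "integrable lborel f"
    by (subst integrable_iff_bounded) (use f0'(1) fm in simp)
  moreover have "P y - P x = (LINT s:{x..y}|lborel. f s)" if xy: "a \<le> x" "x \<le> y" "y \<le> b" for x y
  proof -
    have "(LINT s:{x..y}|lborel. f s) = enn2real (\<integral>\<^sup>+s. ennreal (f s * indicator {x..y} s) \<partial>lborel)"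
      unfolding set_lebesgue_integral_def
      by (subst integral_eq_nn_integral) (use fm f0'(1) in \<open>auto simp: mult.commute\<close>)
    then show ?thesis using nn[OF xy] mono[OF xy] by simp
  qed
  ultimately show thesis by (rule that)
qed

text \<open>P and P - F are increasing and absolutely continuous, so each has a density; their
  difference is a density for \<open>F\<close>.\<close>

lemma abs_cont_on_indefinite_integral:
  assumes ac: "abs_cont_on {a..b} F" and ab: "a \<le> b"
  obtains f :: "real \<Rightarrow> real" where "integrable lborel f"
    "\<And>x y. a \<le> x \<Longrightarrow> x \<le> y \<Longrightarrow> y \<le> b \<Longrightarrow> F y - F x = (LINT s:{x..y}|lborel. f s)"
proof -
  let ?P = "positive_variation F a"
  note acP = abs_cont_on_positive_variation[OF ac ab]
  obtain f1 where f1: "integrable lborel f1"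
    "\<And>x y. a \<le> x \<Longrightarrow> x \<le> y \<Longrightarrow> y \<le> b \<Longrightarrow> ?P y - ?P x = (LINT s:{x..y}|lborel. f1 s)"
    using mono_abs_cont_density[OF acP ab] positive_variation_append[OF ac ab] by (smt (verit, best))
  obtain f2 where f2: "integrable lborel f2"
    "\<And>x y. a \<le> x \<Longrightarrow> x \<le> y \<Longrightarrow> y \<le> b \<Longrightarrow> (?P y - F y) - (?P x - F x) = (LINT s:{x..y}|lborel. f2 s)"
    using mono_abs_cont_density[OF abs_cont_on_diff[OF acP ac] ab] positive_variation_append[OF ac ab] by (smt (verit, best))
  show thesis
  proof (rule that[of "\<lambda>s. f1 s - f2 s"])
    show "integrable lborel (\<lambda>s. f1 s - f2 s)" using f1 f2 by auto
    fix x y assume xy: "a \<le> x" "x \<le> y" "y \<le> b"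
    have si: "set_integrable lborel {x..y} f1" "set_integrable lborel {x..y} f2"
      using f1(1) f2(1) unfolding set_integrable_def by (auto intro!: integrable_mult_indicator simp del: real_scaleR_def)
    show "F y - F x = (LINT s:{x..y}|lborel. f1 s - f2 s)"
      using f1(2)[OF xy] f2(2)[OF xy] by (subst set_integral_diff(2)[OF si]) simp
  qed
qed

section \<open>Lebesgue differentiation and the fundamental theorem of calculus\<close>

text \<open>\<open>integrable_ccontinuous_explicit\<close> controls averages to the right of a
  point. Applied to the reflection of \<open>f\<close> it controls those to the left, and reflection
  preserves null sets.\<close>

lemma integral_has_derivative_AE:
  fixes f F :: "real \<Rightarrow> real"
  assumes f: "integrable lborel f"
    and F: "\<And>x y. a \<le> x \<Longrightarrow> x \<le> y \<Longrightarrow> y \<le> b \<Longrightarrow> F y - F x = (LINT s:{x..y}|lborel. f s)"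
  shows "AE x in lborel. x \<in> {a<..<b} \<longrightarrow> (F has_real_derivative f x) (at x)"
proof -
  have si: "set_integrable lborel {x..y} f" for x y
    using f unfolding set_integrable_def by (auto intro!: integrable_mult_indicator simp del: real_scaleR_def)
  have hk: "f integrable_on {x..y}" "integral {x..y} f = (LINT s:{x..y}|lborel. f s)" for x y
    using set_borel_integral_eq_integral[OF si] by auto
  have hk': "(\<lambda>s. f (- s)) integrable_on {x..y}" "integral {x..y} (\<lambda>s. f (- s)) = integral {-y..-x} f" for x y
    using hk(1)[of "-y" "-x"] Henstock_Kurzweil_Integration.integrable_reflect_real[of f "-x" "-y"] Henstock_Kurzweil_Integration.integral_reflect_real[of "-x" "-y" f] by auto
  obtain N where N: "negligible N" "\<And>x e. x \<notin> N \<Longrightarrow> 0 < e \<Longrightarrow>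
      \<exists>d>0. \<forall>h. 0 < h \<and> h < d \<longrightarrow> norm(integral (cbox x (x + h *\<^sub>R One)) f /\<^sub>R h ^ DIM(real) - f x) < e"
    using integrable_ccontinuous_explicit[of f] hk(1) by auto
  obtain N' where N': "negligible N'" "\<And>x e. x \<notin> N' \<Longrightarrow> 0 < e \<Longrightarrow>
      \<exists>d>0. \<forall>h. 0 < h \<and> h < d \<longrightarrow> norm(integral (cbox x (x + h *\<^sub>R One)) (\<lambda>s. f (- s)) /\<^sub>R h ^ DIM(real) - f (- x)) < e"
    using integrable_ccontinuous_explicit[of "\<lambda>s. f (- s)"] hk'(1) by auto
  have neg: "negligible (uminus ` N')"
    by (rule negligible_differentiable_image_negligible[OF _ N'(1)]) (auto simp: differentiable_on_def intro!: derivative_intros)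
  have der: "(F has_real_derivative f x) (at x)" if x: "x \<in> {a<..<b}" "x \<notin> N" "x \<notin> uminus ` N'" for x
    unfolding DERIV_def LIM_eq
  proof (intro allI impI)
    fix e :: real assume e: "e > 0"
    obtain d1 where d1: "d1 > 0"
      "\<And>h. 0 < h \<Longrightarrow> h < d1 \<Longrightarrow> \<bar>integral {x..x + h} f / h - f x\<bar> < e"
      using N(2)[OF x(2) e] by (auto simp: divide_inverse mult.commute)
    have "- x \<notin> N'" using x(3) by (metis imageI minus_minus)
    then obtain d2 where d2: "d2 > 0"
      "\<And>h. 0 < h \<Longrightarrow> h < d2 \<Longrightarrow> \<bar>integral {- x..- x + h} (\<lambda>s. f (- s)) / h - f x\<bar> < e"
      using N'(2)[OF _ e, of "-x"] by (auto simp: divide_inverse mult.commute)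
    show "\<exists>s>0. \<forall>h. h \<noteq> 0 \<and> norm (h - 0) < s \<longrightarrow> norm ((F (x + h) - F x) / h - f x) < e"
    proof (intro exI[of _ "min (min d1 d2) (min (x - a) (b - x))"] conjI allI impI)
      fix h :: real assume h: "h \<noteq> 0 \<and> norm (h - 0) < min (min d1 d2) (min (x - a) (b - x))"
      show "norm ((F (x + h) - F x) / h - f x) < e"
      proof (cases "h > 0")
        case True
        then have "F (x + h) - F x = integral {x..x + h} f"
          using F[of x "x + h"] h x hk(2) by auto
        then show ?thesis using d1(2)[of h] h True by simp
      next
        case False
        then have "F x - F (x + h) = integral {x + h..x} f"
          using F[of "x + h" x] h x hk(2) by auto
        also have "\<dots> = integral {- x..- x + (- h)} (\<lambda>s. f (- s))"
          by (simp add: hk'(2) add.commute)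
        finally have "(F (x + h) - F x) / h = integral {- x..- x + (- h)} (\<lambda>s. f (- s)) / (- h)"
          by (simp add: field_simps)
        then show ?thesis using d2(2)[of "- h"] h False by simp
      qed
    qed (use d1 d2 x in auto)
  qed
  have "negligible (N \<union> uminus ` N')" using N(1) neg by (rule negligible_Un)
  then have "AE x in lebesgue. x \<notin> N \<union> uminus ` N'"
    unfolding negligible_iff_null_sets by (rule AE_not_in)
  then have "AE x in lborel. x \<notin> N \<union> uminus ` N'" by (simp add: AE_completion_iff)
  then show ?thesis by eventually_elim (use der in auto)
qed

text \<open>By uniqueness of derivatives any almost everywhere derivative agrees with the density,
  so \<open>F'\<close> can be given in whatever form it arises along a line.\<close>

lemma abs_cont_on_FTC:
  assumes ac: "abs_cont_on {a..b} F" and ab: "a \<le> b"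
    and F'[measurable]: "F' \<in> borel_measurable borel"
    and der: "AE s in lborel. s \<in> {a<..<b} \<longrightarrow> (F has_real_derivative F' s) (at s)"
  shows "set_integrable lborel {a..b} F'" "(LINT s:{a..b}|lborel. F' s) = F b - F a"
proof -
  obtain f where f: "integrable lborel f"
    "\<And>x y. a \<le> x \<Longrightarrow> x \<le> y \<Longrightarrow> y \<le> b \<Longrightarrow> F y - F x = (LINT s:{x..y}|lborel. f s)"
    using abs_cont_on_indefinite_integral[OF ac ab] by blast
  have [measurable]: "f \<in> borel_measurable borel" using f by auto
  have h: "AE s in lborel. s \<in> {a<..<b} \<longrightarrow> (F has_real_derivative f s) (at s)"
    by (rule integral_has_derivative_AE[of f a b F]) (use f in auto)
  have ae: "AE s in lborel. s \<in> {a..b} \<longrightarrow> F' s = f s"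
    using h der AE_lborel_singleton[of a] AE_lborel_singleton[of b]
    by eventually_elim (auto intro: DERIV_unique)
  have si: "set_integrable lborel {a..b} f"
    using f(1) unfolding set_integrable_def by (auto intro!: integrable_mult_indicator simp del: real_scaleR_def)
  show "set_integrable lborel {a..b} F'"
    using si set_integrable_cong_AE[OF _ _ ae] by auto
  have "(LINT s:{a..b}|lborel. F' s) = (LINT s:{a..b}|lborel. f s)"
    by (rule set_lebesgue_integral_cong_AE[OF _ _ _ ae]) auto
  then show "(LINT s:{a..b}|lborel. F' s) = F b - F a"
    using f(2)[of a b] ab by simp
qed

lemma abs_cont_on_differentiable_AE:
  assumes "abs_cont_on {a..b} F" "a \<le> b"
  shows "AE s in lborel. s \<in> {a<..<b} \<longrightarrow> (F has_real_derivative deriv F s) (at s)"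
proof -
  obtain f where f: "integrable lborel f"
    "\<And>x y. a \<le> x \<Longrightarrow> x \<le> y \<Longrightarrow> y \<le> b \<Longrightarrow> F y - F x = (LINT s:{x..y}|lborel. f s)"
    using abs_cont_on_indefinite_integral[OF assms] by blast
  have "AE s in lborel. s \<in> {a<..<b} \<longrightarrow> (F has_real_derivative f s) (at s)"
    by (rule integral_has_derivative_AE[of f a b F]) (use f in auto)
  then show ?thesis
    by eventually_elim (auto simp: DERIV_imp_deriv)
qed

section \<open>Integration by parts\<close>

abbreviation lborel2 :: "('a::euclidean_space \<times> 'b::euclidean_space) measure" where
  "lborel2 \<equiv> lborel \<Otimes>\<^sub>M lborel"

abbreviation lborel3 :: "('a::euclidean_space \<times> 'b::euclidean_space \<times> 'c::euclidean_space) measure" where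
  "lborel3 \<equiv> lborel \<Otimes>\<^sub>M lborel2"

lemma abs_cont_on_C1:
  fixes F F' :: "real \<Rightarrow> real"
  assumes der: "\<And>s. (F has_real_derivative F' s) (at s)" and cont: "continuous_on UNIV F'"
  shows "abs_cont_on {a..b} F"
proof -
  have "compact (F' ` {a..b})"
    by (rule compact_continuous_image) (use cont continuous_on_subset in auto)
  then obtain B where B: "\<And>s. s \<in> {a..b} \<Longrightarrow> norm (F' s) \<le> B"
    using compact_imp_bounded[of "F' ` {a..b}"] unfolding bounded_iff by blast
  show ?thesis
  proof (rule abs_cont_on_lipschitz[of _ _ _ B])
    fix x y assume xy: "x \<in> {a..b}" "y \<in> {a..b}"
    have "norm (F x - F y) \<le> B * norm (x - y)"
      by (rule field_differentiable_bound[of "{a..b}" F F'])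
        (use xy B der in \<open>auto intro: has_field_derivative_at_within\<close>)
    then show "\<bar>F y - F x\<bar> \<le> B * \<bar>y - x\<bar>" by (simp add: abs_minus_commute)
  qed
qed

lemma abs_cont_on_compose_lipschitz:
  assumes A: "abs_cont_on {a..b} A" and L: "\<And>x y. \<bar>\<phi> x - \<phi> y\<bar> \<le> L * \<bar>x - y\<bar>"
  shows "abs_cont_on {a..b} (\<lambda>s. \<phi> (A s))"
proof (rule abs_cont_on_increment_bound[OF A A, where K="\<bar>L\<bar>"])
  fix x y
  have "L * \<bar>A y - A x\<bar> \<le> \<bar>L\<bar> * \<bar>A y - A x\<bar>" by (rule mult_right_mono) auto
  then show "\<bar>\<phi> (A y) - \<phi> (A x)\<bar> \<le> \<bar>L\<bar> * \<bar>A y - A x\<bar> + \<bar>L\<bar> * \<bar>A y - A x\<bar>"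
    using L[of "A y" "A x"] by (smt (verit) abs_ge_zero mult_nonneg_nonneg)
qed

lemma abs_cont_on_mult:
  assumes A: "abs_cont_on {a..b} A" and B: "abs_cont_on {a..b} B"
  shows "abs_cont_on {a..b} (\<lambda>s. A s * B s)"
proof -
  have "bounded (A ` {a..b})" "bounded (B ` {a..b})"
    using A B by (auto intro!: compact_imp_bounded compact_continuous_image abs_cont_on_imp_continuous_on)
  then obtain K1 K2 where K: "\<And>s. s \<in> {a..b} \<Longrightarrow> \<bar>A s\<bar> \<le> K1" "\<And>s. s \<in> {a..b} \<Longrightarrow> \<bar>B s\<bar> \<le> K2"
    unfolding bounded_iff real_norm_def by blast
  show ?thesis
  proof (rule abs_cont_on_increment_bound[OF A B, where K="max K1 K2"])
    fix x y assume xy: "x \<in> {a..b}" "y \<in> {a..b}"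
    have "A y * B y - A x * B x = (A y - A x) * B y + A x * (B y - B x)" by (simp add: algebra_simps)
    then have "\<bar>A y * B y - A x * B x\<bar> \<le> \<bar>B y\<bar> * \<bar>A y - A x\<bar> + \<bar>A x\<bar> * \<bar>B y - B x\<bar>"
      by (metis abs_mult abs_triangle_ineq mult.commute)
    also have "\<dots> \<le> max K1 K2 * \<bar>A y - A x\<bar> + max K1 K2 * \<bar>B y - B x\<bar>"
      using K[OF xy(1)] K[OF xy(2)] by (intro add_mono mult_right_mono) auto
    finally show "\<bar>A y * B y - A x * B x\<bar> \<le> max K1 K2 * \<bar>A y - A x\<bar> + max K1 K2 * \<bar>B y - B x\<bar>" .
  qed
qed

section \<open>Test functions and weak derivatives\<close>

text \<open>Smoothness is required along axis \<open>i\<close>, with the derivative carried as a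
  separate function; the last clause is compact support.\<close>

definition C1_test_function :: "'n::finite \<Rightarrow> (real ^ 'n \<Rightarrow> real) \<Rightarrow> (real ^ 'n \<Rightarrow> real) \<Rightarrow> bool" where
  "C1_test_function i \<theta> \<theta>' \<longleftrightarrow> continuous_on UNIV \<theta> \<and> continuous_on UNIV \<theta>' \<and>
     (\<forall>x. ((\<lambda>s. \<theta> (x + s *\<^sub>R axis i 1)) has_real_derivative \<theta>' x) (at 0)) \<and>
     (\<exists>R. \<forall>x. norm x > R \<longrightarrow> \<theta> x = 0 \<and> \<theta>' x = 0)"

lemma line_derivative_shift:
  fixes \<theta> :: "real ^ 'n::finite \<Rightarrow> real"
  assumes "\<And>x. ((\<lambda>s. \<theta> (x + s *\<^sub>R axis i 1)) has_real_derivative \<theta>' x) (at 0)"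
  shows "((\<lambda>s. \<theta> (x + s *\<^sub>R axis i 1)) has_real_derivative \<theta>' (x + s *\<^sub>R axis i 1)) (at s)"
proof -
  have "((\<lambda>r. \<theta> (x + (r + s) *\<^sub>R axis i 1)) has_real_derivative \<theta>' (x + s *\<^sub>R axis i 1)) (at 0)"
    using assms[of "x + s *\<^sub>R axis i 1"] by (simp add: algebra_simps)
  then show ?thesis by (simp add: DERIV_shift[of _ _ 0 s, simplified])
qed

text \<open>No differentiability enters: both sides select from the same set of derivatives, even if
  that set is empty.\<close>

lemma partial_deriv_line:
  "partial_deriv g i (x + s *\<^sub>R axis i 1) = deriv (\<lambda>r. g (x + r *\<^sub>R axis i 1)) s"
proof -
  have "(\<lambda>r. g (x + s *\<^sub>R axis i 1 + r *\<^sub>R axis i 1)) = (\<lambda>r. g (x + (s + r) *\<^sub>R axis i 1))"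
    by (simp add: algebra_simps)
  then show ?thesis
    unfolding partial_deriv_def deriv_def
    by (simp add: DERIV_shift[of _ _ 0 s, simplified] add.commute[of s])
qed

text \<open>Measurability is extracted from the integrability clause: integrable on a ball includes
  measurable there, and the balls exhaust the space.\<close>

lemma borel_measurable_partial_deriv:
  fixes g :: "real ^ 'n::finite \<Rightarrow> real"
  assumes "absolutely_continuous_fun g"
  shows "partial_deriv g i \<in> borel_measurable borel"
proof (rule borel_measurable_LIMSEQ_real)
  fix n :: nat
  show "(\<lambda>x. indicator (cball 0 (real n)) x *\<^sub>R partial_deriv g i x) \<in> borel_measurable borel"
    using assms compact_cball[of "0 :: real ^ 'n" "real n"]
    unfolding absolutely_continuous_fun_def set_integrable_def
    by (metis borel_measurable_integrable measurable_lborel2)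
next
  fix x :: "real ^ 'n"
  obtain n0 where n0: "norm x \<le> real n0" using real_arch_simple by blast
  have "eventually (\<lambda>n. indicator (cball 0 (real n)) x *\<^sub>R partial_deriv g i x = partial_deriv g i x) sequentially"
    using eventually_ge_at_top[of n0] by eventually_elim (use n0 in \<open>auto simp: indicator_def\<close>)
  then show "(\<lambda>n. indicator (cball 0 (real n)) x *\<^sub>R partial_deriv g i x) \<longlonglongrightarrow> partial_deriv g i x"
    by (rule tendsto_eventually)
qed

lemma lborel_translation:
  fixes F :: "'a::euclidean_space \<Rightarrow> real"
  assumes "integrable lborel F"
  shows "integrable lborel (\<lambda>x. F (x + a))" "(LINT x|lborel. F (x + a)) = (LINT x|lborel. F x)"
proof -
  have [measurable]: "F \<in> borel_measurable borel" using assms by auto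
  have eq: "distr lborel borel (\<lambda>x. a + x) = (lborel :: 'a measure)" by (rule lborel_distr_plus)
  have "integrable (distr lborel borel (\<lambda>x. a + x)) F" unfolding eq by (rule assms)
  then show "integrable lborel (\<lambda>x. F (x + a))" by (subst (asm) integrable_distr_eq) (auto simp: add.commute)
  have "(LINT x|distr lborel borel (\<lambda>x. a + x). F x) = (LINT x|lborel. F x)" unfolding eq ..
  then show "(LINT x|lborel. F (x + a)) = (LINT x|lborel. F x)" by (subst (asm) integral_distr) (auto simp: add.commute)
qed

text \<open>By translation invariance the integral of \<open>F\<close> equals its average over all unit segments in
  direction \<open>i\<close>; on almost every segment \<open>F\<close> is the derivative of \<open>\<phi> \<circ> g \<cdot> \<theta>\<close>.\<close>

lemma weak_derivative:
  fixes g :: "real ^ 'n::finite \<Rightarrow> real"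
  assumes ac: "absolutely_continuous_fun g" and test: "C1_test_function i \<theta> \<theta>'"
    and \<phi>: "\<And>w. (\<phi> has_real_derivative \<psi> w) (at w)" and \<psi>: "\<And>w. \<bar>\<psi> w\<bar> \<le> L"
    and \<psi>m[measurable]: "\<psi> \<in> borel_measurable borel"
  shows "integrable lborel (\<lambda>x. \<psi> (g x) * partial_deriv g i x * \<theta> x)"
    and "integrable lborel (\<lambda>x. \<phi> (g x) * \<theta>' x)"
    and "(LINT x|lborel. \<psi> (g x) * partial_deriv g i x * \<theta> x) = - (LINT x|lborel. \<phi> (g x) * \<theta>' x)"
proof -
  have g_cont: "continuous_on UNIV g" using ac by (simp add: absolutely_continuous_fun_def)
  have \<phi>_cont: "continuous_on UNIV \<phi>" using \<phi> by (meson DERIV_isCont continuous_at_imp_continuous_on)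
  have [measurable]: "g \<in> borel_measurable borel" "\<phi> \<in> borel_measurable borel"
    using g_cont \<phi>_cont by (auto intro: borel_measurable_continuous_onI)
  have [measurable]: "partial_deriv g i \<in> borel_measurable borel" by (rule borel_measurable_partial_deriv[OF ac])
  from test obtain R where \<theta>: "continuous_on UNIV \<theta>" "continuous_on UNIV \<theta>'"
    "\<And>x. ((\<lambda>s. \<theta> (x + s *\<^sub>R axis i 1)) has_real_derivative \<theta>' x) (at 0)"
    "\<And>x. norm x > R \<Longrightarrow> \<theta> x = 0" "\<And>x. norm x > R \<Longrightarrow> \<theta>' x = 0"
    unfolding C1_test_function_def by metis
  have [measurable]: "\<theta> \<in> borel_measurable borel" "\<theta>' \<in> borel_measurable borel"
    using \<theta> by (auto intro: borel_measurable_continuous_onI)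
  have bd: "\<exists>C. \<forall>x\<in>cball 0 R. \<bar>f x\<bar> \<le> C" if "continuous_on UNIV f" for f :: "real ^ 'n \<Rightarrow> real"
  proof -
    have "compact (f ` cball 0 R)" by (rule compact_continuous_image) (use that continuous_on_subset in auto)
    then show ?thesis by (auto dest!: compact_imp_bounded simp: bounded_iff)
  qed
  obtain C where C: "\<And>x. x \<in> cball 0 R \<Longrightarrow> \<bar>\<theta> x\<bar> \<le> C" using bd[OF \<theta>(1)] by blast
  have cont2: "continuous_on UNIV (\<lambda>x. \<phi> (g x) * \<theta>' x)"
    by (intro continuous_intros continuous_on_compose2[OF \<phi>_cont g_cont] \<theta>) auto
  obtain C' where C': "\<And>x. x \<in> cball 0 R \<Longrightarrow> \<bar>\<phi> (g x) * \<theta>' x\<bar> \<le> C'" using bd[OF cont2] by blast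
  have pd: "integrable lborel (\<lambda>x. indicator (cball 0 R) x *\<^sub>R partial_deriv g i x)"
    using ac compact_cball[of "0 :: real ^ 'n" R] unfolding absolutely_continuous_fun_def set_integrable_def by blast
  show int1: "integrable lborel (\<lambda>x. \<psi> (g x) * partial_deriv g i x * \<theta> x)"
  proof (rule Bochner_Integration.integrable_bound[OF integrable_mult_left[OF pd, of "L * C"]])
    have "norm (\<psi> (g x) * partial_deriv g i x * \<theta> x) \<le> norm (indicator (cball 0 R) x *\<^sub>R partial_deriv g i x * (L * C))" for x
    proof (cases "norm x > R")
      case False
      then have x: "x \<in> cball 0 R" by simp
      have "\<bar>\<psi> (g x)\<bar> * \<bar>\<theta> x\<bar> \<le> L * C"
        using \<psi>[of "g x"] C[OF x] by (intro mult_mono) auto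
      then have "\<bar>\<psi> (g x)\<bar> * \<bar>\<theta> x\<bar> * \<bar>partial_deriv g i x\<bar> \<le> \<bar>L * C\<bar> * \<bar>partial_deriv g i x\<bar>"
        by (intro mult_right_mono) auto
      then show ?thesis using x by (simp add: abs_mult mult_ac)
    qed (use \<theta> in simp)
    then show "AE x in lborel. norm (\<psi> (g x) * partial_deriv g i x * \<theta> x)
        \<le> norm (indicator (cball 0 R) x *\<^sub>R partial_deriv g i x * (L * C))" by simp
  qed measurable
  show int2: "integrable lborel (\<lambda>x. \<phi> (g x) * \<theta>' x)"
  proof (rule integrableI_bounded_set[of "cball 0 R" _ _ C'])
    show "AE x in lborel. x \<notin> cball 0 R \<longrightarrow> \<phi> (g x) * \<theta>' x = 0" using \<theta> by auto
    show "emeasure lborel (cball (0::real^'n) R) < \<infinity>" using emeasure_lborel_cball_finite by (simp add: less_top)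
  qed (use C' in auto)
  define F where "F x = \<psi> (g x) * partial_deriv g i x * \<theta> x + \<phi> (g x) * \<theta>' x" for x
  define H where "H x = \<phi> (g x) * \<theta> x" for x
  have Fi: "integrable lborel F" unfolding F_def by (intro Bochner_Integration.integrable_add int1 int2)
  have [measurable]: "F \<in> borel_measurable borel" using Fi by auto
  have H_cont: "continuous_on UNIV H" unfolding H_def
    by (intro continuous_intros continuous_on_compose2[OF \<phi>_cont g_cont] \<theta>) auto
  have [measurable]: "H \<in> borel_measurable borel" using H_cont by (rule borel_measurable_continuous_onI)
  have Hi: "integrable lborel H"
  proof -
    obtain C'' where "\<And>x. x \<in> cball 0 R \<Longrightarrow> \<bar>H x\<bar> \<le> C''" using bd[OF H_cont] by blast
    then show ?thesis
      by (intro integrableI_bounded_set[of "cball 0 R" _ _ C''])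
        (use \<theta> emeasure_lborel_cball_finite[of "0::real^'n" R] in \<open>auto simp: H_def less_top\<close>)
  qed
  let ?e = "axis i 1 :: real ^ 'n"
  have lineAC: "AE x in lborel. (LINT s:{0..1}|lborel. F (x + s *\<^sub>R ?e)) = H (x + ?e) - H x"
  proof -
    have "AE x in lborel. \<forall>a b. abs_cont_on {a..b} (\<lambda>s. g (x + s *\<^sub>R ?e))"
      using ac by (simp add: absolutely_continuous_fun_def)
    then show ?thesis
    proof eventually_elim
      case (elim x)
      \<comment> \<open>The bound on \<psi> makes \<phi> Lipschitz, and composition with a Lipschitz
        function preserves absolute continuity on the segment.\<close>
      have Lip: "\<bar>\<phi> u - \<phi> v\<bar> \<le> L * \<bar>u - v\<bar>" for u v
        using field_differentiable_bound[of UNIV \<phi> \<psi> L u v] \<phi> \<psi> by auto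
      have dchi: "((\<lambda>s. \<theta> (x + s *\<^sub>R ?e)) has_real_derivative \<theta>' (x + s *\<^sub>R ?e)) (at s)" for s
        by (rule line_derivative_shift) (rule \<theta>(3))
      have acH: "abs_cont_on {0..1} (\<lambda>s. H (x + s *\<^sub>R ?e))"
        unfolding H_def
        by (intro abs_cont_on_mult abs_cont_on_compose_lipschitz[OF _ Lip] abs_cont_on_C1[OF dchi])
          (use elim in \<open>auto intro!: continuous_intros continuous_on_compose2[OF \<theta>(2)]\<close>)
      have "(LINT s:{0..1}|lborel. F (x + s *\<^sub>R ?e)) = H (x + 1 *\<^sub>R ?e) - H (x + 0 *\<^sub>R ?e)"
      proof (rule abs_cont_on_FTC(2)[OF acH])
        have "AE s in lborel. s \<in> {0<..<1} \<longrightarrow>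
            ((\<lambda>s. g (x + s *\<^sub>R ?e)) has_real_derivative deriv (\<lambda>s. g (x + s *\<^sub>R ?e)) s) (at s)"
          by (rule abs_cont_on_differentiable_AE) (use elim in auto)
        then show "AE s in lborel. s \<in> {0<..<1} \<longrightarrow>
            ((\<lambda>s. H (x + s *\<^sub>R ?e)) has_real_derivative F (x + s *\<^sub>R ?e)) (at s)"
        proof eventually_elim
          case (elim s)
          show ?case
          proof
            assume s: "s \<in> {0<..<1}"
            then have dg: "((\<lambda>s. g (x + s *\<^sub>R ?e)) has_real_derivative partial_deriv g i (x + s *\<^sub>R ?e)) (at s)"
              using elim by (simp add: partial_deriv_line)
            show "((\<lambda>s. H (x + s *\<^sub>R ?e)) has_real_derivative F (x + s *\<^sub>R ?e)) (at s)"
              unfolding H_def F_def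
              by (rule DERIV_cong[OF DERIV_mult[OF DERIV_chain2[OF \<phi> dg] dchi]]) simp
          qed
        qed
      qed auto
      then show ?case by simp
    qed
  qed
  have [measurable]: "(\<lambda>p. F (snd p + fst p *\<^sub>R ?e)) \<in> borel_measurable (borel \<Otimes>\<^sub>M borel)" by measurable
  \<comment> \<open>By translation invariance the inner integral of the absolute value is the same
    for all \<open>s\<close> in the unit interval, which supplies the hypothesis of Fubini's
    theorem.\<close>
  have dbl: "integrable lborel2 (\<lambda>(s, x). indicator {0..1} s *\<^sub>R F (x + s *\<^sub>R ?e))"
  proof (rule lborel_pair.Fubini_integrable)
    show "(\<lambda>(s, x). indicator {0..1} s *\<^sub>R F (x + s *\<^sub>R ?e)) \<in> borel_measurable lborel2" by measurable
    have "(LINT x|lborel. norm (indicator {0..1} s *\<^sub>R F (x + s *\<^sub>R ?e))) = indicator {0..1} s *\<^sub>R (LINT x|lborel. \<bar>F x\<bar>)" for s :: real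
      using lborel_translation(2)[OF integrable_abs[OF Fi], of "s *\<^sub>R ?e"] by (simp add: abs_mult)
    then show "integrable lborel (\<lambda>s. LINT x|lborel. norm (case (s, x) of (s, x) \<Rightarrow> indicator {0..1} s *\<^sub>R F (x + s *\<^sub>R ?e)))"
      by simp
    show "AE s in lborel. integrable lborel (\<lambda>x. case (s, x) of (s, x) \<Rightarrow> indicator {0..1} s *\<^sub>R F (x + s *\<^sub>R ?e))"
      using lborel_translation(1)[OF Fi] by (intro AE_I2) simp
  qed
  have "(LINT x|lborel. F x) = (LINT s:{0..1::real}|lborel. LINT x|lborel. F x)"
    by (simp add: set_lebesgue_integral_def)
  also have "\<dots> = (LINT s|lborel. LINT x|lborel. indicator {0..1} s *\<^sub>R F (x + s *\<^sub>R ?e))"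
    unfolding set_lebesgue_integral_def using lborel_translation(2)[OF Fi]
    by (intro Bochner_Integration.integral_cong refl) simp
  also have "\<dots> = (LINT x|lborel. LINT s|lborel. indicator {0..1} s *\<^sub>R F (x + s *\<^sub>R ?e))"
    by (rule lborel_pair.Fubini_integral[OF dbl, symmetric])
  also have "\<dots> = (LINT x|lborel. H (x + ?e) - H x)"
    by (rule integral_cong_AE) (use lineAC in \<open>auto simp: set_lebesgue_integral_def\<close>)
  also have "\<dots> = 0"
    using lborel_translation[OF Hi, of ?e] Hi by simp
  finally have "(LINT x|lborel. F x) = 0" .
  then show "(LINT x|lborel. \<psi> (g x) * partial_deriv g i x * \<theta> x) = - (LINT x|lborel. \<phi> (g x) * \<theta>' x)"
    unfolding F_def using int1 int2 by simp
qed

section \<open>The standard Gaussian measure\<close>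

text \<open>Density of the centred Gaussian whose covariance is \<open>s\<close> times the identity;
  \<open>s\<close> is a variance, not a standard deviation.\<close>

definition gauss_kernel :: "real \<Rightarrow> real ^ 'n::finite \<Rightarrow> real" where
  "gauss_kernel s w = (1 / sqrt (2 * pi * s)) ^ CARD('n) * exp (- (norm w)\<^sup>2 / (2 * s))"

definition std_gaussian :: "(real ^ 'n::finite) measure" where
  "std_gaussian = density lborel (\<lambda>x. ennreal (gauss_kernel 1 x))"

lemma gauss_kernel_pos: "s > 0 \<Longrightarrow> gauss_kernel s w > 0"
  by (simp add: gauss_kernel_def)

lemma gauss_kernel_nonneg: "s \<ge> 0 \<Longrightarrow> gauss_kernel s w \<ge> 0"
  by (simp add: gauss_kernel_def)

lemma gauss_kernel_measurable[measurable (raw)]: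
  assumes [measurable]: "f \<in> borel_measurable M" "h \<in> borel_measurable M"
  shows "(\<lambda>x. gauss_kernel (f x) (h x)) \<in> borel_measurable M"
  unfolding gauss_kernel_def by measurable

lemma sets_std_gaussian[measurable_cong, simp]: "sets std_gaussian = sets borel"
  by (simp add: std_gaussian_def)

lemma space_std_gaussian[simp]: "space std_gaussian = UNIV"
  by (simp add: std_gaussian_def)

lemma norm_power2_vec: "(norm (x :: real ^ 'n::finite))\<^sup>2 = (\<Sum>i\<in>UNIV. (x $ i)\<^sup>2)"
  by (simp add: norm_vec_def L2_set_def sum_nonneg)

lemma gauss_kernel_1_prod:
  "gauss_kernel 1 (x :: real ^ 'n::finite) = (\<Prod>i\<in>UNIV. std_normal_density (x $ i))"
proof -
  have "(\<Prod>i\<in>UNIV. std_normal_density (x $ i)) = (\<Prod>i\<in>(UNIV::'n set). 1 / sqrt (2 * pi)) * (\<Prod>i\<in>UNIV. exp (- (x $ i)\<^sup>2 / 2))"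
    by (simp only: prod.distrib[symmetric] normal_density_def) simp
  also have "(\<Prod>i\<in>UNIV. exp (- (x $ i)\<^sup>2 / 2)) = exp (\<Sum>i\<in>UNIV. - (x $ i)\<^sup>2 / 2)"
    by (rule exp_sum[symmetric]) simp
  also have "(\<Sum>i\<in>UNIV. - (x $ i)\<^sup>2 / 2) = - (norm x)\<^sup>2 / 2"
    by (simp only: norm_power2_vec sum_divide_distrib[symmetric] sum_negf)
  finally show ?thesis by (simp add: gauss_kernel_def)
qed

section \<open>The Gaussian measure as a product measure\<close>

lemma measurable_vec_lambda[measurable]:
  "vec_lambda \<in> measurable (PiM UNIV (\<lambda>_::'n::finite. borel :: real measure)) (borel :: (real ^ 'n) measure)"
proof (rule borel_measurable_euclidean_space[THEN iffD2], rule ballI)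
  fix b :: "real ^ 'n" assume "b \<in> Basis"
  then obtain i where b: "b = axis i 1" by (auto simp: Basis_vec_def)
  have "(\<lambda>x. vec_lambda x \<bullet> b) = (\<lambda>f. f i)" by (simp add: b inner_axis)
  then show "(\<lambda>x. vec_lambda x \<bullet> b) \<in> borel_measurable (PiM UNIV (\<lambda>_::'n. borel :: real measure))" by simp
qed

text \<open>Lebesgue measure is determined by boxes, and the preimage of a box under
  \<open>vec_lambda\<close> is a product of intervals.\<close>

lemma lborel_eq_PiM_vec:
  "(lborel :: (real ^ 'n::finite) measure) = distr (PiM UNIV (\<lambda>_. lborel)) borel vec_lambda"
proof (rule lborel_eqI)
  have vm: "vec_lambda \<in> measurable (PiM UNIV (\<lambda>_::'n. lborel :: real measure)) (borel :: (real ^ 'n) measure)"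
    using measurable_vec_lambda by (simp cong: measurable_cong_sets sets_PiM_cong)
  fix l u :: "real ^ 'n" assume lu: "\<And>b. b \<in> Basis \<Longrightarrow> l \<bullet> b \<le> u \<bullet> b"
  have lu': "l $ i \<le> u $ i" for i using lu[of "axis i 1"] by (auto simp: inner_axis Basis_vec_def)
  have "vec_lambda -` box l u \<inter> space (PiM UNIV (\<lambda>_::'n. lborel :: real measure)) = PiE UNIV (\<lambda>i. {l $ i <..< u $ i})"
    by (auto simp: space_PiM box_vec_eq_empty PiE_def Pi_def mem_box_cart)
  then have "emeasure (distr (PiM UNIV (\<lambda>_::'n. lborel)) borel vec_lambda) (box l u)
      = emeasure (PiM UNIV (\<lambda>_::'n. lborel)) (PiE UNIV (\<lambda>i. {l $ i <..< u $ i}))"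
    using vm by (subst emeasure_distr) auto
  also have "\<dots> = (\<Prod>i\<in>UNIV. ennreal (u $ i - l $ i))"
  proof -
    interpret product_sigma_finite "\<lambda>_::'n. lborel :: real measure" by standard
    show ?thesis by (subst emeasure_PiM) (auto simp: lu' intro!: prod.cong)
  qed
  also have "\<dots> = ennreal (\<Prod>i\<in>UNIV. u $ i - l $ i)" by (simp add: prod_ennreal lu')
  also have "(\<Prod>i\<in>UNIV. u $ i - l $ i) = (\<Prod>b\<in>Basis. (u - l) \<bullet> b)"
  proof -
    have B: "(Basis :: (real ^ 'n) set) = (\<lambda>i. axis i 1) ` UNIV" by (auto simp: Basis_vec_def)
    have "inj (\<lambda>i::'n. axis i (1::real))" by (auto simp: inj_def axis_eq_axis)
    then show ?thesis unfolding B by (subst prod.reindex) (auto simp: inner_axis)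
  qed
  finally show "emeasure (distr (PiM UNIV (\<lambda>_::'n. lborel)) borel vec_lambda) (box l u) = ennreal (\<Prod>b\<in>Basis. (u - l) \<bullet> b)" .
qed simp

text \<open>Connects independent normal coordinates with a density on the vector space: the density
  factorises, and a product measure is determined by rectangles.\<close>

lemma std_gaussian_eq_PiM:
  "(std_gaussian :: (real ^ 'n::finite) measure) =
     distr (PiM UNIV (\<lambda>_. density lborel (\<lambda>y. ennreal (std_normal_density y)))) borel vec_lambda"
proof -
  interpret product_sigma_finite "\<lambda>_::'n. lborel :: real measure" by standard
  interpret N0: prob_space "density lborel (\<lambda>y. ennreal (std_normal_density y))"
    by (rule prob_space_normal_density) simp
  interpret N: product_sigma_finite "\<lambda>_::'n. density lborel (\<lambda>y. ennreal (std_normal_density y))"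
    by (simp add: product_sigma_finite_def N0.sigma_finite_measure_axioms)
  have vm: "vec_lambda \<in> measurable (PiM UNIV (\<lambda>_::'n. lborel :: real measure)) (borel :: (real ^ 'n) measure)"
    using measurable_vec_lambda by (simp cong: measurable_cong_sets sets_PiM_cong)
  have "density (PiM UNIV (\<lambda>_::'n. lborel)) (\<lambda>f. ennreal (\<Prod>i\<in>UNIV. std_normal_density (f i)))
      = PiM UNIV (\<lambda>_::'n. density lborel (\<lambda>y. ennreal (std_normal_density y)))"
  proof (rule N.PiM_eqI)
    fix A :: "'n \<Rightarrow> real set" assume "\<And>i. i \<in> UNIV \<Longrightarrow> A i \<in> sets (density lborel (\<lambda>y. ennreal (std_normal_density y)))"
    then have A[measurable]: "A i \<in> sets borel" for i by simp
    have "emeasure (density (PiM UNIV (\<lambda>_::'n. lborel)) (\<lambda>f. ennreal (\<Prod>i\<in>UNIV. std_normal_density (f i)))) (PiE UNIV A)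
        = (\<integral>\<^sup>+f. ennreal (\<Prod>i\<in>UNIV. std_normal_density (f i)) * indicator (PiE UNIV A) f \<partial>PiM UNIV (\<lambda>_::'n. lborel))"
      by (rule emeasure_density) (auto intro!: sets_PiM_I_finite)
    also have "\<dots> = (\<integral>\<^sup>+f. (\<Prod>i\<in>UNIV. ennreal (std_normal_density (f i)) * indicator (A i) (f i)) \<partial>PiM UNIV (\<lambda>_::'n. lborel))"
    proof (rule nn_integral_cong)
      fix f :: "'n \<Rightarrow> real"
      have "(indicator (PiE UNIV A) f :: ennreal) = (\<Prod>i\<in>UNIV. indicator (A i) (f i))"
        by (auto simp: indicator_def PiE_def Pi_def prod_zero_iff)
      then show "ennreal (\<Prod>i\<in>UNIV. std_normal_density (f i)) * indicator (PiE UNIV A) f =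
          (\<Prod>i\<in>UNIV. ennreal (std_normal_density (f i)) * indicator (A i) (f i))"
        by (simp add: prod.distrib prod_ennreal)
    qed
    also have "\<dots> = (\<Prod>i\<in>UNIV. \<integral>\<^sup>+y. ennreal (std_normal_density y) * indicator (A i) y \<partial>lborel)"
      by (rule product_nn_integral_prod) auto
    also have "\<dots> = (\<Prod>i\<in>UNIV. emeasure (density lborel (\<lambda>y. ennreal (std_normal_density y))) (A i))"
      by (intro prod.cong refl) (simp add: emeasure_density)
    finally show "emeasure (density (PiM UNIV (\<lambda>_::'n. lborel)) (\<lambda>f. ennreal (\<Prod>i\<in>UNIV. std_normal_density (f i)))) (PiE UNIV A)
        = (\<Prod>i\<in>UNIV. emeasure (density lborel (\<lambda>y. ennreal (std_normal_density y))) (A i))" .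
  next
    show "sets (density (PiM UNIV (\<lambda>_::'n. lborel)) (\<lambda>f. ennreal (\<Prod>i\<in>UNIV. std_normal_density (f i)))) =
      sets (PiM UNIV (\<lambda>_::'n. density lborel (\<lambda>y. ennreal (std_normal_density y))))"
      by (simp cong: sets_PiM_cong)
  qed simp
  moreover have "std_gaussian = density (distr (PiM UNIV (\<lambda>_::'n. lborel)) borel vec_lambda) (\<lambda>x. ennreal (gauss_kernel 1 x))"
    by (simp add: std_gaussian_def lborel_eq_PiM_vec[symmetric])
  moreover have "\<dots> = distr (density (PiM UNIV (\<lambda>_::'n. lborel)) (\<lambda>f. ennreal (gauss_kernel 1 (vec_lambda f)))) borel vec_lambda"
    by (rule density_distr) (use vm in auto)
  ultimately show ?thesis by (simp add: gauss_kernel_1_prod)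
qed

lemma prob_space_std_gaussian: "prob_space (std_gaussian :: (real ^ 'n::finite) measure)"
proof -
  have N: "prob_space (density lborel (\<lambda>y. ennreal (std_normal_density y)))"
    by (rule prob_space_normal_density) simp
  have "prob_space (PiM UNIV (\<lambda>_::'n. density lborel (\<lambda>y. ennreal (std_normal_density y))))"
    by (rule prob_space_PiM) (rule N)
  then show ?thesis
    unfolding std_gaussian_eq_PiM
    by (rule prob_space.prob_space_distr) (use measurable_vec_lambda in \<open>simp cong: measurable_cong_sets sets_PiM_cong\<close>)
qed

interpretation std_gaussian: prob_space "std_gaussian :: (real ^ 'n::finite) measure"
  by (rule prob_space_std_gaussian)

lemma std_gaussian_vector_law:
  fixes X :: "'a \<Rightarrow> real ^ 'n::finite"
  assumes "prob_space M" and X: "std_gaussian_vector M X"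
  shows "X \<in> borel_measurable M" and "distr M borel X = std_gaussian"
proof -
  interpret prob_space M by fact
  have ind: "indep_vars (\<lambda>_. borel) (\<lambda>i \<omega>. X \<omega> $ i) UNIV"
    and d: "\<And>i. distributed M lborel (\<lambda>\<omega>. X \<omega> $ i) (\<lambda>y. ennreal (std_normal_density y))"
    using X by (auto simp: std_gaussian_vector_def)
  have Xi[measurable]: "(\<lambda>\<omega>. X \<omega> $ i) \<in> borel_measurable M" for i
    using ind by (auto simp: indep_vars_def)
  have X_eq: "X = (\<lambda>\<omega>. vec_lambda (\<lambda>i\<in>UNIV. X \<omega> $ i))" by (simp add: fun_eq_iff vec_eq_iff)
  have Ym[measurable]: "(\<lambda>\<omega>. \<lambda>i\<in>UNIV. X \<omega> $ i) \<in> measurable M (PiM UNIV (\<lambda>_. borel))" by measurable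
  show "X \<in> borel_measurable M" by (subst X_eq) measurable
  have "distr M borel X = distr (distr M (PiM UNIV (\<lambda>_. borel)) (\<lambda>\<omega>. \<lambda>i\<in>UNIV. X \<omega> $ i)) borel vec_lambda"
    by (subst distr_distr) (auto simp: comp_def X_eq[symmetric])
  also have "distr M (PiM UNIV (\<lambda>_. borel)) (\<lambda>\<omega>. \<lambda>i\<in>UNIV. X \<omega> $ i) = PiM UNIV (\<lambda>i. distr M borel (\<lambda>\<omega>. X \<omega> $ i))"
    using ind by (subst (asm) indep_vars_iff_distr_eq_PiM) auto
  also have "(\<lambda>i. distr M borel (\<lambda>\<omega>. X \<omega> $ i)) = (\<lambda>i. density lborel (\<lambda>y. ennreal (std_normal_density y)))"
  proof
    fix i
    have "distr M borel (\<lambda>\<omega>. X \<omega> $ i) = distr M lborel (\<lambda>\<omega>. X \<omega> $ i)" by (rule distr_cong) auto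
    then show "distr M borel (\<lambda>\<omega>. X \<omega> $ i) = density lborel (\<lambda>y. ennreal (std_normal_density y))"
      using d[of i] by (simp add: distributed_def)
  qed
  finally show "distr M borel X = std_gaussian" by (simp add: std_gaussian_eq_PiM)
qed

section \<open>Affine substitutions and moments\<close>

text \<open>In the substitution x = c + sqrt s y the Jacobian s^(n/2) cancels the normalisation.
  Kernel integrals around \<open>c\<close> thereby become expectations, and conversely.\<close>

lemma gauss_kernel_affine:
  fixes c :: "real ^ 'n::finite"
  assumes s: "s > 0"
  shows "density lborel (\<lambda>x. ennreal (gauss_kernel s (x - c))) = distr std_gaussian borel (\<lambda>y. c + sqrt s *\<^sub>R y)"
proof -
  let ?T = "\<lambda>y. c + sqrt s *\<^sub>R y"
  have sq: "sqrt s \<noteq> 0" using s by simp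
  have "density lborel (\<lambda>x. ennreal (gauss_kernel s (x - c)))
     = density (density (distr lborel borel ?T) (\<lambda>_. ennreal (\<bar>sqrt s\<bar> ^ DIM(real ^ 'n)))) (\<lambda>x. ennreal (gauss_kernel s (x - c)))"
    using lborel_affine[OF sq, of c] by simp
  also have "\<dots> = density (distr lborel borel ?T) (\<lambda>x. ennreal (\<bar>sqrt s\<bar> ^ CARD('n)) * ennreal (gauss_kernel s (x - c)))"
    by (subst density_density_eq) auto
  also have "\<dots> = distr (density lborel (\<lambda>y. ennreal (\<bar>sqrt s\<bar> ^ CARD('n)) * ennreal (gauss_kernel s (?T y - c)))) borel ?T"
    by (rule density_distr) auto
  also have "(\<lambda>y. ennreal (\<bar>sqrt s\<bar> ^ CARD('n)) * ennreal (gauss_kernel s (?T y - c))) = (\<lambda>y :: real ^ 'n. ennreal (gauss_kernel 1 y))"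
  proof
    fix y :: "real ^ 'n"
    have "\<bar>sqrt s\<bar> ^ CARD('n) * gauss_kernel s (?T y - c) = gauss_kernel 1 y"
      using s by (simp add: gauss_kernel_def power_mult_distrib real_sqrt_mult power_divide field_simps)
    then show "ennreal (\<bar>sqrt s\<bar> ^ CARD('n)) * ennreal (gauss_kernel s (?T y - c)) = ennreal (gauss_kernel 1 y)"
      using s by (simp add: ennreal_mult'[symmetric])
  qed
  finally show ?thesis by (simp add: std_gaussian_def)
qed

lemma gauss_kernel_nn_integral:
  fixes c :: "real ^ 'n::finite"
  assumes s: "s > 0" and [measurable]: "f \<in> borel_measurable borel"
  shows "(\<integral>\<^sup>+x. ennreal (gauss_kernel s (x - c)) * f x \<partial>lborel) = (\<integral>\<^sup>+y. f (c + sqrt s *\<^sub>R y) \<partial>std_gaussian)"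
proof -
  have "(\<integral>\<^sup>+x. f x \<partial>density lborel (\<lambda>x. ennreal (gauss_kernel s (x - c)))) = (\<integral>\<^sup>+y. f (c + sqrt s *\<^sub>R y) \<partial>std_gaussian)"
    unfolding gauss_kernel_affine[OF s] by (rule nn_integral_distr) auto
  then show ?thesis by (subst (asm) nn_integral_density) auto
qed

lemma gauss_kernel_integral:
  fixes c :: "real ^ 'n::finite" and f :: "real ^ 'n \<Rightarrow> real"
  assumes s: "s > 0" and [measurable]: "f \<in> borel_measurable borel"
  shows "integrable lborel (\<lambda>x. gauss_kernel s (x - c) * f x) \<longleftrightarrow> integrable std_gaussian (\<lambda>y. f (c + sqrt s *\<^sub>R y))"
    and "(LINT x|lborel. gauss_kernel s (x - c) * f x) = (LINT y|std_gaussian. f (c + sqrt s *\<^sub>R y))"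
proof -
  have nn: "AE x in lborel. 0 \<le> gauss_kernel s (x - c)" using s by (simp add: gauss_kernel_nonneg)
  have "integrable (density lborel (\<lambda>x. ennreal (gauss_kernel s (x - c)))) f \<longleftrightarrow> integrable std_gaussian (\<lambda>y. f (c + sqrt s *\<^sub>R y))"
    unfolding gauss_kernel_affine[OF s] by (rule integrable_distr_eq) auto
  then show "integrable lborel (\<lambda>x. gauss_kernel s (x - c) * f x) \<longleftrightarrow> integrable std_gaussian (\<lambda>y. f (c + sqrt s *\<^sub>R y))"
    by (subst (asm) integrable_density) (use nn in auto)
  have "(LINT x|density lborel (\<lambda>x. ennreal (gauss_kernel s (x - c))). f x) = (LINT y|std_gaussian. f (c + sqrt s *\<^sub>R y))"
    unfolding gauss_kernel_affine[OF s] by (rule integral_distr) auto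
  then show "(LINT x|lborel. gauss_kernel s (x - c) * f x) = (LINT y|std_gaussian. f (c + sqrt s *\<^sub>R y))"
    by (subst (asm) integral_density) (use nn in auto)
qed

lemma std_gaussian_integral:
  fixes f :: "real ^ 'n::finite \<Rightarrow> real"
  assumes [measurable]: "f \<in> borel_measurable borel"
  shows "integrable std_gaussian f \<longleftrightarrow> integrable lborel (\<lambda>x. gauss_kernel 1 x * f x)"
    and "(LINT x|std_gaussian. f x) = (LINT x|lborel. gauss_kernel 1 x * f x)"
  using gauss_kernel_integral[of 1 f 0] by simp_all

text \<open>Comparison with the Gaussian of variance 2, whose slower decay absorbs the polynomial.
  The outer square is what pairs with the second moment of \<open>g\<close> in
  \<open>g_moment\<close>.\<close>

lemma std_gaussian_moment: "integrable std_gaussian (\<lambda>y :: real ^ 'n::finite. (1 + (norm y)\<^sup>2)\<^sup>2)"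
proof -
  have 1: "integrable lborel (\<lambda>x :: real ^ 'n. gauss_kernel 2 x)"
    using gauss_kernel_integral(1)[of 2 "\<lambda>_. 1" "0 :: real ^ 'n"] by simp
  \<comment> \<open>The inequality 1 + u \<le> 8 exp (u/8), squared, costs exp (u/4), which is half
    of the available decay exp (- u/2); hence the 64.\<close>
  have bd: "(1 + u)\<^sup>2 * exp (- u / 2) \<le> 64 * exp (- u / 4)" if "u \<ge> 0" for u :: real
  proof -
    have "1 + u / 8 \<le> exp (u / 8)" by (rule exp_ge_add_one_self)
    then have "1 + u \<le> 8 * exp (u / 8)" by linarith
    then have "(1 + u)\<^sup>2 \<le> (8 * exp (u / 8))\<^sup>2" using that by (intro power_mono) auto
    also have "\<dots> = 64 * exp (u / 4)" by (simp add: power_mult_distrib exp_double[symmetric])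
    finally have "(1 + u)\<^sup>2 \<le> 64 * exp (u / 4)" .
    then have "(1 + u)\<^sup>2 * exp (- u / 2) \<le> 64 * exp (u / 4) * exp (- u / 2)" by (rule mult_right_mono) simp
    also have "64 * exp (u / 4) * exp (- u / 2) = 64 * exp (- u / 4)" by (simp add: exp_add[symmetric])
    finally show ?thesis .
  qed
  have c: "gauss_kernel 1 x * (1 + (norm x)\<^sup>2)\<^sup>2 \<le> 64 * sqrt 2 ^ CARD('n) * gauss_kernel 2 x" for x :: "real ^ 'n"
  proof -
    have "gauss_kernel 1 x * (1 + (norm x)\<^sup>2)\<^sup>2 =
        (1 / sqrt (2 * pi)) ^ CARD('n) * ((1 + (norm x)\<^sup>2)\<^sup>2 * exp (- (norm x)\<^sup>2 / 2))"
      by (simp add: gauss_kernel_def mult_ac)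
    also have "\<dots> \<le> (1 / sqrt (2 * pi)) ^ CARD('n) * (64 * exp (- (norm x)\<^sup>2 / 4))"
      by (rule mult_left_mono[OF bd]) auto
    also have "\<dots> = 64 * sqrt 2 ^ CARD('n) * gauss_kernel 2 x"
    proof -
      have "sqrt (2 * pi * 2) = sqrt (2 * pi) * sqrt 2" by (rule real_sqrt_mult)
      then have "1 / sqrt (2 * pi) = sqrt 2 * (1 / sqrt (2 * pi * 2))" by simp
      then have "(1 / sqrt (2 * pi)) ^ CARD('n) = sqrt 2 ^ CARD('n) * (1 / sqrt (2 * pi * 2)) ^ CARD('n)"
        by (simp only: power_mult_distrib)
      then show ?thesis by (simp add: gauss_kernel_def)
    qed
    finally show ?thesis .
  qed
  show ?thesis
    unfolding std_gaussian_integral(1)[of "\<lambda>y :: real ^ 'n. (1 + (norm y)\<^sup>2)\<^sup>2", simplified]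
    by (rule Bochner_Integration.integrable_bound[OF integrable_mult_right[OF 1, of "64 * sqrt 2 ^ CARD('n)"]])
      (use c in \<open>auto simp: gauss_kernel_nonneg abs_mult\<close>)
qed

section \<open>The joint density of the interpolation\<close>

text \<open>The density of Z at \<open>z\<close> times the conditional density at \<open>x\<close>
  of the interpolation given Z = z, which is Gaussian around \<open>sqrt t *\<^sub>R z\<close> with
  variance 1 - t.\<close>

definition mehler :: "real \<Rightarrow> real ^ 'n::finite \<Rightarrow> real ^ 'n \<Rightarrow> real" where
  "mehler t x z = gauss_kernel 1 z * gauss_kernel (1 - t) (x - sqrt t *\<^sub>R z)"

text \<open>The interpolation moves with velocity Z / (2 sqrt t) - Z' / (2 sqrt (1 - t)). Inserting
  Z' = (x - sqrt t z) / sqrt (1 - t) turns this into the fraction in front of \<open>mehler\<close>: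
  a flux is velocity times density.\<close>

definition mehler_flux :: "'n::finite \<Rightarrow> real \<Rightarrow> real ^ 'n \<Rightarrow> real ^ 'n \<Rightarrow> real" where
  "mehler_flux i t x z = (z $ i - sqrt t * x $ i) / (2 * sqrt t * (1 - t)) * mehler t x z"

text \<open>Product rule in \<open>x $ i\<close>: the summand \<open>- sqrt t\<close> comes from the
  velocity, the other one from the logarithmic derivative of the density.\<close>

definition mehler_flux_deriv :: "'n::finite \<Rightarrow> real \<Rightarrow> real ^ 'n \<Rightarrow> real ^ 'n \<Rightarrow> real" where
  "mehler_flux_deriv i t x z =
     (- sqrt t - (z $ i - sqrt t * x $ i) * (x $ i - sqrt t * z $ i) / (1 - t)) / (2 * sqrt t * (1 - t)) * mehler t x z"

lemma mehler_measurable[measurable (raw)]: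
  assumes [measurable]: "f \<in> borel_measurable M" "h \<in> borel_measurable M" "k \<in> borel_measurable M"
  shows "(\<lambda>x. mehler (f x) (h x) (k x)) \<in> borel_measurable M"
  unfolding mehler_def by measurable

lemma measurable_vec_nth[measurable (raw)]:
  assumes [measurable]: "f \<in> borel_measurable M"
  shows "(\<lambda>x. (f x :: real ^ 'n::finite) $ i) \<in> borel_measurable M"
proof -
  have "(\<lambda>x. f x $ i) = (\<lambda>x. f x \<bullet> axis i 1)" by (simp add: inner_axis)
  then show ?thesis by simp
qed

lemma mehler_flux_measurable[measurable (raw)]:
  assumes [measurable]: "f \<in> borel_measurable M" "h \<in> borel_measurable M" "k \<in> borel_measurable M"
  shows "(\<lambda>x. mehler_flux i (f x) (h x) (k x)) \<in> borel_measurable M"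
    "(\<lambda>x. mehler_flux_deriv i (f x) (h x) (k x)) \<in> borel_measurable M"
  unfolding mehler_flux_def mehler_flux_deriv_def by measurable

lemma mehler_pos: "t < 1 \<Longrightarrow> mehler t x z > 0"
  by (simp add: mehler_def gauss_kernel_pos)

lemma norm_diff_scaleR_power2:
  "(norm (x - c *\<^sub>R z :: real ^ 'n::finite))\<^sup>2 = (norm x)\<^sup>2 - 2 * c * (x \<bullet> z) + c\<^sup>2 * (norm z)\<^sup>2"
  unfolding power2_norm_eq_inner inner_diff_left inner_diff_right inner_scaleR_left inner_scaleR_right
  by (simp add: inner_commute power2_eq_square algebra_simps)

lemma mehler_explicit:
  assumes "0 \<le> t" "t < 1"
  shows "mehler t (x :: real ^ 'n::finite) z = (1 / sqrt (2 * pi)) ^ CARD('n) * (1 / sqrt (2 * pi * (1 - t))) ^ CARD('n) *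
     exp (- ((norm x)\<^sup>2 + (norm z)\<^sup>2 - 2 * sqrt t * (x \<bullet> z)) / (2 * (1 - t)))"
proof -
  have "- (norm z)\<^sup>2 / (2 * 1) + - (norm (x - sqrt t *\<^sub>R z))\<^sup>2 / (2 * (1 - t))
     = - ((norm x)\<^sup>2 + (norm z)\<^sup>2 - 2 * sqrt t * (x \<bullet> z)) / (2 * (1 - t))"
    using assms by (simp add: norm_diff_scaleR_power2 divide_simps) (simp add: algebra_simps)
  then show ?thesis
    unfolding mehler_def gauss_kernel_def by (simp add: exp_add[symmetric] mult_ac)
qed

text \<open>The exponent is symmetric in its two points. So the kernel is also the Gaussian density
  at \<open>x\<close> times a Gaussian kernel in \<open>z\<close>, which is the origin of the factor
  \<open>gauss_kernel 1 x\<close> beside T.\<close>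

lemma mehler_commute: "0 \<le> t \<Longrightarrow> t < 1 \<Longrightarrow> mehler t x z = mehler t z x"
  by (simp add: mehler_explicit inner_commute add.commute)

lemma gauss_kernel_line_derivative:
  assumes "s > 0"
  shows "((\<lambda>r. gauss_kernel s (x + r *\<^sub>R axis i 1 - c)) has_real_derivative
           - ((x - c) $ i) / s * gauss_kernel s (x - c :: real ^ 'n::finite)) (at 0)"
proof -
  have n: "(norm (x + r *\<^sub>R axis i 1 - c))\<^sup>2 = (norm (x - c))\<^sup>2 + 2 * r * (x - c) $ i + r\<^sup>2" for r :: real
    using norm_diff_scaleR_power2[of "x - c" "- r" "axis i 1"] by (simp add: inner_axis algebra_simps)
  show ?thesis
    unfolding gauss_kernel_def n
    by (rule derivative_eq_intros refl | use assms in \<open>simp add: divide_simps\<close>)+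
qed

lemma mehler_line_derivative:
  assumes "0 \<le> t" "t < 1"
  shows "((\<lambda>r. mehler t (x + r *\<^sub>R axis i 1) z) has_real_derivative
           - (x $ i - sqrt t * z $ i) / (1 - t) * mehler t x z) (at 0)"
  using DERIV_cmult[OF gauss_kernel_line_derivative[of "1 - t" x i "sqrt t *\<^sub>R z"], of "gauss_kernel 1 z"] assms
  by (simp add: mehler_def mult_ac)

lemma mehler_flux_line_derivative:
  assumes "0 < t" "t < 1"
  shows "((\<lambda>r. mehler_flux i t (x + r *\<^sub>R axis i 1) z) has_real_derivative mehler_flux_deriv i t x z) (at 0)"
proof -
  have 1: "((\<lambda>r. (z $ i - sqrt t * (x + r *\<^sub>R axis i 1) $ i) / (2 * sqrt t * (1 - t))) has_real_derivative
     - sqrt t / (2 * sqrt t * (1 - t))) (at 0)"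
  proof -
    have eq: "(\<lambda>r. (z $ i - sqrt t * (x + r *\<^sub>R axis i 1) $ i) / (2 * sqrt t * (1 - t)))
        = (\<lambda>r. (z $ i - sqrt t * (x $ i + r)) / (2 * sqrt t * (1 - t)))" by simp
    have "((\<lambda>r. (a - q * (b + r)) / c) has_real_derivative - q / c) (at 0)" for a b c q :: real
      unfolding divide_inverse by (auto intro!: derivative_eq_intros)
    then show ?thesis unfolding eq .
  qed
  show ?thesis
    unfolding mehler_flux_def mehler_flux_deriv_def
  proof (rule DERIV_cong[OF DERIV_mult[OF 1 mehler_line_derivative]])
    have key: "- q / d * m + - a / r * m * (b / d) = (- q - b * a / r) / d * m" if "d \<noteq> 0" for q d m a r b :: real
      unfolding divide_inverse by algebra
    show "- sqrt t / (2 * sqrt t * (1 - t)) * mehler t (x + 0 *\<^sub>R axis i 1) z +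
        - (x $ i - sqrt t * z $ i) / (1 - t) * mehler t x z * ((z $ i - sqrt t * (x + 0 *\<^sub>R axis i 1) $ i) / (2 * sqrt t * (1 - t))) =
        (- sqrt t - (z $ i - sqrt t * x $ i) * (x $ i - sqrt t * z $ i) / (1 - t)) / (2 * sqrt t * (1 - t)) * mehler t x z"
      unfolding scaleR_zero_left add_0_right by (rule key) (use assms in auto)
  qed (use assms in auto)
qed

text \<open>The continuity equation of the flow \<open>t \<mapsto> \<surd>t Z + \<surd>(1 - t) Z'\<close>.\<close>

lemma mehler_time_derivative:
  assumes t: "0 < t" "t < 1"
  shows "((\<lambda>t. mehler t x z) has_real_derivative - (\<Sum>i\<in>UNIV. mehler_flux_deriv i t x z)) (at t)"
proof -
  let ?n = "real CARD('a)"
  let ?E = "\<lambda>t. - ?n / 2 * ln (2 * pi) - ?n / 2 * ln (2 * pi * (1 - t)) - ((norm x)\<^sup>2 + (norm z)\<^sup>2 - 2 * sqrt t * (x \<bullet> z)) / (2 * (1 - t))"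
  \<comment> \<open>With the normalisations written as exponentials the density is a single
    exponential, and its time derivative is the density times \<open>?D\<close>.\<close>
  have pw: "(1 / sqrt a) ^ CARD('a) = exp (- ?n / 2 * ln a)" if "a > 0" for a :: real
  proof -
    have "exp (- ?n / 2 * ln a) = exp (- (ln a / 2)) ^ CARD('a)"
      by (simp add: exp_of_nat_mult[symmetric])
    also have "exp (- (ln a / 2)) = 1 / sqrt a"
    proof -
      have "exp (ln a / 2) = sqrt a" using that exp_ln[of "sqrt a"] ln_sqrt[of a] by simp
      then show ?thesis unfolding exp_minus by (simp add: inverse_eq_divide)
    qed
    finally show ?thesis by simp
  qed
  have m: "mehler t x z = exp (?E t)" if "0 < t" "t < 1" for t
  proof -
    have "mehler t x z = exp (- ?n / 2 * ln (2 * pi)) * exp (- ?n / 2 * ln (2 * pi * (1 - t))) *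
        exp (- ((norm x)\<^sup>2 + (norm z)\<^sup>2 - 2 * sqrt t * (x \<bullet> z)) / (2 * (1 - t)))"
      unfolding mehler_explicit[OF less_imp_le[OF that(1)] that(2)]
      using pw[of "2 * pi"] pw[of "2 * pi * (1 - t)"] that by simp
    also have "\<dots> = exp (- ?n / 2 * ln (2 * pi) + - ?n / 2 * ln (2 * pi * (1 - t)) +
        - ((norm x)\<^sup>2 + (norm z)\<^sup>2 - 2 * sqrt t * (x \<bullet> z)) / (2 * (1 - t)))"
      by (simp only: exp_add)
    finally show ?thesis by (simp only: minus_divide_left[symmetric] minus_mult_left[symmetric] diff_conv_add_uminus)
  qed
  let ?D = "?n / (2 * (1 - t)) - ((norm x)\<^sup>2 + (norm z)\<^sup>2 - 2 * sqrt t * (x \<bullet> z)) / (2 * (1 - t)\<^sup>2) + (x \<bullet> z) / (2 * sqrt t * (1 - t))"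
  have "(?E has_real_derivative ?D) (at t)"
  proof -
    have d1: "((\<lambda>t. ln (2 * pi * (1 - t))) has_real_derivative - 1 / (1 - t)) (at t)"
      using t by (auto intro!: derivative_eq_intros simp: field_simps)
    have d2: "((\<lambda>t. (norm x)\<^sup>2 + (norm z)\<^sup>2 - 2 * sqrt t * (x \<bullet> z)) has_real_derivative - (x \<bullet> z) / sqrt t) (at t)"
      using t by (auto intro!: derivative_eq_intros simp: field_simps)
    have d3: "((\<lambda>t. 2 * (1 - t)) has_real_derivative - 2) (at t)"
      by (auto intro!: derivative_eq_intros)
    have "((\<lambda>t. ((norm x)\<^sup>2 + (norm z)\<^sup>2 - 2 * sqrt t * (x \<bullet> z)) / (2 * (1 - t))) has_real_derivative
        ((norm x)\<^sup>2 + (norm z)\<^sup>2 - 2 * sqrt t * (x \<bullet> z)) / (2 * (1 - t)\<^sup>2) - (x \<bullet> z) / (2 * sqrt t * (1 - t))) (at t)"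
      by (rule DERIV_cong[OF DERIV_divide[OF d2 d3]])
        (use t in \<open>auto simp: divide_simps power2_eq_square, simp add: algebra_simps\<close>)
    from DERIV_diff[OF DERIV_diff[OF DERIV_const DERIV_cmult[OF d1]] this]
    show ?thesis by (rule DERIV_cong) (use t in \<open>simp add: field_simps\<close>)
  qed
  then have d: "((\<lambda>t. exp (?E t)) has_real_derivative exp (?E t) * ?D) (at t)" by (rule DERIV_fun_exp)
  have ev: "eventually (\<lambda>t. exp (?E t) = mehler t x z) (nhds t)"
    using eventually_nhds_in_open[of "{0<..<1}" t] t by (auto elim!: eventually_mono simp: m)
  have "((\<lambda>t. mehler t x z) has_real_derivative mehler t x z * ?D) (at t)"
    unfolding m[OF t] by (rule DERIV_cong_ev[OF refl ev refl, THEN iffD1, OF d])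
  moreover have "mehler t x z * ?D = - (\<Sum>i\<in>UNIV. mehler_flux_deriv i t x z)"
  proof -
    have S: "(\<Sum>i\<in>UNIV. (z $ i - sqrt t * x $ i) * (x $ i - sqrt t * z $ i)) = (1 + t) * (x \<bullet> z) - sqrt t * ((norm x)\<^sup>2 + (norm z)\<^sup>2)"
    proof -
      have "(\<Sum>i\<in>UNIV. (z $ i - sqrt t * x $ i) * (x $ i - sqrt t * z $ i)) =
          (\<Sum>i\<in>UNIV. (1 + t) * (x $ i * z $ i) - sqrt t * (x $ i * x $ i) - sqrt t * (z $ i * z $ i))"
        using t by (intro sum.cong refl) (simp add: algebra_simps)
      also have "\<dots> = (1 + t) * (\<Sum>i\<in>UNIV. x $ i * z $ i) - sqrt t * (\<Sum>i\<in>UNIV. x $ i * x $ i) - sqrt t * (\<Sum>i\<in>UNIV. z $ i * z $ i)"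
        by (simp only: sum_subtractf sum_distrib_left[symmetric])
      also have "(\<Sum>i\<in>UNIV. x $ i * z $ i) = x \<bullet> z" by (simp add: inner_vec_def)
      also have "(\<Sum>i\<in>UNIV. x $ i * x $ i) = (norm x)\<^sup>2" unfolding norm_power2_vec by (simp only: power2_eq_square)
      also have "(\<Sum>i\<in>UNIV. z $ i * z $ i) = (norm z)\<^sup>2" unfolding norm_power2_vec by (simp only: power2_eq_square)
      finally show ?thesis by (simp only: distrib_left diff_diff_eq)
    qed
    have "(\<Sum>i\<in>UNIV. mehler_flux_deriv i t x z) =
       (\<Sum>i\<in>UNIV. - sqrt t - (z $ i - sqrt t * x $ i) * (x $ i - sqrt t * z $ i) / (1 - t)) / (2 * sqrt t * (1 - t)) * mehler t x z"
      unfolding mehler_flux_deriv_def by (simp add: sum_divide_distrib sum_distrib_right)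
    also have "(\<Sum>i\<in>UNIV. - sqrt t - (z $ i - sqrt t * x $ i) * (x $ i - sqrt t * z $ i) / (1 - t)) =
       - ?n * sqrt t - ((1 + t) * (x \<bullet> z) - sqrt t * ((norm x)\<^sup>2 + (norm z)\<^sup>2)) / (1 - t)"
      by (simp add: sum_subtractf sum_divide_distrib[symmetric] S)
    finally have eq: "(\<Sum>i\<in>UNIV. mehler_flux_deriv i t x z) = mehler t x z *
      ((- ?n * sqrt t - ((1 + t) * (x \<bullet> z) - sqrt t * ((norm x)\<^sup>2 + (norm z)\<^sup>2)) / (1 - t)) / (2 * sqrt t * (1 - t)))"
      by simp
    \<comment> \<open>With q = sqrt t and r = 1 - t both sides are rational functions that agree
      modulo q^2 + r = 1.\<close>
    have alg: "n / (2 * r) - (A - 2 * q * c) / (2 * r\<^sup>2) + c / (2 * q * r)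
        = - ((- n * q - ((1 + q\<^sup>2) * c - q * A) / r) / (2 * q * r))"
      if "q > 0" "r > 0" "q\<^sup>2 = 1 - r" for n q r A c :: real
    proof -
      have "c * q\<^sup>2 = c - c * r" unfolding that(3) by (simp only: right_diff_distrib mult_1_right)
      then have e: "c * r + c * (q * q) = c" by (simp add: power2_eq_square)
      have "c * (q * (r * (r * (r * 2)))) + c * (q * (q * (q * (r * (r * 2))))) = 2 * q * r * r * (c * r + c * (q * q))"
        by (simp add: algebra_simps)
      then have "c * (q * (r * (r * (r * 2)))) + c * (q * (q * (q * (r * (r * 2))))) = c * (q * (r * (r * 2)))"
        unfolding e by simp
      then show ?thesis using that(1,2) by (simp add: field_simps power2_eq_square)
    qed
    have "?D = - ((- ?n * sqrt t - ((1 + t) * (x \<bullet> z) - sqrt t * ((norm x)\<^sup>2 + (norm z)\<^sup>2)) / (1 - t)) / (2 * sqrt t * (1 - t)))"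
      using alg[of "sqrt t" "1 - t" ?n "(norm x)\<^sup>2 + (norm z)\<^sup>2" "x \<bullet> z"] t by simp
    then show ?thesis unfolding eq by simp
  qed
  ultimately show ?thesis by simp
qed

section \<open>Cutoff functions\<close>

text \<open>Squaring the truncated paraboloid makes it C1 across the sphere of radius
  \<open>R\<close>; its gradient is of order 1/R.\<close>

definition cutoff :: "real \<Rightarrow> real ^ 'n::finite \<Rightarrow> real" where
  "cutoff R x = (max 0 (1 - (norm x)\<^sup>2 / R\<^sup>2))\<^sup>2"

definition cutoff_deriv :: "'n::finite \<Rightarrow> real \<Rightarrow> real ^ 'n \<Rightarrow> real" where
  "cutoff_deriv i R x = - 4 * x $ i / R\<^sup>2 * max 0 (1 - (norm x)\<^sup>2 / R\<^sup>2)"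

lemma DERIV_max_0_power2:
  fixes u :: real
  shows "((\<lambda>u. (max 0 u)\<^sup>2) has_real_derivative 2 * max 0 u) (at u)"
proof (cases u "0 :: real" rule: linorder_cases)
  case less
  have "eventually (\<lambda>v. (max 0 v)\<^sup>2 = (0::real)) (nhds u)"
    using eventually_nhds_in_open[of "{..<0}" u] less by (auto elim!: eventually_mono)
  then show ?thesis using less by (subst DERIV_cong_ev[OF refl _ refl, of _ "\<lambda>_. 0"]) auto
next
  case greater
  have "eventually (\<lambda>v. (max 0 v)\<^sup>2 = (v\<^sup>2 :: real)) (nhds u)"
    using eventually_nhds_in_open[of "{0<..}" u] greater by (auto elim!: eventually_mono)
  then show ?thesis using greater
    by (subst DERIV_cong_ev[OF refl _ refl, of _ "\<lambda>v. v\<^sup>2"]) (auto intro!: derivative_eq_intros)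
next
  case equal
  \<comment> \<open>At the kink the difference quotient is bounded by the absolute value of
    \<open>h\<close>.\<close>
  have "((\<lambda>h. ((max 0 (0 + h))\<^sup>2 - (max 0 0)\<^sup>2) / h) \<longlongrightarrow> (0::real)) (at 0)"
  proof (rule Lim_null_comparison)
    show "\<forall>\<^sub>F h in at (0::real). norm (((max 0 (0 + h))\<^sup>2 - (max 0 0)\<^sup>2) / h) \<le> \<bar>h\<bar>"
      by (intro always_eventually) (auto simp: max_def power2_eq_square)
    show "((\<lambda>h. \<bar>h\<bar>) \<longlongrightarrow> (0::real)) (at 0)" by (intro tendsto_eq_intros) auto
  qed
  then show ?thesis using equal by (simp add: DERIV_def)
qed

lemma cutoff_line_derivative:
  "((\<lambda>r. cutoff R (x + r *\<^sub>R axis i 1)) has_real_derivative cutoff_deriv i R x) (at 0)"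
proof -
  have n: "(norm (x + r *\<^sub>R axis i 1))\<^sup>2 = (norm x)\<^sup>2 + 2 * r * x $ i + r\<^sup>2" for r :: real
    using norm_diff_scaleR_power2[of "x" "- r" "axis i 1"] by (simp add: inner_axis)
  have "((\<lambda>r. 1 - ((norm x)\<^sup>2 + 2 * r * x $ i + r\<^sup>2) / R\<^sup>2) has_real_derivative - 2 * x $ i / R\<^sup>2) (at 0)"
    unfolding divide_inverse by (auto intro!: derivative_eq_intros)
  from DERIV_chain2[OF DERIV_max_0_power2 this]
  show ?thesis by (simp add: cutoff_def cutoff_deriv_def n mult_ac)
qed

lemma cutoff_bounds: "0 \<le> cutoff R x" "cutoff R x \<le> 1"
  by (auto simp: cutoff_def max_def intro!: power_le_one)

lemma cutoff_zero: "R > 0 \<Longrightarrow> norm x \<ge> R \<Longrightarrow> cutoff R x = 0 \<and> cutoff_deriv i R x = 0"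
  using power_mono[of R "norm x" 2] by (auto simp: cutoff_def cutoff_deriv_def max_def field_simps)

lemma cutoff_deriv_bound:
  assumes "R > 0"
  shows "\<bar>cutoff_deriv i R x\<bar> \<le> 4 / R"
proof (cases "norm x \<ge> R")
  case False
  have m: "\<bar>max 0 (1 - (norm x)\<^sup>2 / R\<^sup>2)\<bar> \<le> 1" by (auto simp: max_def)
  have "\<bar>x $ i\<bar> \<le> R" using False component_le_norm_cart[of x i] by linarith
  then have "\<bar>- 4 * x $ i / R\<^sup>2\<bar> \<le> 4 / R" using assms by (simp add: abs_mult power2_eq_square field_simps)
  from mult_mono[OF this m] assms show ?thesis unfolding cutoff_deriv_def abs_mult by simp
next
  case True
  then show ?thesis using cutoff_zero[OF assms True, of i] assms by simp
qed

lemma continuous_cutoff[continuous_intros]: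
  "continuous_on S f \<Longrightarrow> continuous_on S (\<lambda>x. cutoff R (f x))"
  "continuous_on S f \<Longrightarrow> continuous_on S (\<lambda>x. cutoff_deriv i R (f x))"
  unfolding cutoff_def cutoff_deriv_def divide_inverse by (intro continuous_intros; assumption)+

lemma cutoff_measurable[measurable]:
  "cutoff R \<in> borel_measurable borel" "cutoff_deriv i R \<in> borel_measurable borel"
  by (intro borel_measurable_continuous_onI continuous_intros)+

lemma cutoff_tendsto_1: "(\<lambda>k. cutoff (real (Suc k)) x) \<longlonglongrightarrow> 1"
proof -
  have "(\<lambda>k. (norm x)\<^sup>2 * (inverse (real (Suc k)))\<^sup>2) \<longlonglongrightarrow> (norm x)\<^sup>2 * 0\<^sup>2"
    by (intro tendsto_intros LIMSEQ_inverse_real_of_nat)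
  then have "(\<lambda>k. (norm x)\<^sup>2 / (real (Suc k))\<^sup>2) \<longlonglongrightarrow> 0"
    by (simp add: divide_inverse power_inverse)
  then have "(\<lambda>k. (max 0 (1 - (norm x)\<^sup>2 / (real (Suc k))\<^sup>2))\<^sup>2) \<longlonglongrightarrow> (max 0 (1 - 0))\<^sup>2"
    by (intro tendsto_intros)
  then show ?thesis by (simp add: cutoff_def)
qed

lemma C1_test_function_cutoff:
  assumes "R > 0" "continuous_on UNIV K" "continuous_on UNIV K'"
    "\<And>x. ((\<lambda>s. K (x + s *\<^sub>R axis i 1)) has_real_derivative K' x) (at 0)"
  shows "C1_test_function i (\<lambda>x. cutoff R x * K x) (\<lambda>x. cutoff_deriv i R x * K x + cutoff R x * K' x)"
  unfolding C1_test_function_def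
proof (intro conjI allI)
  show "continuous_on UNIV (\<lambda>x. cutoff R x * K x)"
    "continuous_on UNIV (\<lambda>x. cutoff_deriv i R x * K x + cutoff R x * K' x)"
    using assms by (auto intro!: continuous_intros)
  show "((\<lambda>s. cutoff R (x + s *\<^sub>R axis i 1) * K (x + s *\<^sub>R axis i 1)) has_real_derivative
      cutoff_deriv i R x * K x + cutoff R x * K' x) (at 0)" for x
    by (rule DERIV_cong[OF DERIV_mult[OF cutoff_line_derivative assms(4)]]) simp
  show "\<exists>r. \<forall>x. r < norm x \<longrightarrow> cutoff R x * K x = 0 \<and> cutoff_deriv i R x * K x + cutoff R x * K' x = 0"
    using cutoff_zero[OF assms(1), of _ i] by (intro exI[of _ R] allI impI) (simp add: less_imp_le)
qed

section \<open>Bounds on the flux\<close>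

text \<open>The primitive 2 sqrt t - 2 sqrt (1 - t) stays bounded at both singular ends, with limits
  -2 and 2.\<close>

lemma nn_integral_inverse_sqrt_finite:
  "(\<integral>\<^sup>+t. ennreal (1 / sqrt t + 1 / sqrt (1 - t)) * indicator {0<..<1} t \<partial>lborel) < \<infinity>"
proof -
  let ?f = "\<lambda>t::real. 1 / sqrt t + 1 / sqrt (1 - t)" and ?F = "\<lambda>t::real. 2 * sqrt t - 2 * sqrt (1 - t)"
  have "set_integrable lborel (einterval (ereal 0) (ereal 1)) ?f"
  proof (rule interval_integral_FTC_nonneg(1)[of "ereal 0" "ereal 1" ?F ?f "-2" 2])
    show "DERIV ?F x :> ?f x" if "ereal 0 < ereal x" "ereal x < ereal 1" for x
      using that by (auto intro!: derivative_eq_intros simp: field_simps)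
    show "isCont ?f x" if "ereal 0 < ereal x" "ereal x < ereal 1" for x
      using that by (auto intro!: continuous_intros)
    show "AE x in lborel. ereal 0 < ereal x \<longrightarrow> ereal x < ereal 1 \<longrightarrow> 0 \<le> ?f x" by auto
    have "((\<lambda>t. ?F t) \<longlongrightarrow> ?F 0) (at_right 0)" "((\<lambda>t. ?F t) \<longlongrightarrow> ?F 1) (at_left 1)"
      by (intro tendsto_intros)+
    then show "((?F \<circ> real_of_ereal) \<longlongrightarrow> - 2) (at_right (ereal 0))" "((?F \<circ> real_of_ereal) \<longlongrightarrow> 2) (at_left (ereal 1))"
      by (simp_all add: ereal_tendsto_simps)
  qed auto
  then have "integrable lborel (\<lambda>t. indicator {0<..<1} t *\<^sub>R ?f t)"
    by (simp add: set_integrable_def einterval_eq)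
  then have "(\<integral>\<^sup>+t. ennreal (norm (indicator {0<..<1} t *\<^sub>R ?f t)) \<partial>lborel) < \<infinity>"
    by (simp add: integrable_iff_bounded)
  also have "(\<integral>\<^sup>+t. ennreal (norm (indicator {0<..<1} t *\<^sub>R ?f t)) \<partial>lborel) =
      (\<integral>\<^sup>+t. ennreal (?f t) * indicator {0<..<1} t \<partial>lborel)"
    by (intro nn_integral_cong) (auto simp: indicator_def)
  finally show ?thesis .
qed

text \<open>Dividing 1 \<le> sqrt t + sqrt (1 - t) by the product separates the singularity at 0
  from the one at 1.\<close>

lemma inverse_sqrt_prod_le:
  assumes "0 < t" "t < 1"
  shows "1 / (sqrt t * sqrt (1 - t)) \<le> 1 / sqrt t + 1 / sqrt (1 - t)"
proof -
  have "1 \<le> (sqrt t + sqrt (1 - t))\<^sup>2" using assms by (simp add: power2_sum)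
  then have "1 \<le> sqrt t + sqrt (1 - t)"
    using assms by (intro power2_le_imp_le[of 1]) auto
  then have "1 / (sqrt t * sqrt (1 - t)) \<le> (sqrt t + sqrt (1 - t)) / (sqrt t * sqrt (1 - t))"
    using assms by (intro divide_right_mono) auto
  also have "\<dots> = 1 / sqrt t + 1 / sqrt (1 - t)"
  proof -
    have "(p + q) / (p * q) = 1 / q + 1 / p" if "p > 0" "q > 0" for p q :: real
      using that by (simp add: add_divide_distrib)
    from this[of "sqrt t" "sqrt (1 - t)"] show ?thesis using assms by simp
  qed
  finally show ?thesis .
qed

text \<open>One term of the exponential series gives y^k \<le> k! exp y for y = 2 + a, and 2 + a -
  a^2/2 is at most 5/2, attained at a = 1.\<close>

lemma power_exp_bound:
  fixes a :: real assumes "a \<ge> 0"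
  shows "(2 + a) ^ k * exp (- a\<^sup>2 / 2) \<le> fact k * exp (5/2)"
proof -
  have "(\<Sum>n\<in>{k}. (2 + a) ^ n /\<^sub>R fact n) \<le> (\<Sum>n. (2 + a) ^ n /\<^sub>R fact n)"
    by (rule sum_le_suminf[OF summable_exp_generic]) (use assms in auto)
  then have "(2 + a) ^ k / fact k \<le> exp (2 + a)"
    unfolding exp_def by (simp add: divide_inverse mult.commute)
  then have "(2 + a) ^ k \<le> fact k * exp (2 + a)"
    by (subst (asm) pos_divide_le_eq) (auto simp: mult.commute)
  then have "(2 + a) ^ k * exp (- a\<^sup>2 / 2) \<le> fact k * exp (2 + a) * exp (- a\<^sup>2 / 2)"
    by (rule mult_right_mono) simp
  also have "\<dots> = fact k * exp (2 + a - a\<^sup>2 / 2)"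
    by (simp only: mult.assoc exp_add[symmetric]) simp
  also have "2 + a - a\<^sup>2 / 2 \<le> 5 / 2"
    using zero_le_power2[of "a - 1"] by (simp add: power2_eq_square algebra_simps)
  then have "fact k * exp (2 + a - a\<^sup>2 / 2) \<le> fact k * exp (5 / 2)" by simp
  finally show ?thesis .
qed

lemma gauss_kernel_le:
  assumes "s > 0"
  shows "gauss_kernel s (w :: real ^ 'n::finite) \<le> (1 / sqrt s) ^ CARD('n) * exp (- (norm w)\<^sup>2 / (2 * s))"
proof -
  have "1 / sqrt (2 * pi * s) \<le> 1 / sqrt s"
    using assms pi_gt3 by (intro divide_left_mono) (auto simp: mult_le_cancel_right1)
  then show ?thesis unfolding gauss_kernel_def
    using assms by (intro mult_right_mono power_mono) auto
qed

lemma norm_le_1_plus_power2: "norm x \<le> 1 + (norm x)\<^sup>2"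
proof -
  have "0 \<le> (norm x - 1/2)\<^sup>2" by simp
  then show ?thesis by (simp add: power2_eq_square algebra_simps)
qed

lemma component_le_1_plus_power2: "\<bar>x $ i\<bar> \<le> 1 + (norm (x :: real ^ 'n::finite))\<^sup>2"
  using component_le_norm_cart[of x i] norm_le_1_plus_power2[of x] by linarith

section \<open>Integrability of the flux over the whole space\<close>

locale gaussian_square_integrable =
  fixes g :: "real ^ 'n::finite \<Rightarrow> real"
  assumes g_cont: "continuous_on UNIV g" and g_L2: "integrable std_gaussian (\<lambda>z. (g z)\<^sup>2)"
begin

lemma g_measurable[measurable]: "g \<in> borel_measurable borel"
  using g_cont by (rule borel_measurable_continuous_onI)

text \<open>The inequality 2ab \<le> a^2 + b^2 splits the product into a Gaussian moment and the
  second moment of \<open>g\<close>.\<close>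

lemma g_moment: "integrable lborel (\<lambda>z. gauss_kernel 1 z * ((1 + (norm z)\<^sup>2) * \<bar>g z\<bar>))"
proof -
  have "integrable std_gaussian (\<lambda>z. (1 + (norm z)\<^sup>2) * \<bar>g z\<bar>)"
  proof (rule Bochner_Integration.integrable_bound[OF Bochner_Integration.integrable_add[OF std_gaussian_moment g_L2]])
    have "\<bar>(1 + (norm z)\<^sup>2) * \<bar>g z\<bar>\<bar> \<le> \<bar>(1 + (norm z)\<^sup>2)\<^sup>2 + (g z)\<^sup>2\<bar>" for z :: "real ^ 'n"
    proof -
      have "2 * (1 + (norm z)\<^sup>2) * \<bar>g z\<bar> \<le> (1 + (norm z)\<^sup>2)\<^sup>2 + (g z)\<^sup>2"
        using sum_squares_bound[of "1 + (norm z)\<^sup>2" "\<bar>g z\<bar>"] by simp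
      moreover have "0 \<le> (1 + (norm z)\<^sup>2) * \<bar>g z\<bar>" by simp
      ultimately have "(1 + (norm z)\<^sup>2) * \<bar>g z\<bar> \<le> (1 + (norm z)\<^sup>2)\<^sup>2 + (g z)\<^sup>2" by linarith
      then show ?thesis by simp
    qed
    then show "AE z in std_gaussian. norm ((1 + (norm z)\<^sup>2) * \<bar>g z\<bar>) \<le> norm ((1 + (norm z)\<^sup>2)\<^sup>2 + (g z)\<^sup>2)" by simp
  qed simp
  then show ?thesis by (simp add: std_gaussian_integral(1))
qed

definition gmom :: real where "gmom = (LINT z|lborel. gauss_kernel 1 z * ((1 + (norm z)\<^sup>2) * \<bar>g z\<bar>))"

definition ymom :: real where "ymom = (LINT y|std_gaussian. 1 + (norm (y :: real ^ 'n))\<^sup>2)"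

lemma gmom: "(\<integral>\<^sup>+z. ennreal (gauss_kernel 1 z * ((1 + (norm z)\<^sup>2) * \<bar>g z\<bar>)) \<partial>lborel) = ennreal gmom" "gmom \<ge> 0"
  unfolding gmom_def by (rule nn_integral_eq_integral[OF g_moment], simp add: gauss_kernel_nonneg)
    (simp add: gauss_kernel_nonneg)

lemma ymom: "(\<integral>\<^sup>+y. ennreal (1 + (norm y)\<^sup>2) \<partial>(std_gaussian :: (real ^ 'n) measure)) = ennreal ymom" "ymom \<ge> 0"
proof -
  have "integrable std_gaussian (\<lambda>y :: real ^ 'n. 1 + (norm y)\<^sup>2)"
  proof (rule Bochner_Integration.integrable_bound[OF std_gaussian_moment])
    have "1 + (norm z)\<^sup>2 \<le> (1 + (norm z)\<^sup>2)\<^sup>2" for z :: "real ^ 'n"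
      using mult_mono[of 1 "1 + (norm z)\<^sup>2" "1 + (norm z)\<^sup>2" "1 + (norm z)\<^sup>2"] by (simp add: power2_eq_square)
    then show "AE z in std_gaussian. norm (1 + (norm (z :: real ^ 'n))\<^sup>2) \<le> norm ((1 + (norm z)\<^sup>2)\<^sup>2)" by simp
  qed simp
  then show "(\<integral>\<^sup>+y. ennreal (1 + (norm y)\<^sup>2) \<partial>(std_gaussian :: (real ^ 'n) measure)) = ennreal ymom"
    unfolding ymom_def by (intro nn_integral_eq_integral) auto
  show "ymom \<ge> 0" unfolding ymom_def by simp
qed

text \<open>Under x = sqrt t z + sqrt s y with s = 1 - t the velocity is again z_i / (2 sqrt t) -
  y_i / (2 sqrt s). The apparent singularity 1/(1 - t) is thus an inverse square root.\<close>

lemma mehler_flux_x_integral: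
  fixes z :: "real ^ 'n"
  assumes t: "0 < t" "t < 1"
  shows "(\<integral>\<^sup>+x. ennreal \<bar>mehler_flux i t x z\<bar> \<partial>lborel)
    \<le> ennreal (gauss_kernel 1 z * (1 + (norm z)\<^sup>2) * ymom * (1 / sqrt t + 1 / sqrt (1 - t)))"
proof -
  define s where "s = 1 - t"
  have s: "s > 0" "t = 1 - s" using t by (auto simp: s_def)
  let ?c = "1 / sqrt t + 1 / sqrt s"
  have c: "?c \<ge> 0" using t s by simp
  have "(\<integral>\<^sup>+x. ennreal \<bar>mehler_flux i t x z\<bar> \<partial>lborel) =
     (\<integral>\<^sup>+x. ennreal (gauss_kernel s (x - sqrt t *\<^sub>R z)) * ennreal (gauss_kernel 1 z * \<bar>(z $ i - sqrt t * x $ i) / (2 * sqrt t * s)\<bar>) \<partial>lborel)"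
    by (intro nn_integral_cong)
      (simp add: mehler_flux_def mehler_def s_def[symmetric] abs_mult gauss_kernel_nonneg s less_imp_le ennreal_mult'[symmetric] mult_ac)
  also have "\<dots> = (\<integral>\<^sup>+y. ennreal (gauss_kernel 1 z * \<bar>(z $ i - sqrt t * (sqrt t *\<^sub>R z + sqrt s *\<^sub>R y) $ i) / (2 * sqrt t * s)\<bar>) \<partial>std_gaussian)"
    by (rule gauss_kernel_nn_integral[OF s(1)]) measurable
  also have "\<dots> \<le> (\<integral>\<^sup>+y. ennreal (gauss_kernel 1 z * (1 + (norm z)\<^sup>2) * ?c) * ennreal (1 + (norm y)\<^sup>2) \<partial>(std_gaussian :: (real ^ 'n) measure))"
  proof (rule nn_integral_mono)
    fix y :: "real ^ 'n"
    have alg: "(u - q * (q * u + p * v)) / (2 * q * p\<^sup>2) = u / (2 * q) - v / (2 * p)"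
      if "q > 0" "p > 0" "q\<^sup>2 = 1 - p\<^sup>2" for u v p q :: real
    proof -
      have "u - q * (q * u + p * v) = u - q\<^sup>2 * u - q * p * v" by (simp add: power2_eq_square algebra_simps)
      also have "\<dots> = p\<^sup>2 * u - q * p * v" unfolding that(3) by (simp add: algebra_simps)
      finally show ?thesis using that(1,2) by (simp add: diff_divide_distrib power2_eq_square)
    qed
    have "\<bar>(z $ i - sqrt t * (sqrt t *\<^sub>R z + sqrt s *\<^sub>R y) $ i) / (2 * sqrt t * s)\<bar> = \<bar>z $ i / (2 * sqrt t) - y $ i / (2 * sqrt s)\<bar>"
      using alg[of "sqrt t" "sqrt s" "z $ i" "y $ i"] t s by simp
    also have "\<dots> \<le> \<bar>z $ i\<bar> * (1 / (2 * sqrt t)) + \<bar>y $ i\<bar> * (1 / (2 * sqrt s))"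
      using t s abs_triangle_ineq4[of "z $ i / (2 * sqrt t)" "y $ i / (2 * sqrt s)"] by (simp add: abs_mult)
    also have "\<dots> \<le> ((1 + (norm z)\<^sup>2) * (1 + (norm y)\<^sup>2)) * (1 / sqrt t) + ((1 + (norm z)\<^sup>2) * (1 + (norm y)\<^sup>2)) * (1 / sqrt s)"
    proof (intro add_mono mult_mono)
      show "\<bar>z $ i\<bar> \<le> (1 + (norm z)\<^sup>2) * (1 + (norm y)\<^sup>2)" "\<bar>y $ i\<bar> \<le> (1 + (norm z)\<^sup>2) * (1 + (norm y)\<^sup>2)"
        using component_le_1_plus_power2[of z i] component_le_1_plus_power2[of y i]
          mult_left_mono[of 1 "1 + (norm y)\<^sup>2" "1 + (norm z)\<^sup>2"] mult_right_mono[of 1 "1 + (norm z)\<^sup>2" "1 + (norm y)\<^sup>2"] by simp_all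
    qed (use t s in \<open>auto simp: field_simps\<close>)
    also have "\<dots> = (1 + (norm z)\<^sup>2) * ?c * (1 + (norm y)\<^sup>2)" by (simp add: algebra_simps add_divide_distrib)
    finally have "gauss_kernel 1 z * \<bar>(z $ i - sqrt t * (sqrt t *\<^sub>R z + sqrt s *\<^sub>R y) $ i) / (2 * sqrt t * s)\<bar>
        \<le> gauss_kernel 1 z * ((1 + (norm z)\<^sup>2) * ?c * (1 + (norm y)\<^sup>2))"
      by (rule mult_left_mono) (simp add: gauss_kernel_nonneg)
    then show "ennreal (gauss_kernel 1 z * \<bar>(z $ i - sqrt t * (sqrt t *\<^sub>R z + sqrt s *\<^sub>R y) $ i) / (2 * sqrt t * s)\<bar>)
        \<le> ennreal (gauss_kernel 1 z * (1 + (norm z)\<^sup>2) * ?c) * ennreal (1 + (norm y)\<^sup>2)"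
      using c by (subst ennreal_mult[symmetric]) (auto simp: gauss_kernel_nonneg mult.assoc intro!: ennreal_leI)
  qed
  also have "\<dots> = ennreal (gauss_kernel 1 z * (1 + (norm z)\<^sup>2) * ?c) * ennreal ymom"
    by (subst nn_integral_cmult) (simp_all add: ymom del: ennreal_plus)
  also have "\<dots> = ennreal (gauss_kernel 1 z * (1 + (norm z)\<^sup>2) * ymom * ?c)"
    using c ymom by (subst ennreal_mult[symmetric]) (auto simp: gauss_kernel_nonneg mult_ac)
  finally show ?thesis by (simp add: s_def)
qed

text \<open>Integrating over \<open>x\<close> first leaves an integrable function of time times a
  moment of \<open>g\<close>. In the cutoff error no gradient stands beside the flux, so this bound
  makes the error O(1/R).\<close>

lemma flux_globally_integrable:
  "integrable lborel3
     (\<lambda>(x, t, z). indicator {0<..<1} t * mehler_flux i t x z * g z)"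
proof (rule integrableI_bounded)
  let ?F = "\<lambda>x t z. indicator {0<..<1} t * mehler_flux i t x z * g z"
  show meas: "(\<lambda>(x, t, z). ?F x t z) \<in> borel_measurable lborel3" by measurable
  interpret P: pair_sigma_finite "lborel :: (real ^ 'n) measure" "lborel2 :: (real \<times> (real ^ 'n)) measure"
    by (simp add: pair_sigma_finite_def sigma_finite_lborel lborel_prod)
  have "(\<integral>\<^sup>+p. ennreal (norm (case p of (x, t, z) \<Rightarrow> ?F x t z)) \<partial>lborel3) =
     (\<integral>\<^sup>+q. (\<integral>\<^sup>+x. ennreal (norm (case (x, q) of (x, t, z) \<Rightarrow> ?F x t z)) \<partial>lborel) \<partial>lborel2)"
    by (rule P.nn_integral_snd[symmetric]) (use meas in measurable)
  also have "\<dots> = (\<integral>\<^sup>+t. \<integral>\<^sup>+z. (\<integral>\<^sup>+x. ennreal \<bar>?F x t z\<bar> \<partial>lborel) \<partial>lborel \<partial>lborel)"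
    by (subst lborel.nn_integral_fst[symmetric]) auto
  also have "\<dots> \<le> (\<integral>\<^sup>+t. \<integral>\<^sup>+z. ennreal (gauss_kernel 1 z * ((1 + (norm z)\<^sup>2) * \<bar>g z\<bar>)) *
      (ennreal (1 / sqrt t + 1 / sqrt (1 - t)) * indicator {0<..<1} t * ennreal ymom) \<partial>lborel \<partial>lborel)"
  proof (intro nn_integral_mono)
    fix t :: real and z :: "real ^ 'n"
    show "(\<integral>\<^sup>+x. ennreal \<bar>?F x t z\<bar> \<partial>lborel) \<le> ennreal (gauss_kernel 1 z * ((1 + (norm z)\<^sup>2) * \<bar>g z\<bar>)) *
      (ennreal (1 / sqrt t + 1 / sqrt (1 - t)) * indicator {0<..<1} t * ennreal ymom)"
    proof (cases "t \<in> {0<..<1}")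
      case True
      then have "(\<integral>\<^sup>+x. ennreal \<bar>?F x t z\<bar> \<partial>lborel) = (\<integral>\<^sup>+x. ennreal \<bar>mehler_flux i t x z\<bar> * ennreal \<bar>g z\<bar> \<partial>lborel)"
        by (intro nn_integral_cong) (simp add: abs_mult ennreal_mult)
      also have "\<dots> = (\<integral>\<^sup>+x. ennreal \<bar>mehler_flux i t x z\<bar> \<partial>lborel) * ennreal \<bar>g z\<bar>"
        by (rule nn_integral_multc) measurable
      also have "\<dots> \<le> ennreal (gauss_kernel 1 z * (1 + (norm z)\<^sup>2) * ymom * (1 / sqrt t + 1 / sqrt (1 - t))) * ennreal \<bar>g z\<bar>"
        using True by (intro mult_right_mono mehler_flux_x_integral) auto
      also have "\<dots> = ennreal (gauss_kernel 1 z * ((1 + (norm z)\<^sup>2) * \<bar>g z\<bar>)) *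
          (ennreal (1 / sqrt t + 1 / sqrt (1 - t)) * indicator {0<..<1} t * ennreal ymom)"
      proof -
        have "ennreal (A * B * Y * c) * ennreal G = ennreal (A * (B * G)) * (ennreal c * 1 * ennreal Y)"
          if "A \<ge> 0" "B \<ge> 0" "Y \<ge> 0" "c \<ge> 0" "G \<ge> 0" for A B Y c G :: real
          using that by (simp add: ennreal_mult mult_ac)
        from this[of "gauss_kernel 1 z" "1 + (norm z)\<^sup>2" ymom "1 / sqrt t + 1 / sqrt (1 - t)" "\<bar>g z\<bar>"] True ymom(2)
        show ?thesis by (simp add: gauss_kernel_nonneg del: ennreal_plus)
      qed
      finally show ?thesis .
    qed simp
  qed
  also have "\<dots> = (\<integral>\<^sup>+t. ennreal gmom * (ennreal (1 / sqrt t + 1 / sqrt (1 - t)) * indicator {0<..<1} t * ennreal ymom) \<partial>lborel)"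
    by (subst nn_integral_multc) (auto simp: gmom)
  also have "\<dots> = ennreal gmom * ((\<integral>\<^sup>+t. ennreal (1 / sqrt t + 1 / sqrt (1 - t)) * indicator {0<..<1} t \<partial>lborel) * ennreal ymom)"
    by (subst nn_integral_cmult, simp, subst nn_integral_multc) auto
  also have "\<dots> < \<infinity>"
    using nn_integral_inverse_sqrt_finite by (simp add: ennreal_mult_less_top)
  finally show "(\<integral>\<^sup>+p. ennreal (norm (case p of (x, t, z) \<Rightarrow> ?F x t z)) \<partial>lborel3) < \<infinity>" .
qed

end

section \<open>Bounds on the flux, locally uniform in x\<close>

lemma mehler_le:
  assumes "0 \<le> t" "t < 1"
  shows "mehler t x (z :: real ^ 'n::finite) \<le> (1 / sqrt (1 - t)) ^ CARD('n) * gauss_kernel 1 z"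
proof -
  have "exp (- (norm (x - sqrt t *\<^sub>R z))\<^sup>2 / (2 * (1 - t))) \<le> 1" using assms by simp
  then have "gauss_kernel (1 - t) (x - sqrt t *\<^sub>R z) \<le> (1 / sqrt (1 - t)) ^ CARD('n)"
    using gauss_kernel_le[of "1 - t" "x - sqrt t *\<^sub>R z"] assms
      mult_left_le[of "exp (- (norm (x - sqrt t *\<^sub>R z))\<^sup>2 / (2 * (1 - t)))" "(1 / sqrt (1 - t)) ^ CARD('n)"]
    by (auto intro: order_trans)
  then show ?thesis unfolding mehler_def
    by (subst mult.commute) (intro mult_right_mono, auto simp: gauss_kernel_nonneg)
qed

lemma gauss_kernel_1_le_1: "gauss_kernel 1 (x :: real ^ 'n::finite) \<le> 1"
proof -
  have "exp (- (norm x)\<^sup>2 / (2 * 1)) \<le> 1" by simp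
  moreover have "gauss_kernel 1 x \<le> exp (- (norm x)\<^sup>2 / (2 * 1))"
    using gauss_kernel_le[of 1 x] by simp
  ultimately show ?thesis by linarith
qed

text \<open>\<open>a\<close> and \<open>b\<close> are two distances in units of the standard
  deviation. As exp (- a^2/2) absorbs powers of 2 + a, it suffices to bound 1 / sqrt s and
  \<open>b\<close> by multiples of 2 + a. The radius 2R + 2 serves the first of these: for sqrt t
  \<ge> 1/2 the point sqrt t z has norm at least R + 1, hence distance at least 1 from
  \<open>x\<close>.\<close>

lemma mehler_tail_bound:
  fixes x z :: "real ^ 'n::finite"
  assumes t: "0 < t" "t < 1" and x: "norm x \<le> R" and z: "2 * R + 2 \<le> norm z"
  shows "norm (z - sqrt t *\<^sub>R x) / sqrt (1 - t) * mehler t x z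
     \<le> fact (CARD('n) + 1) * exp (5/2) * (1 + (norm z)\<^sup>2) * gauss_kernel 1 z"
proof -
  define s where "s = 1 - t"
  have s: "s > 0" "s < 1" "t = 1 - s" using t by (auto simp: s_def)
  define a where "a = norm (x - sqrt t *\<^sub>R z) / sqrt s"
  define b where "b = norm (z - sqrt t *\<^sub>R x) / sqrt s"
  have a0: "a \<ge> 0" and b0: "b \<ge> 0" using s by (auto simp: a_def b_def)
  \<comment> \<open>The squares of the two distances differ by (1 - t) times the difference of the
    squared norms; after division by \<open>s\<close> no singular factor is left.\<close>
  have "(norm (z - sqrt t *\<^sub>R x))\<^sup>2 = s * (norm z)\<^sup>2 + (norm (x - sqrt t *\<^sub>R z))\<^sup>2 - s * (norm x)\<^sup>2"
    using t by (simp add: norm_diff_scaleR_power2 s_def inner_commute algebra_simps)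
  then have "b\<^sup>2 = (norm z)\<^sup>2 + a\<^sup>2 - (norm x)\<^sup>2"
    using s by (simp add: a_def b_def power_divide add_divide_distrib diff_divide_distrib)
  moreover have "(norm z)\<^sup>2 + a\<^sup>2 - (norm x)\<^sup>2 \<le> (norm z + a)\<^sup>2"
  proof -
    have "0 \<le> 2 * norm z * a" using a0 by simp
    then show ?thesis using zero_le_power2[of "norm x"] unfolding power2_sum by linarith
  qed
  ultimately have "b\<^sup>2 \<le> (norm z + a)\<^sup>2" by simp
  then have b1: "b \<le> norm z + a" by (rule power2_le_imp_le) (use a0 in simp)
  have b: "b \<le> (1 + (norm z)\<^sup>2) * (2 + a)"
  proof -
    have "b \<le> N * (2 + a)" if "u \<le> N" "b \<le> u + a" "1 \<le> N" for N u :: real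
    proof -
      have "1 * a \<le> N * a" by (rule mult_right_mono) (use that a0 in auto)
      moreover have "N * (2 + a) = 2 * N + N * a" by (simp add: algebra_simps)
      ultimately show ?thesis using that by linarith
    qed
    from this[OF norm_le_1_plus_power2 b1] show ?thesis by simp
  qed
  \<comment> \<open>This absorbs the normalisation of the kernel as \<open>t\<close> tends to 1: either \<open>s\<close> is not small or \<open>a \<surd>s \<ge> 1\<close>.\<close>
  have "1 / sqrt s \<le> 2 + a"
  proof (cases "t \<le> 3 / 4")
    case True
    then have "sqrt (1 / 4) \<le> sqrt s" by (intro real_sqrt_le_mono) (simp add: s_def)
    then have "1 / 2 \<le> sqrt s" by (simp add: real_sqrt_divide)
    then have "1 / sqrt s \<le> 2" using s by (simp add: field_simps)
    then show ?thesis using a0 by simp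
  next
    case False
    then have "sqrt (1 / 4) \<le> sqrt t" by (intro real_sqrt_le_mono) simp
    then have "1 / 2 \<le> sqrt t" by (simp add: real_sqrt_divide)
    then have "1 / 2 * norm z \<le> sqrt t * norm z" by (rule mult_right_mono) simp
    moreover have "norm (sqrt t *\<^sub>R z) \<le> norm (x - sqrt t *\<^sub>R z) + norm x"
      by (metis norm_minus_commute norm_triangle_sub add.commute)
    ultimately have "1 \<le> norm (x - sqrt t *\<^sub>R z)" using x z t by simp
    then have "1 / sqrt s \<le> a" unfolding a_def using s by (intro divide_right_mono) auto
    then show ?thesis by simp
  qed
  then have "(1 / sqrt s) ^ CARD('n) \<le> (2 + a) ^ CARD('n)" using s by (intro power_mono) auto
  then have "(1 / sqrt s) ^ CARD('n) * exp (- a\<^sup>2 / 2) \<le> (2 + a) ^ CARD('n) * exp (- a\<^sup>2 / 2)"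
    by (rule mult_right_mono) simp
  moreover have e: "- (norm (x - sqrt t *\<^sub>R z))\<^sup>2 / (2 * s) = - a\<^sup>2 / 2" using s by (simp add: a_def power_divide)
  ultimately have gk: "gauss_kernel s (x - sqrt t *\<^sub>R z) \<le> (2 + a) ^ CARD('n) * exp (- a\<^sup>2 / 2)"
    using gauss_kernel_le[OF s(1), of "x - sqrt t *\<^sub>R z"] unfolding e by linarith
  have "b * gauss_kernel s (x - sqrt t *\<^sub>R z) \<le> ((1 + (norm z)\<^sup>2) * (2 + a)) * ((2 + a) ^ CARD('n) * exp (- a\<^sup>2 / 2))"
    using b gk b0 a0 s by (intro mult_mono) (auto simp: gauss_kernel_nonneg)
  also have "\<dots> = (1 + (norm z)\<^sup>2) * ((2 + a) ^ (CARD('n) + 1) * exp (- a\<^sup>2 / 2))" by simp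
  also have "\<dots> \<le> (1 + (norm z)\<^sup>2) * (fact (CARD('n) + 1) * exp (5/2))"
    by (intro mult_left_mono power_exp_bound a0) simp
  finally have "b * gauss_kernel s (x - sqrt t *\<^sub>R z) * gauss_kernel 1 z \<le> (1 + (norm z)\<^sup>2) * (fact (CARD('n) + 1) * exp (5/2)) * gauss_kernel 1 z"
    by (rule mult_right_mono) (simp add: gauss_kernel_nonneg)
  then show ?thesis unfolding mehler_def b_def s_def by (simp add: mult_ac)
qed

context gaussian_square_integrable
begin

text \<open>In a ball \<open>g\<close> is bounded, and the kernel is at most a Gaussian in
  \<open>z\<close> around sqrt t x, in whose natural scale the weight is the norm of
  \<open>y\<close>. Outside, where \<open>g\<close> is merely square integrable, the tail bound
  replaces the kernel by the standard Gaussian. Both bounds are uniform in \<open>t\<close>.\<close>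

lemma mehler_z_integral:
  fixes x :: "real ^ 'n"
  assumes t: "0 < t" "t < 1" and x: "norm x \<le> R" and R: "R \<ge> 0"
    and G: "\<And>z. norm z \<le> 2 * R + 2 \<Longrightarrow> \<bar>g z\<bar> \<le> G"
  shows "(\<integral>\<^sup>+z. ennreal (norm (z - sqrt t *\<^sub>R x) / sqrt (1 - t) * mehler t x z * \<bar>g z\<bar>) \<partial>lborel)
    \<le> ennreal (G * ymom + fact (CARD('n) + 1) * exp (5/2) * gmom)"
proof -
  define s where "s = 1 - t"
  have s: "s > 0" using t by (simp add: s_def)
  have G0: "G \<ge> 0" using G[of 0] R by simp
  let ?K = "fact (CARD('n) + 1) * exp (5/2) :: real"
  let ?A = "\<lambda>z. ennreal (gauss_kernel s (z - sqrt t *\<^sub>R x)) * ennreal (G * (norm (z - sqrt t *\<^sub>R x) / sqrt s))"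
  let ?B = "\<lambda>z. ennreal ?K * ennreal (gauss_kernel 1 z * ((1 + (norm z)\<^sup>2) * \<bar>g z\<bar>))"
  have "(\<integral>\<^sup>+z. ennreal (norm (z - sqrt t *\<^sub>R x) / sqrt s * mehler t x z * \<bar>g z\<bar>) \<partial>lborel) \<le> (\<integral>\<^sup>+z. ?A z + ?B z \<partial>lborel)"
  proof (rule nn_integral_mono)
    fix z :: "real ^ 'n"
    show "ennreal (norm (z - sqrt t *\<^sub>R x) / sqrt s * mehler t x z * \<bar>g z\<bar>) \<le> ?A z + ?B z"
    proof (cases "norm z \<le> 2 * R + 2")
      case True
      have "mehler t x z = gauss_kernel 1 x * gauss_kernel s (z - sqrt t *\<^sub>R x)"
        using mehler_commute[of t x z] t by (simp add: mehler_def s_def)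
      also have "\<dots> \<le> 1 * gauss_kernel s (z - sqrt t *\<^sub>R x)"
        using s by (intro mult_right_mono gauss_kernel_1_le_1) (simp add: gauss_kernel_nonneg)
      finally have m: "mehler t x z \<le> gauss_kernel s (z - sqrt t *\<^sub>R x)" by simp
      have "norm (z - sqrt t *\<^sub>R x) / sqrt s * mehler t x z * \<bar>g z\<bar> \<le>
          norm (z - sqrt t *\<^sub>R x) / sqrt s * gauss_kernel s (z - sqrt t *\<^sub>R x) * G"
        using m G[OF True] s t mehler_pos[of t x z] by (intro mult_mono mult_nonneg_nonneg) auto
      then have "ennreal (norm (z - sqrt t *\<^sub>R x) / sqrt s * mehler t x z * \<bar>g z\<bar>) \<le> ?A z"
        using s G0 by (subst ennreal_mult[symmetric]) (auto simp: gauss_kernel_nonneg mult_ac intro!: ennreal_leI)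
      then show ?thesis by (simp add: add_increasing2)
    next
      case False
      then have "norm (z - sqrt t *\<^sub>R x) / sqrt s * mehler t x z \<le> ?K * (1 + (norm z)\<^sup>2) * gauss_kernel 1 z"
        unfolding s_def by (intro mehler_tail_bound[OF t x]) simp
      then have "norm (z - sqrt t *\<^sub>R x) / sqrt s * mehler t x z * \<bar>g z\<bar> \<le> ?K * (1 + (norm z)\<^sup>2) * gauss_kernel 1 z * \<bar>g z\<bar>"
        by (rule mult_right_mono) simp
      then have "ennreal (norm (z - sqrt t *\<^sub>R x) / sqrt s * mehler t x z * \<bar>g z\<bar>) \<le> ?B z"
        by (subst ennreal_mult[symmetric]) (auto simp: gauss_kernel_nonneg mult_ac intro!: ennreal_leI)
      then show ?thesis by (simp add: add_increasing)
    qed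
  qed
  also have "\<dots> = (\<integral>\<^sup>+z. ?A z \<partial>lborel) + (\<integral>\<^sup>+z. ?B z \<partial>lborel)"
    by (rule nn_integral_add) measurable
  also have "(\<integral>\<^sup>+z. ?B z \<partial>lborel) = ennreal (?K * gmom)"
    by (subst nn_integral_cmult) (auto simp: gmom ennreal_mult)
  also have "(\<integral>\<^sup>+z. ?A z \<partial>lborel) \<le> ennreal (G * ymom)"
  proof -
    have "(\<integral>\<^sup>+z. ?A z \<partial>lborel) = (\<integral>\<^sup>+y. ennreal (G * (norm (sqrt t *\<^sub>R x + sqrt s *\<^sub>R y - sqrt t *\<^sub>R x) / sqrt s)) \<partial>(std_gaussian :: (real ^ 'n) measure))"
      by (rule gauss_kernel_nn_integral[OF s]) measurable
    also have "\<dots> \<le> (\<integral>\<^sup>+y. ennreal G * ennreal (1 + (norm y)\<^sup>2) \<partial>(std_gaussian :: (real ^ 'n) measure))"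
    proof (rule nn_integral_mono)
      fix y :: "real ^ 'n"
      have "norm (sqrt t *\<^sub>R x + sqrt s *\<^sub>R y - sqrt t *\<^sub>R x) / sqrt s = norm y" using s by simp
      then have "G * (norm (sqrt t *\<^sub>R x + sqrt s *\<^sub>R y - sqrt t *\<^sub>R x) / sqrt s) \<le> G * (1 + (norm y)\<^sup>2)"
        using norm_le_1_plus_power2[of y] G0 by (simp add: mult_left_mono)
      then show "ennreal (G * (norm (sqrt t *\<^sub>R x + sqrt s *\<^sub>R y - sqrt t *\<^sub>R x) / sqrt s)) \<le> ennreal G * ennreal (1 + (norm y)\<^sup>2)"
        using G0 by (subst ennreal_mult[symmetric]) (auto intro: ennreal_leI)
    qed
    also have "\<dots> = ennreal (G * ymom)"
      using G0 by (subst nn_integral_cmult) (simp_all add: ymom ennreal_mult del: ennreal_plus)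
    finally show ?thesis .
  qed
  finally show ?thesis using G0 ymom gmom unfolding s_def by (simp add: add_mono ennreal_plus[symmetric] del: ennreal_plus)
qed

text \<open>Beside the weight of \<open>mehler_z_integral\<close> the flux retains the time factor 1
  / (2 sqrt t sqrt (1 - t)), which is integrable. Uniformity in \<open>x\<close> is the point: the
  constant gets multiplied by a gradient that is only locally integrable.\<close>

lemma flux_local_bound:
  assumes R: "R \<ge> 0"
  obtains C where "C \<ge> 0"
    "\<And>(x :: real ^ 'n) i. norm x \<le> R \<Longrightarrow>
      (\<integral>\<^sup>+q. ennreal (norm (case q of (t, z) \<Rightarrow> indicator {0<..<1} t * mehler_flux i t x z * g z)) \<partial>lborel2) \<le> ennreal C"
proof -
  have "compact (g ` cball 0 (2 * R + 2))"
    by (rule compact_continuous_image) (use g_cont continuous_on_subset in auto)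
  then obtain G where G: "\<And>z. norm z \<le> 2 * R + 2 \<Longrightarrow> \<bar>g z\<bar> \<le> G"
    using compact_imp_bounded[of "g ` cball 0 (2 * R + 2)"] unfolding bounded_iff
    by (metis imageI mem_cball_0 real_norm_def)
  have G0: "G \<ge> 0" using G[of 0] R by simp
  define K where "K = G * ymom + fact (CARD('n) + 1) * exp (5/2) * gmom"
  have K: "K \<ge> 0" unfolding K_def using G0 ymom gmom by simp
  define I where "I = (\<integral>\<^sup>+t. ennreal (1 / sqrt t + 1 / sqrt (1 - t)) * indicator {0<..<1} t \<partial>lborel)"
  have I: "I < \<infinity>" unfolding I_def by (rule nn_integral_inverse_sqrt_finite)
  show thesis
  proof (rule that)
    show "enn2real (ennreal K * I) \<ge> 0" by simp
    fix x :: "real ^ 'n" and i assume x: "norm x \<le> R"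
    have "(\<integral>\<^sup>+q. ennreal (norm (case q of (t, z) \<Rightarrow> indicator {0<..<1} t * mehler_flux i t x z * g z)) \<partial>lborel2)
       = (\<integral>\<^sup>+t. \<integral>\<^sup>+z. ennreal \<bar>indicator {0<..<1} t * mehler_flux i t x z * g z\<bar> \<partial>lborel \<partial>lborel)"
      by (subst lborel.nn_integral_fst[symmetric]) auto
    also have "\<dots> \<le> (\<integral>\<^sup>+t. ennreal K * (ennreal (1 / sqrt t + 1 / sqrt (1 - t)) * indicator {0<..<1} t) \<partial>lborel)"
    proof (rule nn_integral_mono)
      fix t :: real
      show "(\<integral>\<^sup>+z. ennreal \<bar>indicator {0<..<1} t * mehler_flux i t x z * g z\<bar> \<partial>lborel)
         \<le> ennreal K * (ennreal (1 / sqrt t + 1 / sqrt (1 - t)) * indicator {0<..<1} t)"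
      proof (cases "t \<in> {0<..<1}")
        case True
        then have t: "0 < t" "t < 1" by auto
        have "(\<integral>\<^sup>+z. ennreal \<bar>indicator {0<..<1} t * mehler_flux i t x z * g z\<bar> \<partial>lborel)
          \<le> (\<integral>\<^sup>+z. ennreal (1 / sqrt t + 1 / sqrt (1 - t)) * ennreal (norm (z - sqrt t *\<^sub>R x) / sqrt (1 - t) * mehler t x z * \<bar>g z\<bar>) \<partial>lborel)"
        proof (rule nn_integral_mono)
          fix z :: "real ^ 'n"
          have "\<bar>z $ i - sqrt t * x $ i\<bar> \<le> norm (z - sqrt t *\<^sub>R x)"
            using component_le_norm_cart[of "z - sqrt t *\<^sub>R x" i] by simp
          then have "\<bar>z $ i - sqrt t * x $ i\<bar> / sqrt (1 - t) \<le> norm (z - sqrt t *\<^sub>R x) / sqrt (1 - t)"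
            using t by (intro divide_right_mono) auto
          moreover have "1 / (2 * (sqrt t * sqrt (1 - t))) \<le> 1 / sqrt t + 1 / sqrt (1 - t)"
          proof -
            have "1 / (2 * (sqrt t * sqrt (1 - t))) \<le> 1 / (sqrt t * sqrt (1 - t))"
              using t by (intro divide_left_mono) auto
            then show ?thesis using inverse_sqrt_prod_le[OF t] by linarith
          qed
          ultimately have le: "1 / (2 * (sqrt t * sqrt (1 - t))) * (\<bar>z $ i - sqrt t * x $ i\<bar> / sqrt (1 - t)) \<le>
             (1 / sqrt t + 1 / sqrt (1 - t)) * (norm (z - sqrt t *\<^sub>R x) / sqrt (1 - t))"
            using t by (intro mult_mono) auto
          have "\<bar>indicator {0<..<1} t * mehler_flux i t x z * g z\<bar> =
             (1 / (2 * (sqrt t * sqrt (1 - t))) * (\<bar>z $ i - sqrt t * x $ i\<bar> / sqrt (1 - t))) * (mehler t x z * \<bar>g z\<bar>)"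
          proof -
            have "\<bar>u / (2 * q * p\<^sup>2) * m * w\<bar> = 1 / (2 * (q * p)) * (\<bar>u\<bar> / p) * (m * \<bar>w\<bar>)"
              if "p > 0" "q > 0" "m > 0" for u p q m w :: real
              using that by (simp add: abs_mult power2_eq_square)
            from this[of "sqrt (1 - t)" "sqrt t" "mehler t x z" "z $ i - sqrt t * x $ i" "g z"]
            show ?thesis using True t mehler_pos[of t x z] by (simp add: mehler_flux_def)
          qed
          also have "\<dots> \<le> ((1 / sqrt t + 1 / sqrt (1 - t)) * (norm (z - sqrt t *\<^sub>R x) / sqrt (1 - t))) * (mehler t x z * \<bar>g z\<bar>)"
            using le t mehler_pos[of t x z] by (intro mult_right_mono) auto
          finally show "ennreal \<bar>indicator {0<..<1} t * mehler_flux i t x z * g z\<bar> \<le>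
             ennreal (1 / sqrt t + 1 / sqrt (1 - t)) * ennreal (norm (z - sqrt t *\<^sub>R x) / sqrt (1 - t) * mehler t x z * \<bar>g z\<bar>)"
            using t mehler_pos[of t x z] by (subst ennreal_mult[symmetric]) (auto simp: mult_ac intro!: ennreal_leI simp del: ennreal_plus)
        qed
        also have "\<dots> = ennreal (1 / sqrt t + 1 / sqrt (1 - t)) * (\<integral>\<^sup>+z. ennreal (norm (z - sqrt t *\<^sub>R x) / sqrt (1 - t) * mehler t x z * \<bar>g z\<bar>) \<partial>lborel)"
          by (rule nn_integral_cmult) measurable
        also have "\<dots> \<le> ennreal (1 / sqrt t + 1 / sqrt (1 - t)) * ennreal K"
          unfolding K_def by (intro mult_left_mono mehler_z_integral[OF t x R G]) auto
        finally show ?thesis using True by (simp add: mult.commute del: ennreal_plus)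
      qed simp
    qed
    also have "\<dots> = ennreal K * I" unfolding I_def by (rule nn_integral_cmult) measurable
    also have "\<dots> = ennreal (enn2real (ennreal K * I))" using I by (simp add: ennreal_mult_less_top)
    finally show "(\<integral>\<^sup>+q. ennreal (norm (case q of (t, z) \<Rightarrow> indicator {0<..<1} t * mehler_flux i t x z * g z)) \<partial>lborel2)
      \<le> ennreal (enn2real (ennreal K * I))" .
  qed
qed

lemma flux_integrable:
  "integrable lborel2 (\<lambda>(t, z). indicator {0<..<1} t * mehler_flux i t (x :: real ^ 'n) z * g z)"
proof -
  obtain C where "(\<integral>\<^sup>+q. ennreal (norm (case q of (t, z) \<Rightarrow> indicator {0<..<1} t * mehler_flux i t x z * g z)) \<partial>lborel2) \<le> ennreal C"
    by (rule flux_local_bound[OF norm_ge_zero[of x]]) blast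
  then have "(\<integral>\<^sup>+q. ennreal (norm (case q of (t, z) \<Rightarrow> indicator {0<..<1} t * mehler_flux i t x z * g z)) \<partial>lborel2) < \<infinity>"
    by (rule le_less_trans) simp
  then show ?thesis by (intro integrableI_bounded) measurable
qed

lemma mehler_g_integrable:
  assumes t: "0 \<le> t" "t < 1"
  shows "integrable lborel (\<lambda>z. mehler t (x :: real ^ 'n) z * ((1 + (norm z)\<^sup>2) * \<bar>g z\<bar>))"
proof (rule Bochner_Integration.integrable_bound[OF integrable_mult_right[OF g_moment, of "(1 / sqrt (1 - t)) ^ CARD('n)"]])
  have "norm (mehler t x z * ((1 + (norm z)\<^sup>2) * \<bar>g z\<bar>)) \<le> norm ((1 / sqrt (1 - t)) ^ CARD('n) * (gauss_kernel 1 z * ((1 + (norm z)\<^sup>2) * \<bar>g z\<bar>)))" for z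
  proof -
    have "mehler t x z * ((1 + (norm z)\<^sup>2) * \<bar>g z\<bar>) \<le> (1 / sqrt (1 - t)) ^ CARD('n) * gauss_kernel 1 z * ((1 + (norm z)\<^sup>2) * \<bar>g z\<bar>)"
      by (intro mult_right_mono mehler_le t) auto
    then show ?thesis using mehler_pos[OF t(2), of x z] t by (simp add: gauss_kernel_nonneg mult.assoc)
  qed
  then show "AE z in lborel. norm (mehler t x z * ((1 + (norm z)\<^sup>2) * \<bar>g z\<bar>)) \<le> norm ((1 / sqrt (1 - t)) ^ CARD('n) * (gauss_kernel 1 z * ((1 + (norm z)\<^sup>2) * \<bar>g z\<bar>)))"
    by simp
qed measurable

end

section \<open>The function T\<close>

lemma continuous_gauss_kernel[continuous_intros]:
  fixes f :: "'a::topological_space \<Rightarrow> real ^ 'n::finite"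
  shows "continuous_on S f \<Longrightarrow> continuous_on S (\<lambda>x. gauss_kernel s (f x))"
  unfolding gauss_kernel_def divide_inverse by (intro continuous_intros)

locale gaussian_sobolev = gaussian_square_integrable g for g :: "real ^ 'n::finite \<Rightarrow> real" +
  assumes g_ac: "absolutely_continuous_fun g"
begin

lemma partial_deriv_measurable[measurable]: "partial_deriv g i \<in> borel_measurable borel"
  using g_ac by (rule borel_measurable_partial_deriv)

lemma gauss_kernel_integration_by_parts:
  fixes x :: "real ^ 'n" and v :: "'n \<Rightarrow> real"
  assumes t: "0 < t" "t < 1"
    and int: "integrable lborel (\<lambda>z. gauss_kernel (1 - t) (z - sqrt t *\<^sub>R x) * (\<Sum>i\<in>UNIV. v i * partial_deriv g i z))"
  shows "(LINT z|lborel. gauss_kernel (1 - t) (z - sqrt t *\<^sub>R x) * (\<Sum>i\<in>UNIV. v i * partial_deriv g i z)) =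
    (LINT z|lborel. g z * (\<Sum>i\<in>UNIV. v i * ((z $ i - sqrt t * x $ i) / (1 - t) * gauss_kernel (1 - t) (z - sqrt t *\<^sub>R x))))"
proof -
  define s where "s = 1 - t"
  have s: "s > 0" using t by (simp add: s_def)
  define c where "c = sqrt t *\<^sub>R x"
  define q where "q z = gauss_kernel s (z - c)" for z :: "real ^ 'n"
  define q' where "q' i z = - ((z - c) $ i) / s * q z" for i z
  have q0: "q z \<ge> 0" for z using s by (simp add: q_def gauss_kernel_nonneg)
  have [measurable]: "q \<in> borel_measurable borel" "q' i \<in> borel_measurable borel" for i
    unfolding q_def[abs_def] q'_def[abs_def] by measurable
  have q_cont: "continuous_on UNIV q" "continuous_on UNIV (q' i)" for i
    unfolding q_def[abs_def] q'_def[abs_def] divide_inverse by (intro continuous_intros)+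
  have q_der: "((\<lambda>r. q (z + r *\<^sub>R axis i 1)) has_real_derivative q' i z) (at 0)" for z i
    unfolding q_def q'_def by (rule gauss_kernel_line_derivative[OF s])
  define K where "K = (\<lambda>k::nat. real (Suc k))"
  have K0: "K k > 0" "K k \<ge> 1" for k by (simp_all add: K_def)
  let ?L = "\<lambda>k z. \<Sum>i\<in>UNIV. v i * (1 * partial_deriv g i z * (cutoff (K k) z * q z))"
  let ?R = "\<lambda>k z. \<Sum>i\<in>UNIV. v i * (g z * (cutoff_deriv i (K k) z * q z + cutoff (K k) z * q' i z))"
  have eq: "(LINT z|lborel. ?L k z) = - (LINT z|lborel. ?R k z)" for k
  proof -
    have test: "C1_test_function i (\<lambda>z. cutoff (K k) z * q z) (\<lambda>z. cutoff_deriv i (K k) z * q z + cutoff (K k) z * q' i z)" for i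
      by (rule C1_test_function_cutoff) (use K0 q_cont q_der in auto)
    note wd = weak_derivative[OF g_ac test, of "\<lambda>w. w" "\<lambda>_. 1" 1, simplified]
    show ?thesis
      using wd by (simp add: sum_negf[symmetric])
  qed
  have lim1: "(\<lambda>k. LINT z|lborel. ?L k z) \<longlonglongrightarrow> (LINT z|lborel. q z * (\<Sum>i\<in>UNIV. v i * partial_deriv g i z))"
  proof (rule integral_dominated_convergence[where w="\<lambda>z. \<bar>q z * (\<Sum>i\<in>UNIV. v i * partial_deriv g i z)\<bar>"])
    show "integrable lborel (\<lambda>z. \<bar>q z * (\<Sum>i\<in>UNIV. v i * partial_deriv g i z)\<bar>)"
      using int unfolding q_def s_def c_def by (rule integrable_abs)
    have L: "?L k z = cutoff (K k) z * (q z * (\<Sum>i\<in>UNIV. v i * partial_deriv g i z))" for k z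
      by (simp add: sum_distrib_left mult_ac)
    show "AE z in lborel. (\<lambda>k. ?L k z) \<longlonglongrightarrow> q z * (\<Sum>i\<in>UNIV. v i * partial_deriv g i z)"
    proof (rule AE_I2)
      fix z :: "real ^ 'n"
      show "(\<lambda>k. ?L k z) \<longlonglongrightarrow> q z * (\<Sum>i\<in>UNIV. v i * partial_deriv g i z)"
        unfolding L using tendsto_mult_right[OF cutoff_tendsto_1[of z], of "q z * (\<Sum>i\<in>UNIV. v i * partial_deriv g i z)"]
        unfolding K_def mult_1_left .
    qed
    show "AE z in lborel. norm (?L k z) \<le> \<bar>q z * (\<Sum>i\<in>UNIV. v i * partial_deriv g i z)\<bar>" for k
      unfolding L real_norm_def
      by (intro AE_I2, subst abs_mult, rule mult_left_le_one_le) (simp_all add: cutoff_bounds)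
  qed measurable
  \<comment> \<open>Up to the factor 1 + |z|^2, the 4 bounds the cutoff derivative (the radii are at
    least 1) and \<open>(1 + norm c) / s\<close> the logarithmic derivative of \<open>q\<close>;
    division by \<open>gauss_kernel 1 x\<close> turns \<open>q\<close> into
    \<open>mehler t x\<close>.\<close>
  define D where "D = (\<Sum>i\<in>UNIV. \<bar>v i\<bar>) * ((4 + (1 + norm c) / s) / gauss_kernel 1 x)"
  have lim2: "(\<lambda>k. LINT z|lborel. ?R k z) \<longlonglongrightarrow> (LINT z|lborel. g z * (\<Sum>i\<in>UNIV. v i * q' i z))"
  proof (rule integral_dominated_convergence[where w="\<lambda>z. D * (mehler t x z * ((1 + (norm z)\<^sup>2) * \<bar>g z\<bar>))"])
    show "integrable lborel (\<lambda>z. D * (mehler t x z * ((1 + (norm z)\<^sup>2) * \<bar>g z\<bar>)))"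
      using t by (intro integrable_mult_right mehler_g_integrable) auto
    show "AE z in lborel. (\<lambda>k. ?R k z) \<longlonglongrightarrow> g z * (\<Sum>i\<in>UNIV. v i * q' i z)"
    proof (rule AE_I2)
      fix z :: "real ^ 'n"
      have d0: "(\<lambda>k. cutoff_deriv i (K k) z) \<longlonglongrightarrow> 0" for i :: 'n
      proof (rule Lim_null_comparison)
        show "\<forall>\<^sub>F k in sequentially. norm (cutoff_deriv i (K k) z) \<le> 4 * inverse (real (Suc k))"
          using cutoff_deriv_bound[OF K0(1), of i] by (intro always_eventually) (simp add: K_def divide_inverse)
        show "(\<lambda>k. 4 * inverse (real (Suc k))) \<longlonglongrightarrow> 0"
          using tendsto_mult_left[OF LIMSEQ_inverse_real_of_nat, of 4] by simp
      qed
      have "(\<lambda>k. ?R k z) \<longlonglongrightarrow> (\<Sum>i\<in>UNIV. v i * (g z * (0 * q z + 1 * q' i z)))"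
        using cutoff_tendsto_1[of z] by (intro tendsto_intros d0) (simp add: K_def)
      then show "(\<lambda>k. ?R k z) \<longlonglongrightarrow> g z * (\<Sum>i\<in>UNIV. v i * q' i z)"
        by (simp add: sum_distrib_left mult_ac)
    qed
    show "AE z in lborel. norm (?R k z) \<le> D * (mehler t x z * ((1 + (norm z)\<^sup>2) * \<bar>g z\<bar>))" for k
    proof (rule AE_I2)
      fix z :: "real ^ 'n"
      let ?N = "1 + (norm z)\<^sup>2"
      have m: "mehler t x z = gauss_kernel 1 x * q z"
        using mehler_commute[of t x z] t by (simp add: mehler_def q_def s_def c_def)
      have qb: "\<bar>q' i z\<bar> \<le> ((1 + norm c) / s * ?N) * q z" for i
      proof -
        have "\<bar>(z - c) $ i\<bar> \<le> norm (z - c)" by (rule component_le_norm_cart)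
        also have "\<dots> \<le> norm z + norm c" by (rule norm_triangle_ineq4)
        also have "\<dots> \<le> (1 + norm c) * ?N"
        proof -
          have "norm c * 1 \<le> norm c * ?N" by (rule mult_left_mono) auto
          then show ?thesis using norm_le_1_plus_power2[of z] by (simp add: distrib_right)
        qed
        finally have "\<bar>(z - c) $ i\<bar> / s \<le> (1 + norm c) * ?N / s" using s by (intro divide_right_mono) auto
        then have "\<bar>(z - c) $ i\<bar> / s * q z \<le> (1 + norm c) * ?N / s * q z" by (rule mult_right_mono) (rule q0)
        then show ?thesis using s q0[of z] by (simp add: q'_def abs_mult abs_minus_commute)
      qed
      have cb: "\<bar>cutoff_deriv i (K k) z * q z\<bar> \<le> (4 * ?N) * q z" for i
      proof -
        have "\<bar>cutoff_deriv i (K k) z\<bar> \<le> 4 / K k" by (rule cutoff_deriv_bound[OF K0(1)])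
        also have "\<dots> \<le> 4" using K0(2)[of k] by (simp add: field_simps)
        also have "\<dots> \<le> 4 * ?N" by simp
        finally show ?thesis using q0[of z] unfolding abs_mult by (intro mult_mono) auto
      qed
      have cq: "\<bar>cutoff (K k) z * q' i z\<bar> \<le> ((1 + norm c) / s * ?N) * q z" for i
        using mult_mono[of "\<bar>cutoff (K k) z\<bar>" 1 "\<bar>q' i z\<bar>" "((1 + norm c) / s * ?N) * q z"] cutoff_bounds[of "K k" z] qb[of i]
        unfolding abs_mult by simp
      have "norm (?R k z) \<le> (\<Sum>i\<in>UNIV. \<bar>v i\<bar> * (\<bar>g z\<bar> * ((4 + (1 + norm c) / s) * ?N * q z)))"
      proof (rule order_trans[OF norm_sum], rule sum_mono)
        fix i
        have "\<bar>cutoff_deriv i (K k) z * q z + cutoff (K k) z * q' i z\<bar> \<le> (4 + (1 + norm c) / s) * ?N * q z"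
          using cb[of i] cq[of i] abs_triangle_ineq[of "cutoff_deriv i (K k) z * q z" "cutoff (K k) z * q' i z"]
          unfolding distrib_right[of 4] distrib_right[of "4 * ?N"] by linarith
        then show "norm (v i * (g z * (cutoff_deriv i (K k) z * q z + cutoff (K k) z * q' i z))) \<le> \<bar>v i\<bar> * (\<bar>g z\<bar> * ((4 + (1 + norm c) / s) * ?N * q z))"
          unfolding real_norm_def abs_mult[of "v i"] abs_mult[of "g z"] by (intro mult_left_mono) auto
      qed
      also have "\<dots> = D * (mehler t x z * (?N * \<bar>g z\<bar>))"
        using gauss_kernel_pos[of 1 x] unfolding m D_def sum_distrib_right[symmetric] by (simp add: mult_ac)
      finally show "norm (?R k z) \<le> D * (mehler t x z * ((1 + (norm z)\<^sup>2) * \<bar>g z\<bar>))" .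
    qed
  qed measurable
  have "(LINT z|lborel. q z * (\<Sum>i\<in>UNIV. v i * partial_deriv g i z)) = - (LINT z|lborel. g z * (\<Sum>i\<in>UNIV. v i * q' i z))"
    using lim1 tendsto_minus[OF lim2] unfolding eq by (rule LIMSEQ_unique)
  also have "\<dots> = (LINT z|lborel. - (g z * (\<Sum>i\<in>UNIV. v i * q' i z)))" by simp
  also have "\<dots> = (LINT z|lborel. g z * (\<Sum>i\<in>UNIV. v i * ((z $ i - sqrt t * x $ i) / s * q z)))"
  proof -
    have "q' i z = - ((z $ i - sqrt t * x $ i) / s * q z)" for i z
      unfolding q'_def c_def vector_minus_component vector_scaleR_component real_scaleR_def
      by (simp only: minus_divide_left[symmetric] mult_minus_left)
    then show ?thesis by (simp only: mult_minus_right sum_negf minus_minus)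
  qed
  finally show ?thesis by (simp add: q_def s_def c_def)
qed

lemma mehler_flux_g_integrable:
  assumes t: "0 < t" "t < 1"
  shows "integrable lborel (\<lambda>z. mehler_flux i t x z * g z)"
proof (rule Bochner_Integration.integrable_bound)
  let ?c = "(1 + norm x) / (2 * sqrt t * (1 - t))"
  show "integrable lborel (\<lambda>z. ?c * (mehler t x z * ((1 + (norm z)\<^sup>2) * \<bar>g z\<bar>)))"
    using t by (intro integrable_mult_right mehler_g_integrable) auto
  show "AE z in lborel. norm (mehler_flux i t x z * g z) \<le> norm (?c * (mehler t x z * ((1 + (norm z)\<^sup>2) * \<bar>g z\<bar>)))"
  proof (rule AE_I2)
    fix z :: "real ^ 'n"
    have "\<bar>z $ i - sqrt t * x $ i\<bar> \<le> \<bar>z $ i\<bar> + sqrt t * \<bar>x $ i\<bar>" using t abs_triangle_ineq4[of "z $ i" "sqrt t * x $ i"] by (simp add: abs_mult)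
    also have "\<dots> \<le> (1 + (norm z)\<^sup>2) + 1 * norm x"
      using t component_le_1_plus_power2[of z i] component_le_norm_cart[of x i] by (intro add_mono mult_mono) auto
    also have "\<dots> \<le> (1 + norm x) * (1 + (norm z)\<^sup>2)" by (simp add: algebra_simps)
    finally have "\<bar>z $ i - sqrt t * x $ i\<bar> / (2 * sqrt t * (1 - t)) \<le> (1 + norm x) * (1 + (norm z)\<^sup>2) / (2 * sqrt t * (1 - t))"
      using t by (intro divide_right_mono) auto
    then have "\<bar>z $ i - sqrt t * x $ i\<bar> / (2 * sqrt t * (1 - t)) * (mehler t x z * \<bar>g z\<bar>) \<le> (1 + norm x) * (1 + (norm z)\<^sup>2) / (2 * sqrt t * (1 - t)) * (mehler t x z * \<bar>g z\<bar>)"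
      using t mehler_pos[of t x z] by (intro mult_right_mono) auto
    then show "norm (mehler_flux i t x z * g z) \<le> norm (?c * (mehler t x z * ((1 + (norm z)\<^sup>2) * \<bar>g z\<bar>)))"
      using t mehler_pos[of t x z] by (simp add: mehler_flux_def abs_mult mult_ac)
  qed
qed measurable

text \<open>\<open>T_fun\<close> times the Gaussian density, after integrating by parts in \<open>z\<close>. In contrast to
  \<open>T_fun\<close>, the inner integral exists at every \<open>x\<close>, and Borel measurability is evident.\<close>

definition Gamma_density :: "real ^ 'n \<Rightarrow> real" where
  "Gamma_density x = (\<Sum>i\<in>UNIV. partial_deriv g i x *
     (\<integral>(t, z). indicator {0<..<1} t * mehler_flux i t x z * g z \<partial>lborel2))"

lemma Gamma_density_measurable[measurable]: "Gamma_density \<in> borel_measurable borel"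
proof -
  interpret Q: sigma_finite_measure "lborel2 :: (real \<times> (real ^ 'n)) measure"
    by (simp add: sigma_finite_lborel lborel_prod)
  show ?thesis unfolding Gamma_density_def[abs_def] by measurable
qed

text \<open>For almost every time the inner expectation is a Gaussian integral around sqrt t x.
  Integration by parts creates (z_i - sqrt t x_i) / (1 - t), and together with 1 / (2 sqrt t) and
  \<open>gauss_kernel 1 x\<close> this is the flux. From then on each direction is integrable on its
  own and the sum may be split.\<close>

lemma T_fun_eq:
  fixes X :: "'a \<Rightarrow> real ^ 'n"
  assumes prob: "prob_space M" and X: "std_gaussian_vector M X" and T: "T_exists M X g x"
  shows "T_fun M X g x * gauss_kernel 1 x = Gamma_density x"
proof -
  interpret prob_space M by fact
  note law = std_gaussian_vector_law[OF prob X]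
  have [measurable]: "X \<in> borel_measurable M" by (rule law(1))
  define v where "v i = partial_deriv g i x" for i
  define f where "f t y = (\<Sum>i\<in>UNIV. v i * partial_deriv g i (sqrt t *\<^sub>R x + sqrt (1 - t) *\<^sub>R y))" for t y
  have gp: "grad_prod g x t y = f t y" for t y by (simp add: grad_prod_def f_def v_def)
  have fm[measurable]: "(\<lambda>(t, y). f t y) \<in> borel_measurable (borel \<Otimes>\<^sub>M borel)" unfolding f_def by measurable
  have tr: "integrable M (\<lambda>\<omega>. f t (X \<omega>)) \<longleftrightarrow> integrable std_gaussian (f t)"
    "(LINT \<omega>|M. f t (X \<omega>)) = (LINT y|std_gaussian. f t y)" for t
    unfolding law(2)[symmetric] by (subst integrable_distr_eq, auto, subst integral_distr, auto)
  have AEt: "AE t in lborel. t \<in> {0<..<1} \<longrightarrow> integrable std_gaussian (f t)"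
    using T unfolding T_exists_def gp tr by simp
  have key: "1 / (2 * sqrt t) * (LINT y|std_gaussian. f t y) * gauss_kernel 1 x = (\<Sum>i\<in>UNIV. v i * (LINT z|lborel. mehler_flux i t x z * g z))"
    if t: "0 < t" "t < 1" and int: "integrable std_gaussian (f t)" for t
  proof -
    define V where "V z = (\<Sum>i\<in>UNIV. v i * partial_deriv g i z)" for z
    have [measurable]: "V \<in> borel_measurable borel" unfolding V_def[abs_def] by measurable
    have s: "1 - t > 0" using t by simp
    have fV: "f t y = V (sqrt t *\<^sub>R x + sqrt (1 - t) *\<^sub>R y)" for y by (simp add: f_def V_def)
    have i1: "integrable lborel (\<lambda>z. gauss_kernel (1 - t) (z - sqrt t *\<^sub>R x) * V z)"
      using int unfolding fV[abs_def] by (subst gauss_kernel_integral(1)[OF s]) auto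
    have "(LINT y|std_gaussian. f t y) = (LINT z|lborel. gauss_kernel (1 - t) (z - sqrt t *\<^sub>R x) * V z)"
      unfolding fV by (rule gauss_kernel_integral(2)[OF s, symmetric]) measurable
    also have "\<dots> = (LINT z|lborel. g z * (\<Sum>i\<in>UNIV. v i * ((z $ i - sqrt t * x $ i) / (1 - t) * gauss_kernel (1 - t) (z - sqrt t *\<^sub>R x))))"
      using i1 unfolding V_def by (rule gauss_kernel_integration_by_parts[OF t])
    finally have "1 / (2 * sqrt t) * (LINT y|std_gaussian. f t y) * gauss_kernel 1 x =
       (LINT z|lborel. 1 / (2 * sqrt t) * (g z * (\<Sum>i\<in>UNIV. v i * ((z $ i - sqrt t * x $ i) / (1 - t) * gauss_kernel (1 - t) (z - sqrt t *\<^sub>R x)))) * gauss_kernel 1 x)"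
      by simp
    also have "\<dots> = (LINT z|lborel. (\<Sum>i\<in>UNIV. v i * (mehler_flux i t x z * g z)))"
    proof (intro Bochner_Integration.integral_cong refl)
      fix z :: "real ^ 'n"
      have m: "mehler t x z = gauss_kernel 1 x * gauss_kernel (1 - t) (z - sqrt t *\<^sub>R x)"
        using mehler_commute[of t x z] t by (simp add: mehler_def)
      show "1 / (2 * sqrt t) * (g z * (\<Sum>i\<in>UNIV. v i * ((z $ i - sqrt t * x $ i) / (1 - t) * gauss_kernel (1 - t) (z - sqrt t *\<^sub>R x)))) * gauss_kernel 1 x
        = (\<Sum>i\<in>UNIV. v i * (mehler_flux i t x z * g z))"
        unfolding mehler_flux_def m by (simp add: sum_distrib_left sum_distrib_right mult_ac)
    qed
    also have "\<dots> = (\<Sum>i\<in>UNIV. v i * (LINT z|lborel. mehler_flux i t x z * g z))"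
      using mehler_flux_g_integrable[OF t] by simp
    finally show ?thesis .
  qed
  have "T_fun M X g x * gauss_kernel 1 x = (LINT t|lborel. indicator {0<..<1} t *\<^sub>R (1 / (2 * sqrt t) * (LINT y|std_gaussian. f t y)) * gauss_kernel 1 x)"
    unfolding T_fun_def set_lebesgue_integral_def gp tr by (rule integral_mult_left_zero[symmetric])
  also have "\<dots> = (LINT t|lborel. (\<Sum>i\<in>UNIV. v i * (LINT z|lborel. indicator {0<..<1} t * mehler_flux i t x z * g z)))"
  proof (rule integral_cong_AE)
    show "AE t in lborel. indicator {0<..<1} t *\<^sub>R (1 / (2 * sqrt t) * (LINT y|std_gaussian. f t y)) * gauss_kernel 1 x =
       (\<Sum>i\<in>UNIV. v i * (LINT z|lborel. indicator {0<..<1} t * mehler_flux i t x z * g z))"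
      using AEt
    proof eventually_elim
      case (elim t)
      show ?case
      proof (cases "t \<in> {0<..<1}")
        case True
        then show ?thesis using key[of t] elim by (simp add: mult.assoc)
      qed simp
    qed
  qed measurable
  also have "\<dots> = (\<Sum>i\<in>UNIV. v i * (LINT t|lborel. LINT z|lborel. indicator {0<..<1} t * mehler_flux i t x z * g z))"
    using lborel_pair.integrable_fst'[OF flux_integrable, of _ x] by simp
  also have "\<dots> = Gamma_density x"
    unfolding Gamma_density_def v_def using lborel_pair.integral_fst'[OF flux_integrable, of _ x] by simp
  finally show ?thesis .
qed

end

section \<open>The Stein identity\<close>

text \<open>The singular factors are replaced by their values at the worst times \<open>a\<close>
  and \<open>b\<close>; what remains is independent of \<open>t\<close> and has a finite integral
  against \<open>g\<close>.\<close>

lemma mehler_flux_deriv_bound: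
  fixes x z :: "real ^ 'n::finite"
  assumes ab: "0 < a" "b < 1" and t: "a \<le> t" "t \<le> b" and x: "norm x \<le> R"
  shows "\<bar>mehler_flux_deriv i t x z\<bar> \<le>
    (1 + (2 + 2 * R\<^sup>2) / (1 - b)) / (2 * sqrt a * (1 - b)) * (1 / sqrt (1 - b)) ^ CARD('n) * ((1 + (norm z)\<^sup>2) * gauss_kernel 1 z)"
proof -
  have t01: "0 < t" "t < 1" "0 < 1 - b" "1 - b \<le> 1 - t" using ab t by auto
  have st: "sqrt t \<le> 1" "0 < sqrt a" "sqrt a \<le> sqrt t" using t01 ab t by auto
  have R: "R \<ge> 0" using x norm_ge_zero order_trans by blast
  let ?N = "1 + (norm z)\<^sup>2"
  have xi: "\<bar>x $ i\<bar> \<le> R" "\<bar>z $ i\<bar> \<le> norm z"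
    using component_le_norm_cart[of x i] component_le_norm_cart[of z i] x by auto
  have sx: "\<bar>sqrt t * x $ i\<bar> \<le> R" "\<bar>sqrt t * z $ i\<bar> \<le> norm z"
    using mult_mono[of "sqrt t" 1 "\<bar>x $ i\<bar>" R] mult_mono[of "sqrt t" 1 "\<bar>z $ i\<bar>" "norm z"] xi st t01 by (auto simp: abs_mult)
  have p: "\<bar>(z $ i - sqrt t * x $ i) * (x $ i - sqrt t * z $ i)\<bar> \<le> (norm z + R) * (norm z + R)"
    unfolding abs_mult by (intro mult_mono) (use xi sx R in auto)
  also have "\<dots> \<le> (2 + 2 * R\<^sup>2) * ?N"
  proof -
    have "(norm z + R) * (norm z + R) \<le> 2 * (norm z)\<^sup>2 + 2 * R\<^sup>2"
      using sum_squares_bound[of "norm z" R] by (simp add: power2_eq_square algebra_simps)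
    also have "\<dots> \<le> (2 + 2 * R\<^sup>2) * ?N" by (simp add: algebra_simps)
    finally show ?thesis .
  qed
  finally have p': "\<bar>(z $ i - sqrt t * x $ i) * (x $ i - sqrt t * z $ i)\<bar> \<le> (2 + 2 * R\<^sup>2) * ?N" .
  have n2: "\<bar>(z $ i - sqrt t * x $ i) * (x $ i - sqrt t * z $ i) / (1 - t)\<bar> \<le> (2 + 2 * R\<^sup>2) * ?N / (1 - b)"
    unfolding abs_divide using p' t01 by (intro frac_le) auto
  have n1: "\<bar>sqrt t\<bar> \<le> ?N" using st t01 by (intro order_trans[OF _ le_add_same_cancel1[THEN iffD2]]) auto
  have n3: "\<bar>- sqrt t - (z $ i - sqrt t * x $ i) * (x $ i - sqrt t * z $ i) / (1 - t)\<bar>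
      \<le> \<bar>sqrt t\<bar> + \<bar>(z $ i - sqrt t * x $ i) * (x $ i - sqrt t * z $ i) / (1 - t)\<bar>"
    using abs_triangle_ineq4[of "- sqrt t" "(z $ i - sqrt t * x $ i) * (x $ i - sqrt t * z $ i) / (1 - t)"]
    unfolding abs_minus_cancel .
  have num: "\<bar>- sqrt t - (z $ i - sqrt t * x $ i) * (x $ i - sqrt t * z $ i) / (1 - t)\<bar> \<le> (1 + (2 + 2 * R\<^sup>2) / (1 - b)) * ?N"
    unfolding distrib_right[of 1] times_divide_eq_left mult_1_left by (rule order_trans[OF n3 add_mono[OF n1 n2]])
  have den: "2 * sqrt a * (1 - b) \<le> \<bar>2 * sqrt t * (1 - t)\<bar>"
    using st t01 mult_mono[of "2 * sqrt a" "2 * sqrt t" "1 - b" "1 - t"] by simp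
  have q: "\<bar>(- sqrt t - (z $ i - sqrt t * x $ i) * (x $ i - sqrt t * z $ i) / (1 - t)) / (2 * sqrt t * (1 - t))\<bar>
      \<le> (1 + (2 + 2 * R\<^sup>2) / (1 - b)) * ?N / (2 * sqrt a * (1 - b))"
    unfolding abs_divide using num den st t01 by (intro frac_le) auto
  have m: "mehler t x z \<le> (1 / sqrt (1 - b)) ^ CARD('n) * gauss_kernel 1 z"
  proof -
    have "1 / sqrt (1 - t) \<le> 1 / sqrt (1 - b)" using t01 by (intro divide_left_mono) auto
    then have "(1 / sqrt (1 - t)) ^ CARD('n) \<le> (1 / sqrt (1 - b)) ^ CARD('n)" using t01 by (intro power_mono) auto
    then show ?thesis using mehler_le[of t x z] t01
      by (meson gauss_kernel_nonneg less_imp_le mult_right_mono order_trans zero_le_one)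
  qed
  have "\<bar>mehler_flux_deriv i t x z\<bar> \<le> ((1 + (2 + 2 * R\<^sup>2) / (1 - b)) * ?N / (2 * sqrt a * (1 - b))) * ((1 / sqrt (1 - b)) ^ CARD('n) * gauss_kernel 1 z)"
    unfolding mehler_flux_deriv_def abs_mult[of _ "mehler t x z"]
    using q m mehler_pos[of t x z] t01 st by (intro mult_mono) auto
  then show ?thesis by (simp add: mult_ac)
qed

lemma mehler_time_FTC:
  fixes x z :: "real ^ 'n::finite"
  assumes ab: "0 < a" "a \<le> b" "b < 1"
  shows "(LINT t|lborel. indicator {a..b} t * (\<Sum>i\<in>UNIV. mehler_flux_deriv i t x z)) = - (mehler b x z - mehler a x z)"
proof -
  have "(LINT t|lborel. (- (\<Sum>i\<in>UNIV. mehler_flux_deriv i t x z)) * indicator {a..b} t) = mehler b x z - mehler a x z"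
  proof (rule integral_FTC_Icc_real[OF ab(2)])
    fix t assume t: "a \<le> t" "t \<le> b"
    then have t01: "0 < t" "t < 1" using ab by auto
    show der: "((\<lambda>t. mehler t x z) has_real_derivative - (\<Sum>i\<in>UNIV. mehler_flux_deriv i t x z)) (at t)"
      by (rule mehler_time_derivative[OF t01])
    have c: "isCont (\<lambda>t. mehler t x z) t" using der by (rule DERIV_isCont)
    show "isCont (\<lambda>t. - (\<Sum>i\<in>UNIV. mehler_flux_deriv i t x z)) t"
      unfolding mehler_flux_deriv_def
      by (intro continuous_intros c) (use t01 in auto)
  qed
  then have "- (LINT t|lborel. indicator {a..b} t * (\<Sum>i\<in>UNIV. mehler_flux_deriv i t x z)) = mehler b x z - mehler a x z"
    by (simp add: mult.commute)
  then show ?thesis by simp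
qed

context gaussian_sobolev
begin

text \<open>At time 1 the joint law has no density. Written as an expectation over independent
  \<open>z\<close> and \<open>y\<close>, the average of u(x) g(z) is continuous in time up to both
  ends.\<close>

lemma gaussian_average_tendsto:
  fixes u :: "real ^ 'n \<Rightarrow> real" and t :: "nat \<Rightarrow> real"
  assumes u_cont: "continuous_on UNIV u" and u_bd: "\<And>x. \<bar>u x\<bar> \<le> B" and t: "t \<longlonglongrightarrow> t0"
  shows "(\<lambda>k. LINT z|std_gaussian. g z * (LINT y|std_gaussian. u (sqrt (t k) *\<^sub>R z + sqrt (1 - t k) *\<^sub>R y)))
     \<longlonglongrightarrow> (LINT z|std_gaussian. g z * (LINT y|std_gaussian. u (sqrt t0 *\<^sub>R z + sqrt (1 - t0) *\<^sub>R y)))"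
proof (rule integral_dominated_convergence[where w="\<lambda>z. B * \<bar>g z\<bar>"])
  have [measurable]: "u \<in> borel_measurable borel" using u_cont by (rule borel_measurable_continuous_onI)
  have m: "(\<lambda>z. LINT y|std_gaussian. u (sqrt s *\<^sub>R z + sqrt (1 - s) *\<^sub>R y)) \<in> borel_measurable borel" for s
    by measurable
  show "(\<lambda>z. g z * (LINT y|std_gaussian. u (sqrt t0 *\<^sub>R z + sqrt (1 - t0) *\<^sub>R y))) \<in> borel_measurable std_gaussian"
    "(\<lambda>z. g z * (LINT y|std_gaussian. u (sqrt (t k) *\<^sub>R z + sqrt (1 - t k) *\<^sub>R y))) \<in> borel_measurable std_gaussian" for k
    by measurable
  have "integrable std_gaussian g"
    by (rule std_gaussian.square_integrable_imp_integrable[OF _ g_L2]) simp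
  then show "integrable std_gaussian (\<lambda>z. B * \<bar>g z\<bar>)" by simp
  show "AE z in std_gaussian. (\<lambda>k. g z * (LINT y|std_gaussian. u (sqrt (t k) *\<^sub>R z + sqrt (1 - t k) *\<^sub>R y)))
     \<longlonglongrightarrow> g z * (LINT y|std_gaussian. u (sqrt t0 *\<^sub>R z + sqrt (1 - t0) *\<^sub>R y))"
  proof (rule AE_I2, rule tendsto_mult_left)
    fix z :: "real ^ 'n"
    show "(\<lambda>k. LINT y|std_gaussian. u (sqrt (t k) *\<^sub>R z + sqrt (1 - t k) *\<^sub>R y))
      \<longlonglongrightarrow> (LINT y|std_gaussian. u (sqrt t0 *\<^sub>R z + sqrt (1 - t0) *\<^sub>R y))"
    proof (rule integral_dominated_convergence[where w="\<lambda>_. B"])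
      show "AE y in std_gaussian. (\<lambda>k. u (sqrt (t k) *\<^sub>R z + sqrt (1 - t k) *\<^sub>R y)) \<longlonglongrightarrow> u (sqrt t0 *\<^sub>R z + sqrt (1 - t0) *\<^sub>R y)"
      proof (rule AE_I2)
        fix y :: "real ^ 'n"
        have "isCont u (sqrt t0 *\<^sub>R z + sqrt (1 - t0) *\<^sub>R y)" using u_cont by (simp add: continuous_on_eq_continuous_at)
        moreover have "(\<lambda>k. sqrt (t k) *\<^sub>R z + sqrt (1 - t k) *\<^sub>R y) \<longlonglongrightarrow> sqrt t0 *\<^sub>R z + sqrt (1 - t0) *\<^sub>R y"
          by (intro tendsto_intros t)
        ultimately show "(\<lambda>k. u (sqrt (t k) *\<^sub>R z + sqrt (1 - t k) *\<^sub>R y)) \<longlonglongrightarrow> u (sqrt t0 *\<^sub>R z + sqrt (1 - t0) *\<^sub>R y)"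
          by (rule isCont_tendsto_compose)
      qed
    qed (use u_bd in auto)
  qed
  show "AE z in std_gaussian. norm (g z * (LINT y|std_gaussian. u (sqrt (t k) *\<^sub>R z + sqrt (1 - t k) *\<^sub>R y))) \<le> B * \<bar>g z\<bar>" for k
  proof (rule AE_I2)
    fix z :: "real ^ 'n"
    have i: "integrable std_gaussian (\<lambda>y. u (sqrt (t k) *\<^sub>R z + sqrt (1 - t k) *\<^sub>R y))"
      using u_bd by (intro std_gaussian.integrable_const_bound[where B=B]) auto
    have "\<bar>LINT y|std_gaussian. u (sqrt (t k) *\<^sub>R z + sqrt (1 - t k) *\<^sub>R y)\<bar> \<le>
        (LINT y|std_gaussian. \<bar>u (sqrt (t k) *\<^sub>R z + sqrt (1 - t k) *\<^sub>R y)\<bar>)"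
      by (rule integral_abs_bound)
    also have "\<dots> \<le> B" using u_bd i by (intro std_gaussian.integral_le_const) auto
    finally have "\<bar>LINT y|std_gaussian. u (sqrt (t k) *\<^sub>R z + sqrt (1 - t k) *\<^sub>R y)\<bar> \<le> B" .
    then show "norm (g z * (LINT y|std_gaussian. u (sqrt (t k) *\<^sub>R z + sqrt (1 - t k) *\<^sub>R y))) \<le> B * \<bar>g z\<bar>"
      unfolding real_norm_def abs_mult mult.commute[of "\<bar>g z\<bar>"] by (rule mult_right_mono) simp
  qed
qed

interpretation P: pair_sigma_finite "lborel :: (real ^ 'n) measure" "lborel2 :: (real \<times> (real ^ 'n)) measure"
  by (simp add: pair_sigma_finite_def sigma_finite_lborel lborel_prod)

lemma sigma_finite_time_space: "sigma_finite_measure (lborel2 :: (real \<times> (real ^ 'n)) measure)"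
  by (simp add: sigma_finite_lborel lborel_prod)

section \<open>The identity for a fixed cutoff radius\<close>

context
  fixes \<phi> \<psi> :: "real \<Rightarrow> real" and B R :: real
  assumes \<phi>: "\<And>w. (\<phi> has_real_derivative \<psi> w) (at w)" and \<psi>: "\<And>w. \<bar>\<psi> w\<bar> \<le> 1"
    and \<psi>m[measurable]: "\<psi> \<in> borel_measurable borel" and \<phi>b: "\<And>w. \<bar>\<phi> w\<bar> \<le> B" and R: "R > 0"
begin

lemma \<phi>_cont: "continuous_on UNIV \<phi>"
  using \<phi> by (meson DERIV_isCont continuous_at_imp_continuous_on)

lemma \<phi>_measurable[measurable]: "\<phi> \<in> borel_measurable borel"
  using \<phi>_cont by (rule borel_measurable_continuous_onI)

lemma cball_measurable[measurable]: "cball (0 :: real ^ 'n) R \<in> sets borel"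
  by simp

lemma B_nonneg: "B \<ge> 0"
  using \<phi>b[of 0] by linarith

text \<open>Integrating \<open>\<phi> \<circ> g \<cdot> cutoff \<cdot> flux\<close> by parts in direction \<open>i\<close> produces three terms with vanishing
  sum. By the continuity equation, summing the third over \<open>i\<close> gives a time derivative.\<close>

definition main_term :: "'n \<Rightarrow> real set \<Rightarrow> (real ^ 'n) \<times> real \<times> (real ^ 'n) \<Rightarrow> real" where
  "main_term i S = (\<lambda>(x, t, z). (\<psi> (g x) * partial_deriv g i x * cutoff R x) * (indicator S t * mehler_flux i t x z * g z))"

definition cutoff_term :: "'n \<Rightarrow> real set \<Rightarrow> (real ^ 'n) \<times> real \<times> (real ^ 'n) \<Rightarrow> real" where
  "cutoff_term i S = (\<lambda>(x, t, z). (\<phi> (g x) * cutoff_deriv i R x) * (indicator S t * mehler_flux i t x z * g z))"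

definition time_term :: "'n \<Rightarrow> real set \<Rightarrow> (real ^ 'n) \<times> real \<times> (real ^ 'n) \<Rightarrow> real" where
  "time_term i S = (\<lambda>(x, t, z). (\<phi> (g x) * cutoff R x) * (indicator S t * mehler_flux_deriv i t x z * g z))"

lemma terms_measurable[measurable]:
  assumes [measurable]: "S \<in> sets borel"
  shows "main_term i S \<in> borel_measurable lborel3"
    "cutoff_term i S \<in> borel_measurable lborel3"
    "time_term i S \<in> borel_measurable lborel3"
  unfolding main_term_def cutoff_term_def time_term_def by measurable

text \<open>On the support of the cutoff the flux has a uniformly bounded integral over time and
  \<open>z\<close>, and the gradient is integrable there.\<close>

lemma main_term_integrable: "integrable lborel3 (main_term i {0<..<1})"
proof (rule integrableI_bounded)
  let ?J = "\<lambda>x q. case q of (t, z) \<Rightarrow> indicator {0<..<1} t * mehler_flux i t x z * g z"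
  let ?c = "\<lambda>x. \<psi> (g x) * partial_deriv g i x * cutoff R x"
  obtain C where C: "C \<ge> 0" "\<And>x. norm x \<le> R \<Longrightarrow> (\<integral>\<^sup>+q. ennreal (norm (?J x q)) \<partial>lborel2) \<le> ennreal C"
    by (rule flux_local_bound[of R]) (use R in auto)
  have pd: "integrable lborel (\<lambda>x. indicator (cball 0 R) x *\<^sub>R partial_deriv g i x)"
    using g_ac compact_cball[of "0 :: real ^ 'n" R] unfolding absolutely_continuous_fun_def set_integrable_def by blast
  have "(\<integral>\<^sup>+p. ennreal (norm (main_term i {0<..<1} p)) \<partial>lborel3) =
     (\<integral>\<^sup>+x. \<integral>\<^sup>+q. ennreal (norm (main_term i {0<..<1} (x, q))) \<partial>lborel2 \<partial>lborel)"
    by (rule sigma_finite_measure.nn_integral_fst[OF sigma_finite_time_space, symmetric]) measurable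
  also have "\<dots> \<le> (\<integral>\<^sup>+x. ennreal C * ennreal (norm (indicator (cball 0 R) x *\<^sub>R partial_deriv g i x)) \<partial>lborel)"
  proof (rule nn_integral_mono)
    fix x :: "real ^ 'n"
    show "(\<integral>\<^sup>+q. ennreal (norm (main_term i {0<..<1} (x, q))) \<partial>lborel2)
       \<le> ennreal C * ennreal (norm (indicator (cball 0 R) x *\<^sub>R partial_deriv g i x))"
    proof (cases "norm x \<le> R")
      case True
      have "(\<integral>\<^sup>+q. ennreal (norm (main_term i {0<..<1} (x, q))) \<partial>lborel2) =
         (\<integral>\<^sup>+q. ennreal \<bar>?c x\<bar> * ennreal (norm (?J x q)) \<partial>lborel2)"
        by (intro nn_integral_cong) (auto simp: main_term_def abs_mult ennreal_mult)
      also have "\<dots> = ennreal \<bar>?c x\<bar> * (\<integral>\<^sup>+q. ennreal (norm (?J x q)) \<partial>lborel2)"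
        by (rule nn_integral_cmult) measurable
      also have "\<dots> \<le> ennreal \<bar>partial_deriv g i x\<bar> * ennreal C"
      proof (rule mult_mono[OF ennreal_leI C(2)[OF True]])
        have "\<bar>\<psi> (g x)\<bar> * \<bar>cutoff R x\<bar> \<le> 1 * 1" using \<psi>[of "g x"] by (intro mult_mono) (auto simp: cutoff_bounds)
        then have "(\<bar>\<psi> (g x)\<bar> * \<bar>cutoff R x\<bar>) * \<bar>partial_deriv g i x\<bar> \<le> 1 * \<bar>partial_deriv g i x\<bar>" by (intro mult_right_mono) auto
        then show "\<bar>?c x\<bar> \<le> \<bar>partial_deriv g i x\<bar>" by (simp add: abs_mult mult_ac)
      qed auto
      finally show ?thesis using True by (simp add: mult.commute)
    next
      case False
      then show ?thesis using cutoff_zero[OF R, of x] by (simp add: main_term_def split_def)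
    qed
  qed
  also have "\<dots> = ennreal C * (\<integral>\<^sup>+x. ennreal (norm (indicator (cball 0 R) x *\<^sub>R partial_deriv g i x)) \<partial>lborel)"
    by (rule nn_integral_cmult) (use borel_measurable_integrable[OF pd] in measurable)
  also have "\<dots> < \<infinity>" using pd unfolding integrable_iff_bounded by (simp add: ennreal_mult_less_top)
  finally show "(\<integral>\<^sup>+p. ennreal (norm (main_term i {0<..<1} p)) \<partial>lborel3) < \<infinity>" .
qed measurable

lemma cutoff_term_bound: "\<bar>cutoff_term i S (x, t, z)\<bar> \<le> 4 / R * B * \<bar>indicator S t * mehler_flux i t x z * g z\<bar>"
proof -
  have "\<bar>\<phi> (g x)\<bar> * \<bar>cutoff_deriv i R x\<bar> \<le> B * (4 / R)"
    using \<phi>b cutoff_deriv_bound[OF R] B_nonneg by (intro mult_mono) auto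
  then have "(\<bar>\<phi> (g x)\<bar> * \<bar>cutoff_deriv i R x\<bar>) * \<bar>indicator S t * mehler_flux i t x z * g z\<bar> \<le> B * (4 / R) * \<bar>indicator S t * mehler_flux i t x z * g z\<bar>"
    by (rule mult_right_mono) simp
  then show ?thesis unfolding cutoff_term_def abs_mult prod.case by (simp add: mult_ac)
qed

lemma cutoff_term_integrable: "integrable lborel3 (cutoff_term i {0<..<1})"
proof (rule Bochner_Integration.integrable_bound)
  show "integrable lborel3 (\<lambda>p. 4 / R * B * \<bar>case p of (x, t, z) \<Rightarrow> indicator {0<..<1} t * mehler_flux i t x z * g z\<bar>)"
    by (intro integrable_mult_right integrable_abs flux_globally_integrable)
  show "AE p in lborel3. norm (cutoff_term i {0<..<1} p) \<le>
      norm (4 / R * B * \<bar>case p of (x, t, z) \<Rightarrow> indicator {0<..<1} t * mehler_flux i t x z * g z\<bar>)"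
    using cutoff_term_bound[of i "{0<..<1}"] B_nonneg R by (intro AE_I2) (auto simp: abs_mult)
qed measurable

lemma terms_subset_integrable:
  assumes [measurable]: "S \<in> sets borel" and S: "S \<subseteq> {0<..<1}"
  shows "integrable lborel3 (main_term i S)"
    "integrable lborel3 (cutoff_term i S)"
proof -
  have a: "AE p in lborel3. norm (main_term i S p) \<le> norm (main_term i {0<..<1} p)"
    "AE p in lborel3. norm (cutoff_term i S p) \<le> norm (cutoff_term i {0<..<1} p)"
    using S by (auto intro!: AE_I2 simp: main_term_def cutoff_term_def indicator_def)
  show "integrable lborel3 (main_term i S)"
    by (rule Bochner_Integration.integrable_bound[OF main_term_integrable _ a(1)]) measurable
  show "integrable lborel3 (cutoff_term i S)"
    by (rule Bochner_Integration.integrable_bound[OF cutoff_term_integrable _ a(2)]) measurable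
qed

text \<open>Staying away from times 0 and 1 gives a bound on the divergence; the support in
  \<open>x\<close> has finite volume and the moment of \<open>g\<close> handles
  \<open>z\<close>.\<close>

lemma time_term_integrable:
  assumes ab: "0 < a" "b < 1"
  shows "integrable lborel3 (time_term i {a..b})"
proof (rule integrableI_bounded)
  define K where "K = B * ((1 + (2 + 2 * R\<^sup>2) / (1 - b)) / (2 * sqrt a * (1 - b)) * (1 / sqrt (1 - b)) ^ CARD('n))"
  have K: "K \<ge> 0" unfolding K_def using ab B_nonneg by (intro mult_nonneg_nonneg divide_nonneg_nonneg add_nonneg_nonneg) auto
  let ?h = "\<lambda>z. ennreal (gauss_kernel 1 z * ((1 + (norm z)\<^sup>2) * \<bar>g z\<bar>))"
  have "(\<integral>\<^sup>+p. ennreal (norm (time_term i {a..b} p)) \<partial>lborel3)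
     \<le> (\<integral>\<^sup>+p. (case p of (x :: real ^ 'n, t, z) \<Rightarrow> indicator (cball 0 R) x * (indicator {a..b} t * (ennreal K * ?h z))) \<partial>lborel3)"
  proof (rule nn_integral_mono)
    fix p :: "(real ^ 'n) \<times> real \<times> (real ^ 'n)"
    obtain x t z where p: "p = (x, t, z)" by (cases p) auto
    show "ennreal (norm (time_term i {a..b} p)) \<le> (case p of (x, t, z) \<Rightarrow> indicator (cball 0 R) x * (indicator {a..b} t * (ennreal K * ?h z)))"
    proof (cases "norm x \<le> R \<and> t \<in> {a..b}")
      case True
      have c1: "\<bar>\<phi> (g x)\<bar> * \<bar>cutoff R x\<bar> \<le> B * 1"
        using \<phi>b B_nonneg by (intro mult_mono) (auto simp: cutoff_bounds)
      have c2: "\<bar>mehler_flux_deriv i t x z\<bar> \<le> (1 + (2 + 2 * R\<^sup>2) / (1 - b)) / (2 * sqrt a * (1 - b)) * (1 / sqrt (1 - b)) ^ CARD('n) * ((1 + (norm z)\<^sup>2) * gauss_kernel 1 z)"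
        by (rule mehler_flux_deriv_bound[OF ab]) (use True in auto)
      have "(\<bar>\<phi> (g x)\<bar> * \<bar>cutoff R x\<bar>) * \<bar>mehler_flux_deriv i t x z\<bar> \<le> B * 1 * ((1 + (2 + 2 * R\<^sup>2) / (1 - b)) / (2 * sqrt a * (1 - b)) * (1 / sqrt (1 - b)) ^ CARD('n) * ((1 + (norm z)\<^sup>2) * gauss_kernel 1 z))"
        by (rule mult_mono[OF c1 c2]) (use B_nonneg in auto)
      also have "\<dots> = K * ((1 + (norm z)\<^sup>2) * gauss_kernel 1 z)" by (simp add: K_def)
      finally have "(\<bar>\<phi> (g x)\<bar> * \<bar>cutoff R x\<bar>) * \<bar>mehler_flux_deriv i t x z\<bar> * \<bar>g z\<bar> \<le> K * ((1 + (norm z)\<^sup>2) * gauss_kernel 1 z) * \<bar>g z\<bar>"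
        by (rule mult_right_mono) simp
      then have "\<bar>time_term i {a..b} p\<bar> \<le> K * (gauss_kernel 1 z * ((1 + (norm z)\<^sup>2) * \<bar>g z\<bar>))"
        using True by (simp add: p time_term_def abs_mult mult_ac)
      then have "ennreal (norm (time_term i {a..b} p)) \<le> ennreal K * ?h z"
        using K by (subst ennreal_mult[symmetric]) (auto intro!: ennreal_leI simp: gauss_kernel_nonneg)
      then show ?thesis using True by (simp add: p)
    next
      case False
      then have "time_term i {a..b} p = 0" using cutoff_zero[OF R, of x] by (auto simp: p time_term_def)
      then show ?thesis by simp
    qed
  qed
  also have "\<dots> = (\<integral>\<^sup>+x. indicator (cball (0 :: real ^ 'n) R) x * (\<integral>\<^sup>+t. indicator {a..b} t * (ennreal K * ennreal gmom) \<partial>lborel) \<partial>lborel)"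
  proof -
    have "(\<integral>\<^sup>+q. (case q of (t, z) \<Rightarrow> indicator (cball (0 :: real ^ 'n) R) x * (indicator {a..b} t * (ennreal K * ?h z))) \<partial>lborel2) =
       indicator (cball 0 R) x * (\<integral>\<^sup>+t. indicator {a..b} t * (ennreal K * ennreal gmom) \<partial>lborel)" for x
      by (subst lborel.nn_integral_fst[symmetric]) (auto simp: nn_integral_cmult gmom)
    note inner = this
    show ?thesis
      by (subst sigma_finite_measure.nn_integral_fst[OF sigma_finite_time_space, symmetric])
        (measurable, simp only: prod.case inner)
  qed
  also have "\<dots> < \<infinity>"
    using emeasure_lborel_cball_finite[of "0 :: real ^ 'n" R]
    by (simp add: nn_integral_multc ennreal_mult_less_top emeasure_lborel_Icc_eq)
  finally show "(\<integral>\<^sup>+p. ennreal (norm (time_term i {a..b} p)) \<partial>lborel3) < \<infinity>" .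
qed measurable

text \<open>For fixed time and \<open>z\<close> the three terms add up to \<open>g z\<close> times
  the integrand of \<open>weak_derivative\<close>, with cutoff times flux as the test function. So
  the integral over \<open>x\<close> is taken first.\<close>

lemma terms_sum_zero:
  assumes ab: "0 < a" "b < 1"
  shows "(\<integral>p. main_term i {a..b} p + cutoff_term i {a..b} p + time_term i {a..b} p \<partial>lborel3) = 0"
proof -
  have S: "{a..b} \<subseteq> {0<..<1}" using ab by auto
  let ?F = "\<lambda>x q. main_term i {a..b} (x, q) + cutoff_term i {a..b} (x, q) + time_term i {a..b} (x, q)"
  have int: "integrable lborel3 (\<lambda>(x, q). ?F x q)"
    using terms_subset_integrable[OF _ S, of i] time_term_integrable[OF ab, of i] by (simp add: split_def)
  have "(LINT x|lborel. ?F x q) = 0" for q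
  proof -
    obtain t z where q: "q = (t, z)" by (cases q)
    show ?thesis
    proof (cases "t \<in> {a..b}")
      case True
      then have t: "0 < t" "t < 1" using ab by auto
      have cm: "continuous_on UNIV (\<lambda>x. mehler t x z)" unfolding mehler_def by (intro continuous_intros)
      have test: "C1_test_function i (\<lambda>x. cutoff R x * mehler_flux i t x z)
          (\<lambda>x. cutoff_deriv i R x * mehler_flux i t x z + cutoff R x * mehler_flux_deriv i t x z)"
      proof (rule C1_test_function_cutoff[OF R])
        show "continuous_on UNIV (\<lambda>x. mehler_flux i t x z)" "continuous_on UNIV (\<lambda>x. mehler_flux_deriv i t x z)"
          unfolding mehler_flux_def mehler_flux_deriv_def divide_inverse by (intro continuous_intros cm)+
      qed (rule mehler_flux_line_derivative[OF t])
      note wd = weak_derivative[OF g_ac test \<phi> \<psi> \<psi>m]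
      have "(LINT x|lborel. ?F x q) = (LINT x|lborel. g z * (\<psi> (g x) * partial_deriv g i x * (cutoff R x * mehler_flux i t x z) +
          \<phi> (g x) * (cutoff_deriv i R x * mehler_flux i t x z + cutoff R x * mehler_flux_deriv i t x z)))"
        using True unfolding q main_term_def cutoff_term_def time_term_def
        by (intro Bochner_Integration.integral_cong refl) (simp add: algebra_simps)
      also have "\<dots> = 0" using wd by simp
      finally show ?thesis .
    qed (simp add: q main_term_def cutoff_term_def time_term_def)
  qed
  then have "(LINT q|lborel2. LINT x|lborel. ?F x q) = 0" by simp
  then show ?thesis using P.integral_snd[OF int] by (simp add: split_def)
qed

definition cutoff_composite :: "real ^ 'n \<Rightarrow> real" where
  "cutoff_composite x = \<phi> (g x) * cutoff R x"

lemma cutoff_composite_cont: "continuous_on UNIV cutoff_composite"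
  unfolding cutoff_composite_def[abs_def]
  by (intro continuous_intros continuous_on_compose2[OF \<phi>_cont g_cont]) auto

lemma cutoff_composite_measurable[measurable]: "cutoff_composite \<in> borel_measurable borel"
  using cutoff_composite_cont by (rule borel_measurable_continuous_onI)

lemma cutoff_composite_bound: "\<bar>cutoff_composite x\<bar> \<le> B"
proof -
  have "\<bar>\<phi> (g x)\<bar> * \<bar>cutoff R x\<bar> \<le> B * 1"
    using \<phi>b B_nonneg by (intro mult_mono) (auto simp: cutoff_bounds)
  then show ?thesis by (simp add: cutoff_composite_def abs_mult)
qed

lemma mehler_average_integrable:
  assumes t: "0 < t" "t < 1"
  shows "integrable lborel2 (\<lambda>(x, z). cutoff_composite x * g z * mehler t x z)"
proof (rule integrableI_bounded)
  define K where "K = B * (1 / sqrt (1 - t)) ^ CARD('n)"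
  have K: "K \<ge> 0" using B_nonneg t by (simp add: K_def)
  let ?h = "\<lambda>z. ennreal (gauss_kernel 1 z * ((1 + (norm z)\<^sup>2) * \<bar>g z\<bar>))"
  have "(\<integral>\<^sup>+p. ennreal (norm (case p of (x, z) \<Rightarrow> cutoff_composite x * g z * mehler t x z)) \<partial>lborel2)
     \<le> (\<integral>\<^sup>+p. (case p of (x :: real ^ 'n, z) \<Rightarrow> indicator (cball 0 R) x * (ennreal K * ?h z)) \<partial>lborel2)"
  proof (rule nn_integral_mono)
    fix p :: "(real ^ 'n) \<times> (real ^ 'n)"
    obtain x z where p: "p = (x, z)" by (cases p) auto
    show "ennreal (norm (case p of (x, z) \<Rightarrow> cutoff_composite x * g z * mehler t x z)) \<le>
       (case p of (x, z) \<Rightarrow> indicator (cball 0 R) x * (ennreal K * ?h z))"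
    proof (cases "norm x \<le> R")
      case True
      have m: "mehler t x z \<le> (1 / sqrt (1 - t)) ^ CARD('n) * gauss_kernel 1 z" using t by (intro mehler_le) auto
      have "\<bar>g z\<bar> * 1 \<le> \<bar>g z\<bar> * (1 + (norm z)\<^sup>2)" by (rule mult_left_mono) auto
      then have "\<bar>cutoff_composite x\<bar> * \<bar>g z\<bar> * mehler t x z \<le> B * (\<bar>g z\<bar> * (1 + (norm z)\<^sup>2)) * ((1 / sqrt (1 - t)) ^ CARD('n) * gauss_kernel 1 z)"
        using m mehler_pos[of t x z] t cutoff_composite_bound[of x] B_nonneg by (intro mult_mono) auto
      then have "\<bar>cutoff_composite x * g z * mehler t x z\<bar> \<le> K * (gauss_kernel 1 z * ((1 + (norm z)\<^sup>2) * \<bar>g z\<bar>))"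
        using mehler_pos[of t x z] t by (simp add: K_def abs_mult mult_ac)
      then have "ennreal (norm (cutoff_composite x * g z * mehler t x z)) \<le> ennreal K * ?h z"
        using K by (subst ennreal_mult[symmetric]) (auto intro!: ennreal_leI simp: gauss_kernel_nonneg)
      then show ?thesis using True by (simp add: p)
    next
      case False
      then show ?thesis using cutoff_zero[OF R, of x] by (simp add: p cutoff_composite_def)
    qed
  qed
  also have "\<dots> = (\<integral>\<^sup>+x. \<integral>\<^sup>+z. indicator (cball (0 :: real ^ 'n) R) x * (ennreal K * ?h z) \<partial>lborel \<partial>lborel)"
    by (subst lborel.nn_integral_fst[symmetric]) auto
  also have "\<dots> = (\<integral>\<^sup>+x. indicator (cball (0 :: real ^ 'n) R) x * (ennreal K * ennreal gmom) \<partial>lborel)"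
    by (simp add: nn_integral_cmult gmom)
  also have "\<dots> < \<infinity>"
    using emeasure_lborel_cball_finite[of "0 :: real ^ 'n" R]
    by (simp add: nn_integral_multc ennreal_mult_less_top)
  finally show "(\<integral>\<^sup>+p. ennreal (norm (case p of (x, z) \<Rightarrow> cutoff_composite x * g z * mehler t x z)) \<partial>lborel2) < \<infinity>" .
qed measurable

text \<open>The divergence is minus the time derivative of the density, so for fixed
  \<open>x\<close> and \<open>z\<close> the time integral collapses to the values at
  \<open>a\<close> and \<open>b\<close>.\<close>

lemma time_term_sum:
  assumes ab: "0 < a" "a \<le> b" "b < 1"
  shows "(\<Sum>i\<in>UNIV. \<integral>p. time_term i {a..b} p \<partial>lborel3) =
     - ((\<integral>(x, z). cutoff_composite x * g z * mehler b x z \<partial>lborel2) -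
        (\<integral>(x, z). cutoff_composite x * g z * mehler a x z \<partial>lborel2))"
proof -
  let ?P = "lborel3 :: ((real ^ 'n) \<times> real \<times> (real ^ 'n)) measure"
  define F where "F p = (\<Sum>i\<in>UNIV. time_term i {a..b} p)" for p
  let ?D = "\<lambda>x z. cutoff_composite x * g z * mehler b x z - cutoff_composite x * g z * mehler a x z"
  have Fi: "integrable ?P F" unfolding F_def[abs_def] using time_term_integrable[of a b] ab by simp
  have Fi': "integrable ?P (\<lambda>(x, q). F (x, q))" using Fi by (simp add: split_def)
  have m_int: "integrable lborel2 (\<lambda>(x, z). cutoff_composite x * g z * mehler a x z)"
    "integrable lborel2 (\<lambda>(x, z). cutoff_composite x * g z * mehler b x z)"
    using mehler_average_integrable ab by auto
  have Di: "integrable lborel2 (\<lambda>(x, z). ?D x z)"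
    using Bochner_Integration.integrable_diff[OF m_int(2,1)] by (simp add: split_def)
  have "(\<Sum>i\<in>UNIV. \<integral>p. time_term i {a..b} p \<partial>?P) = (\<integral>p. F p \<partial>?P)"
    unfolding F_def using time_term_integrable[of a b] ab by simp
  also have "\<dots> = (LINT x|lborel. \<integral>q. F (x, q) \<partial>lborel2)"
    by (rule P.integral_fst'[OF Fi, symmetric])
  also have "\<dots> = (LINT x|lborel. LINT z|lborel. - ?D x z)"
  proof (rule integral_cong_AE)
    have [measurable]: "F \<in> borel_measurable ?P" using Fi by auto
    show "(\<lambda>x. \<integral>q. F (x, q) \<partial>lborel2) \<in> borel_measurable lborel"
      using P.integrable_fst'[OF Fi] by auto
    show "AE x in lborel. (\<integral>q. F (x, q) \<partial>lborel2) = (LINT z|lborel. - ?D x z)"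
      using P.AE_integrable_fst'[OF Fi]
    proof eventually_elim
      case (elim x)
      then have "integrable lborel2 (\<lambda>(t, z). F (x, t, z))" by (simp add: split_def)
      from lborel_pair.integral_snd[OF this]
      have "(\<integral>q. F (x, q) \<partial>lborel2) = (LINT z|lborel. LINT t|lborel. F (x, t, z))"
        by (simp add: split_def)
      also have "\<dots> = (LINT z|lborel. - ?D x z)"
      proof (intro Bochner_Integration.integral_cong refl)
        fix z
        have "(LINT t|lborel. F (x, t, z)) = (LINT t|lborel. (cutoff_composite x * g z) * (indicator {a..b} t * (\<Sum>i\<in>UNIV. mehler_flux_deriv i t x z)))"
          by (intro Bochner_Integration.integral_cong refl)
            (simp add: F_def time_term_def cutoff_composite_def sum_distrib_left mult_ac)
        also have "\<dots> = (cutoff_composite x * g z) * (LINT t|lborel. indicator {a..b} t * (\<Sum>i\<in>UNIV. mehler_flux_deriv i t x z))"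
          by (rule integral_mult_right_zero)
        also have "\<dots> = - ?D x z" unfolding mehler_time_FTC[OF ab] by (simp add: algebra_simps)
        finally show "(LINT t|lborel. F (x, t, z)) = - ?D x z" .
      qed
      finally show ?case .
    qed
  qed measurable
  also have "\<dots> = - (LINT x|lborel. LINT z|lborel. ?D x z)"
    by (simp only: Bochner_Integration.integral_minus)
  also have "(LINT x|lborel. LINT z|lborel. ?D x z) = (\<integral>(x, z). ?D x z \<partial>lborel2)"
    using lborel_pair.integral_fst'[OF Di] by simp
  also have "\<dots> = (\<integral>(x, z). cutoff_composite x * g z * mehler b x z \<partial>lborel2) -
        (\<integral>(x, z). cutoff_composite x * g z * mehler a x z \<partial>lborel2)"
    using Bochner_Integration.integral_diff[OF m_int(2,1)] by (simp add: split_def)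
  finally show ?thesis .
qed

text \<open>Conditioning on \<open>z\<close> gives the form to which
  \<open>gaussian_average_tendsto\<close> applies.\<close>

lemma mehler_average_eq:
  assumes t: "0 < t" "t < 1"
  shows "(\<integral>(x, z). cutoff_composite x * g z * mehler t x z \<partial>lborel2) =
    (LINT z|std_gaussian. g z * (LINT y|std_gaussian. cutoff_composite (sqrt t *\<^sub>R z + sqrt (1 - t) *\<^sub>R y)))"
proof -
  have "(\<integral>(x, z). cutoff_composite x * g z * mehler t x z \<partial>lborel2) =
     (LINT z|lborel. LINT x|lborel. cutoff_composite x * g z * mehler t x z)"
    using lborel_pair.integral_snd[OF mehler_average_integrable[OF t]] by (simp add: split_def)
  also have "\<dots> = (LINT z|lborel. gauss_kernel 1 z * (g z * (LINT x|lborel. gauss_kernel (1 - t) (x - sqrt t *\<^sub>R z) * cutoff_composite x)))"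
  proof (intro Bochner_Integration.integral_cong refl)
    fix z
    have "(LINT x|lborel. cutoff_composite x * g z * mehler t x z) =
        (LINT x|lborel. (gauss_kernel 1 z * g z) * (gauss_kernel (1 - t) (x - sqrt t *\<^sub>R z) * cutoff_composite x))"
      by (intro Bochner_Integration.integral_cong refl) (simp add: mehler_def mult_ac)
    then show "(LINT x|lborel. cutoff_composite x * g z * mehler t x z) =
       gauss_kernel 1 z * (g z * (LINT x|lborel. gauss_kernel (1 - t) (x - sqrt t *\<^sub>R z) * cutoff_composite x))"
      by (simp add: mult_ac)
  qed
  also have "\<dots> = (LINT z|std_gaussian. g z * (LINT x|lborel. gauss_kernel (1 - t) (x - sqrt t *\<^sub>R z) * cutoff_composite x))"
    by (rule std_gaussian_integral(2)[symmetric]) measurable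
  also have "\<dots> = (LINT z|std_gaussian. g z * (LINT y|std_gaussian. cutoff_composite (sqrt t *\<^sub>R z + sqrt (1 - t) *\<^sub>R y)))"
    using t by (subst gauss_kernel_integral(2)) auto
  finally show ?thesis .
qed

text \<open>At time 0 the inner average is independent of \<open>z\<close>, so the mean of
  \<open>g\<close> factors out and this end vanishes; at time 1 it is the value of
  \<open>cutoff_composite\<close> at \<open>z\<close>.\<close>

lemma localized_identity:
  assumes mean: "(LINT z|std_gaussian. g z) = 0"
  shows "(\<Sum>i\<in>UNIV. \<integral>p. main_term i {0<..<1} p \<partial>lborel3) +
     (\<Sum>i\<in>UNIV. \<integral>p. cutoff_term i {0<..<1} p \<partial>lborel3) =
     (LINT z|std_gaussian. g z * cutoff_composite z)"
proof -
  let ?P = "lborel3 :: ((real ^ 'n) \<times> real \<times> (real ^ 'n)) measure"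
  let ?E = "\<lambda>t. LINT z|std_gaussian. g z * (LINT y|std_gaussian. cutoff_composite (sqrt t *\<^sub>R z + sqrt (1 - t) *\<^sub>R y))"
  \<comment> \<open>The summand 2 gives a k \<le> 1/2 \<le> b k from k = 0 on.\<close>
  define a where "a k = 1 / (real k + 2)" for k
  define b where "b k = 1 - a k" for k
  have ab: "0 < a k" "a k \<le> b k" "b k < 1" for k
    by (auto simp: a_def b_def field_simps)
  have S: "{a k..b k} \<subseteq> {0<..<1}" for k using ab[of k] by auto
  have a_lim: "a \<longlonglongrightarrow> 0"
    using LIMSEQ_ignore_initial_segment[OF lim_1_over_n[where 'a=real], of 2] by (simp add: a_def[abs_def] add.commute)
  have b_lim: "b \<longlonglongrightarrow> 1" unfolding b_def[abs_def] using tendsto_diff[OF tendsto_const[of 1] a_lim] by simp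
  have ind: "(\<lambda>k. indicator {a k..b k} t :: real) \<longlonglongrightarrow> indicator {0<..<1} t" for t :: real
  proof (cases "t \<in> {0<..<1}")
    case True
    then have "eventually (\<lambda>k. a k < t) sequentially" "eventually (\<lambda>k. t < b k) sequentially"
      using order_tendstoD(2)[OF a_lim, of t] order_tendstoD(1)[OF b_lim, of t] by auto
    then have "eventually (\<lambda>k. (indicator {a k..b k} t :: real) = indicator {0<..<1} t) sequentially"
      by eventually_elim (use True in auto)
    then show ?thesis by (rule tendsto_eventually)
  next
    case False
    then have "(indicator {a k..b k} t :: real) = indicator {0<..<1} t" for k using S[of k] by (auto simp: indicator_def)
    then show ?thesis by simp
  qed
  have lim_main: "(\<lambda>k. \<integral>p. main_term i {a k..b k} p \<partial>?P) \<longlonglongrightarrow> (\<integral>p. main_term i {0<..<1} p \<partial>?P)" for i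
  proof (rule integral_dominated_convergence[where w="\<lambda>p. \<bar>main_term i {0<..<1} p\<bar>"])
    show "integrable ?P (\<lambda>p. \<bar>main_term i {0<..<1} p\<bar>)" by (rule integrable_abs[OF main_term_integrable])
    show "AE p in ?P. (\<lambda>k. main_term i {a k..b k} p) \<longlonglongrightarrow> main_term i {0<..<1} p"
      unfolding main_term_def split_def by (intro AE_I2 tendsto_intros ind)
    show "AE p in ?P. norm (main_term i {a k..b k} p) \<le> \<bar>main_term i {0<..<1} p\<bar>" for k
      using S[of k] by (auto intro!: AE_I2 simp: main_term_def indicator_def)
  qed measurable
  have lim_cutoff: "(\<lambda>k. \<integral>p. cutoff_term i {a k..b k} p \<partial>?P) \<longlonglongrightarrow> (\<integral>p. cutoff_term i {0<..<1} p \<partial>?P)" for i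
  proof (rule integral_dominated_convergence[where w="\<lambda>p. \<bar>cutoff_term i {0<..<1} p\<bar>"])
    show "integrable ?P (\<lambda>p. \<bar>cutoff_term i {0<..<1} p\<bar>)" by (rule integrable_abs[OF cutoff_term_integrable])
    show "AE p in ?P. (\<lambda>k. cutoff_term i {a k..b k} p) \<longlonglongrightarrow> cutoff_term i {0<..<1} p"
      unfolding cutoff_term_def split_def by (intro AE_I2 tendsto_intros ind)
    show "AE p in ?P. norm (cutoff_term i {a k..b k} p) \<le> \<bar>cutoff_term i {0<..<1} p\<bar>" for k
      using S[of k] by (auto intro!: AE_I2 simp: cutoff_term_def indicator_def)
  qed measurable
  have eq: "(\<Sum>i\<in>UNIV. \<integral>p. main_term i {a k..b k} p \<partial>?P) + (\<Sum>i\<in>UNIV. \<integral>p. cutoff_term i {a k..b k} p \<partial>?P) = ?E (b k) - ?E (a k)" for k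
  proof -
    have "(\<integral>p. main_term i {a k..b k} p \<partial>?P) + (\<integral>p. cutoff_term i {a k..b k} p \<partial>?P) = - (\<integral>p. time_term i {a k..b k} p \<partial>?P)" for i
      using terms_sum_zero[OF ab(1,3), of i k k] terms_subset_integrable[OF _ S[of k], of i] time_term_integrable[OF ab(1,3), of i k k]
      by simp
    then have "(\<Sum>i\<in>UNIV. \<integral>p. main_term i {a k..b k} p \<partial>?P) + (\<Sum>i\<in>UNIV. \<integral>p. cutoff_term i {a k..b k} p \<partial>?P)
       = - (\<Sum>i\<in>UNIV. \<integral>p. time_term i {a k..b k} p \<partial>?P)"
      by (simp add: sum.distrib[symmetric] sum_negf[symmetric])
    also have "\<dots> = ?E (b k) - ?E (a k)"
      unfolding time_term_sum[OF ab[of k]]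
      using mehler_average_eq[of "a k"] mehler_average_eq[of "b k"] ab[of k] by simp
    finally show ?thesis .
  qed
  have lim: "(\<lambda>k. ?E (b k) - ?E (a k)) \<longlonglongrightarrow> ?E 1 - ?E 0"
    by (intro tendsto_diff gaussian_average_tendsto[OF cutoff_composite_cont cutoff_composite_bound] a_lim b_lim)
  have E1: "?E 1 = (LINT z|std_gaussian. g z * cutoff_composite z)"
    using std_gaussian.prob_space[where 'n='n] by simp
  have E0: "?E 0 = 0" by (simp add: mean)
  have "(\<lambda>k. ?E (b k) - ?E (a k)) \<longlonglongrightarrow> (LINT z|std_gaussian. g z * cutoff_composite z)"
  proof -
    have "?E 1 - ?E 0 = (LINT z|std_gaussian. g z * cutoff_composite z)" unfolding E1 E0 by (rule diff_zero)
    with lim show ?thesis by (rule back_subst)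
  qed
  moreover have "(\<lambda>k. ?E (b k) - ?E (a k)) \<longlonglongrightarrow> (\<Sum>i\<in>UNIV. \<integral>p. main_term i {0<..<1} p \<partial>?P) + (\<Sum>i\<in>UNIV. \<integral>p. cutoff_term i {0<..<1} p \<partial>?P)"
    unfolding eq[symmetric] by (intro tendsto_intros lim_main lim_cutoff)
  ultimately show ?thesis by (rule LIMSEQ_unique[rotated])
qed

lemma main_term_sum:
  "integrable lborel (\<lambda>x. \<psi> (g x) * cutoff R x * Gamma_density x)"
  "(\<Sum>i\<in>UNIV. \<integral>p. main_term i {0<..<1} p \<partial>lborel3) =
     (LINT x|lborel. \<psi> (g x) * cutoff R x * Gamma_density x)"
proof -
  let ?J = "\<lambda>i x. \<integral>(t, z). indicator {0<..<1} t * mehler_flux i t x z * g z \<partial>lborel2"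
  let ?c = "\<lambda>i x. \<psi> (g x) * partial_deriv g i x * cutoff R x"
  have inner: "(\<integral>q. main_term i {0<..<1} (x, q) \<partial>lborel2) = ?c i x * ?J i x" for i x
  proof -
    have "(\<lambda>q. main_term i {0<..<1} (x, q)) = (\<lambda>q. ?c i x * (case q of (t, z) \<Rightarrow> indicator {0<..<1} t * mehler_flux i t x z * g z))"
      by (auto simp: main_term_def)
    then show ?thesis by (simp only: integral_mult_right_zero)
  qed
  have G: "\<psi> (g x) * cutoff R x * Gamma_density x = (\<Sum>i\<in>UNIV. ?c i x * ?J i x)" for x
    by (simp add: Gamma_density_def sum_distrib_left mult_ac)
  have i: "integrable lborel (\<lambda>x. ?c i x * ?J i x)" for i
    using P.integrable_fst'[OF main_term_integrable, of i] unfolding inner .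
  show "integrable lborel (\<lambda>x. \<psi> (g x) * cutoff R x * Gamma_density x)"
    unfolding G by (intro Bochner_Integration.integrable_sum i)
  have "(\<integral>p. main_term i {0<..<1} p \<partial>lborel3) = (LINT x|lborel. ?c i x * ?J i x)" for i
    using P.integral_fst'[OF main_term_integrable, of i] unfolding inner by simp
  then show "(\<Sum>i\<in>UNIV. \<integral>p. main_term i {0<..<1} p \<partial>lborel3) =
     (LINT x|lborel. \<psi> (g x) * cutoff R x * Gamma_density x)"
    unfolding G using i by (simp only: Bochner_Integration.integral_sum)
qed

text \<open>The integral on the right does not involve \<open>R\<close>, so the bound decays like
  1/R.\<close>

lemma cutoff_term_sum_bound:
  "\<bar>\<Sum>i\<in>UNIV. \<integral>p. cutoff_term i {0<..<1} p \<partial>lborel3\<bar>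
    \<le> 4 / R * B * (\<Sum>i\<in>UNIV. \<integral>p. \<bar>case p of (x, t, z) \<Rightarrow> indicator {0<..<1} t * mehler_flux i t x z * g z\<bar> \<partial>lborel3)"
proof -
  let ?P = "lborel3 :: ((real ^ 'n) \<times> real \<times> (real ^ 'n)) measure"
  let ?J = "\<lambda>i p. case p of (x, t, z) \<Rightarrow> indicator {0<..<1} t * mehler_flux i t x z * g z"
  have "\<bar>\<integral>p. cutoff_term i {0<..<1} p \<partial>?P\<bar> \<le> 4 / R * B * (\<integral>p. \<bar>?J i p\<bar> \<partial>?P)" for i
  proof -
    have "\<bar>\<integral>p. cutoff_term i {0<..<1} p \<partial>?P\<bar> \<le> (\<integral>p. \<bar>cutoff_term i {0<..<1} p\<bar> \<partial>?P)"
      by (rule integral_abs_bound)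
    also have "\<dots> \<le> (\<integral>p. 4 / R * B * \<bar>?J i p\<bar> \<partial>?P)"
    proof (rule integral_mono)
      show "integrable ?P (\<lambda>p. \<bar>cutoff_term i {0<..<1} p\<bar>)" by (rule integrable_abs[OF cutoff_term_integrable])
      show "integrable ?P (\<lambda>p. 4 / R * B * \<bar>?J i p\<bar>)"
        by (intro integrable_mult_right integrable_abs flux_globally_integrable)
      show "\<bar>cutoff_term i {0<..<1} p\<bar> \<le> 4 / R * B * \<bar>?J i p\<bar>" for p
        using cutoff_term_bound[of i "{0<..<1}"] by (cases p) auto
    qed
    finally show ?thesis by simp
  qed
  then have "(\<Sum>i\<in>UNIV. \<bar>\<integral>p. cutoff_term i {0<..<1} p \<partial>?P\<bar>) \<le> (\<Sum>i\<in>UNIV. 4 / R * B * (\<integral>p. \<bar>?J i p\<bar> \<partial>?P))"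
    by (rule sum_mono)
  then show ?thesis unfolding sum_distrib_left[symmetric] by (rule order_trans[OF sum_abs])
qed

end

end

section \<open>Removal of the cutoff\<close>

context gaussian_sobolev
begin

text \<open>As the radius tends to infinity, \<open>cutoff_term_sum_bound\<close> disposes of the
  error; the limits on the two sides are dominated by a multiple of |g| and by |T|.\<close>

lemma stein_identity:
  fixes X :: "'a \<Rightarrow> real ^ 'n" and \<phi> \<psi> :: "real \<Rightarrow> real"
  assumes prob: "prob_space M" and X: "std_gaussian_vector M X"
    and mean: "(LINT z|std_gaussian. g z) = 0"
    and T_ex: "AE \<omega> in M. T_exists M X g (X \<omega>)"
    and T_int: "integrable M (\<lambda>\<omega>. T_fun M X g (X \<omega>))"
    and \<phi>: "\<And>w. (\<phi> has_real_derivative \<psi> w) (at w)" and \<psi>: "\<And>w. \<bar>\<psi> w\<bar> \<le> 1"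
    and \<psi>m[measurable]: "\<psi> \<in> borel_measurable borel" and \<phi>b: "\<And>w. \<bar>\<phi> w\<bar> \<le> B"
  shows "(LINT \<omega>|M. \<phi> (g (X \<omega>)) * g (X \<omega>)) = (LINT \<omega>|M. \<psi> (g (X \<omega>)) * T_fun M X g (X \<omega>))"
proof -
  interpret prob_space M by fact
  note law = std_gaussian_vector_law[OF prob X]
  have Xm[measurable]: "X \<in> borel_measurable M" by (rule law(1))
  have [measurable]: "(\<lambda>\<omega>. T_fun M X g (X \<omega>)) \<in> borel_measurable M" using T_int by auto
  have \<phi>_m[measurable]: "\<phi> \<in> borel_measurable borel" by (rule \<phi>_measurable[OF \<phi> \<psi> \<psi>m \<phi>b zero_less_one])
  define K where "K = (\<lambda>k::nat. real (Suc k))"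
  have K0: "K k > 0" for k by (simp add: K_def)
  define err where "err k = (\<Sum>i\<in>UNIV. \<integral>p. cutoff_term \<phi> (K k) i {0<..<1} p \<partial>lborel3)" for k
  have id: "(LINT x|lborel. \<psi> (g x) * cutoff (K k) x * Gamma_density x) + err k =
     (LINT z|std_gaussian. g z * (\<phi> (g z) * cutoff (K k) z))" for k
    using localized_identity[OF \<phi> \<psi> \<psi>m \<phi>b K0 mean, of k] main_term_sum(2)[OF \<phi> \<psi> \<psi>m \<phi>b K0, of k]
    unfolding err_def cutoff_composite_def[OF \<phi> \<psi> \<psi>m \<phi>b K0] by simp
  have err: "err \<longlonglongrightarrow> 0"
  proof (rule Lim_null_comparison)
    let ?C = "B * (\<Sum>i\<in>UNIV. \<integral>p. \<bar>case p of (x, t, z) \<Rightarrow> indicator {0<..<1} t * mehler_flux i t x z * g z\<bar> \<partial>lborel3)"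
    show "\<forall>\<^sub>F k in sequentially. norm (err k) \<le> 4 * ?C * inverse (real (Suc k))"
      using cutoff_term_sum_bound[OF \<phi> \<psi> \<psi>m \<phi>b K0] unfolding err_def
      by (intro always_eventually allI) (simp add: K_def divide_inverse mult_ac)
    show "(\<lambda>k. 4 * ?C * inverse (real (Suc k))) \<longlonglongrightarrow> 0"
      using tendsto_mult_left[OF LIMSEQ_inverse_real_of_nat, of "4 * ?C"] by simp
  qed
  \<comment> \<open>Dividing by the Gaussian density, which is positive everywhere, turns
    \<open>Gamma_density\<close> into T at almost every sample.\<close>
  have T_eq: "(LINT x|lborel. \<psi> (g x) * cutoff (K k) x * Gamma_density x) =
     (LINT \<omega>|M. cutoff (K k) (X \<omega>) * (\<psi> (g (X \<omega>)) * T_fun M X g (X \<omega>)))" for k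
  proof -
    have "(LINT x|lborel. \<psi> (g x) * cutoff (K k) x * Gamma_density x) =
       (LINT x|lborel. gauss_kernel 1 x * (\<psi> (g x) * cutoff (K k) x * (Gamma_density x / gauss_kernel 1 x)))"
    proof (intro Bochner_Integration.integral_cong refl)
      fix x :: "real ^ 'n"
      have "gauss_kernel 1 x > 0" by (simp add: gauss_kernel_pos)
      then show "\<psi> (g x) * cutoff (K k) x * Gamma_density x =
         gauss_kernel 1 x * (\<psi> (g x) * cutoff (K k) x * (Gamma_density x / gauss_kernel 1 x))" by simp
    qed
    also have "\<dots> = (LINT x|std_gaussian. \<psi> (g x) * cutoff (K k) x * (Gamma_density x / gauss_kernel 1 x))"
      by (rule std_gaussian_integral(2)[symmetric]) measurable
    also have "\<dots> = (LINT \<omega>|M. \<psi> (g (X \<omega>)) * cutoff (K k) (X \<omega>) * (Gamma_density (X \<omega>) / gauss_kernel 1 (X \<omega>)))"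
      unfolding law(2)[symmetric] by (rule integral_distr) measurable
    also have "\<dots> = (LINT \<omega>|M. cutoff (K k) (X \<omega>) * (\<psi> (g (X \<omega>)) * T_fun M X g (X \<omega>)))"
    proof (rule integral_cong_AE)
      show "AE \<omega> in M. \<psi> (g (X \<omega>)) * cutoff (K k) (X \<omega>) * (Gamma_density (X \<omega>) / gauss_kernel 1 (X \<omega>)) =
         cutoff (K k) (X \<omega>) * (\<psi> (g (X \<omega>)) * T_fun M X g (X \<omega>))"
        using T_ex
      proof eventually_elim
        case (elim \<omega>)
        have "gauss_kernel 1 (X \<omega>) > 0" by (simp add: gauss_kernel_pos)
        then show ?case using T_fun_eq[OF prob X elim] by (simp add: field_simps)
      qed
    qed measurable
    finally show ?thesis .
  qed
  have lim1: "(\<lambda>k. LINT \<omega>|M. cutoff (K k) (X \<omega>) * (\<psi> (g (X \<omega>)) * T_fun M X g (X \<omega>))) \<longlonglongrightarrow>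
      (LINT \<omega>|M. \<psi> (g (X \<omega>)) * T_fun M X g (X \<omega>))"
  proof (rule integral_dominated_convergence[where w="\<lambda>\<omega>. \<bar>T_fun M X g (X \<omega>)\<bar>"])
    show "AE \<omega> in M. (\<lambda>k. cutoff (K k) (X \<omega>) * (\<psi> (g (X \<omega>)) * T_fun M X g (X \<omega>))) \<longlonglongrightarrow> \<psi> (g (X \<omega>)) * T_fun M X g (X \<omega>)"
    proof (rule AE_I2)
      fix \<omega>
      show "(\<lambda>k. cutoff (K k) (X \<omega>) * (\<psi> (g (X \<omega>)) * T_fun M X g (X \<omega>))) \<longlonglongrightarrow> \<psi> (g (X \<omega>)) * T_fun M X g (X \<omega>)"
        using tendsto_mult_right[OF cutoff_tendsto_1[of "X \<omega>"], of "\<psi> (g (X \<omega>)) * T_fun M X g (X \<omega>)"]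
        unfolding K_def mult_1_left .
    qed
    have "\<bar>cutoff (K k) (X \<omega>) * (\<psi> (g (X \<omega>)) * T_fun M X g (X \<omega>))\<bar> \<le> 1 * (1 * \<bar>T_fun M X g (X \<omega>)\<bar>)" for k \<omega>
      unfolding abs_mult using \<psi> by (intro mult_mono) (auto simp: cutoff_bounds)
    then show "AE \<omega> in M. norm (cutoff (K k) (X \<omega>) * (\<psi> (g (X \<omega>)) * T_fun M X g (X \<omega>))) \<le> \<bar>T_fun M X g (X \<omega>)\<bar>" for k
      by simp
  qed (use T_int in \<open>auto intro: integrable_abs\<close>)
  have gi: "integrable std_gaussian g"
    by (rule std_gaussian.square_integrable_imp_integrable[OF _ g_L2]) simp
  have lim2: "(\<lambda>k. LINT z|std_gaussian. g z * (\<phi> (g z) * cutoff (K k) z)) \<longlonglongrightarrow> (LINT z|std_gaussian. \<phi> (g z) * g z)"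
  proof (rule integral_dominated_convergence[where w="\<lambda>z. B * \<bar>g z\<bar>"])
    show "AE z in std_gaussian. (\<lambda>k. g z * (\<phi> (g z) * cutoff (K k) z)) \<longlonglongrightarrow> \<phi> (g z) * g z"
    proof (rule AE_I2)
      fix z
      have "(\<lambda>k. (\<phi> (g z) * g z) * cutoff (K k) z) \<longlonglongrightarrow> (\<phi> (g z) * g z) * 1"
        unfolding K_def by (rule tendsto_mult_left[OF cutoff_tendsto_1])
      then show "(\<lambda>k. g z * (\<phi> (g z) * cutoff (K k) z)) \<longlonglongrightarrow> \<phi> (g z) * g z" by (simp add: mult_ac)
    qed
    have B0: "B \<ge> 0" using \<phi>b[of 0] by linarith
    have "\<bar>g z * (\<phi> (g z) * cutoff (K k) z)\<bar> \<le> \<bar>g z\<bar> * (B * 1)" for z k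
      unfolding abs_mult using \<phi>b B0 by (intro mult_mono) (auto simp: cutoff_bounds)
    then show "AE z in std_gaussian. norm (g z * (\<phi> (g z) * cutoff (K k) z)) \<le> B * \<bar>g z\<bar>" for k
      by (simp add: mult.commute)
  qed (use gi in auto)
  have "(\<lambda>k. LINT z|std_gaussian. g z * (\<phi> (g z) * cutoff (K k) z)) \<longlonglongrightarrow> (LINT \<omega>|M. \<psi> (g (X \<omega>)) * T_fun M X g (X \<omega>)) + 0"
    unfolding id[symmetric] T_eq by (intro tendsto_add lim1 err)
  with lim2 have "(LINT z|std_gaussian. \<phi> (g z) * g z) = (LINT \<omega>|M. \<psi> (g (X \<omega>)) * T_fun M X g (X \<omega>)) + 0"
    by (rule LIMSEQ_unique)
  moreover have "(LINT z|std_gaussian. \<phi> (g z) * g z) = (LINT \<omega>|M. \<phi> (g (X \<omega>)) * g (X \<omega>))"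
    unfolding law(2)[symmetric] by (rule integral_distr) measurable
  ultimately show ?thesis by simp
qed

end

section \<open>From the Stein identity to the conditional expectation\<close>

text \<open>The antiderivative is constant on either side of [a, b] and 1-Lipschitz in
  between.\<close>

lemma bounded_antiderivative:
  fixes \<psi> :: "real \<Rightarrow> real"
  assumes cont: "continuous_on UNIV \<psi>" and ab: "a \<le> b"
    and zero: "\<And>w. w \<notin> {a..b} \<Longrightarrow> \<psi> w = 0" and bd: "\<And>w. \<bar>\<psi> w\<bar> \<le> 1"
  obtains \<phi> B where "\<And>w. (\<phi> has_real_derivative \<psi> w) (at w)" "\<And>w. \<bar>\<phi> w\<bar> \<le> B"
proof -
  have "\<exists>F. \<forall>x. -\<infinity> < ereal x \<longrightarrow> ereal x < \<infinity> \<longrightarrow> (F has_vector_derivative \<psi> x) (at x)"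
    by (rule einterval_antiderivative) (use cont in \<open>auto simp: continuous_on_eq_continuous_at\<close>)
  then obtain \<phi> where \<phi>: "\<And>w. (\<phi> has_real_derivative \<psi> w) (at w)"
    by (auto simp: has_real_derivative_iff_has_vector_derivative)
  have der: "(\<phi> has_real_derivative \<psi> w) (at w within S)" for w S
    using \<phi> by (rule has_field_derivative_at_within)
  have mid: "\<bar>\<phi> u - \<phi> v\<bar> \<le> 1 * \<bar>u - v\<bar>" for u v
    using field_differentiable_bound[of UNIV \<phi> \<psi> 1 u v] der bd by simp
  have const: "\<phi> u = \<phi> v" if "u \<le> v" "\<And>z. z \<in> {u..v} \<Longrightarrow> \<psi> z = 0" for u v
  proof -
    have "norm (\<phi> u - \<phi> v) \<le> 0 * norm (u - v)"
      by (rule field_differentiable_bound[of "{u..v}" \<phi> \<psi>, OF _ der]) (use that in auto)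
    then show ?thesis by simp
  qed
  have "\<bar>\<phi> w\<bar> \<le> \<bar>\<phi> a\<bar> + \<bar>\<phi> b\<bar> + (b - a)" for w
  proof -
    consider "w < a" | "a \<le> w" "w \<le> b" | "b < w" by linarith
    then show ?thesis
    proof cases
      case 1
      \<comment> \<open>\<open>zero\<close> concerns points off the closed interval; continuity
        extends it to the endpoint.\<close>
      have "\<psi> a = 0"
      proof (rule tendsto_unique)
        show "(\<psi> \<longlongrightarrow> \<psi> a) (at_left a)" using cont by (simp add: continuous_on_eq_continuous_at isCont_def filterlim_at_split)
        show "(\<psi> \<longlongrightarrow> 0) (at_left a)"
          by (rule tendsto_eventually) (auto simp: eventually_at_filter zero)
      qed simp
      then have "\<psi> v = 0" if "v \<in> {w..a}" for v using that zero[of v] by (cases "v = a") auto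
      then have "\<phi> w = \<phi> a" using 1 by (intro const) auto
      then show ?thesis using ab by simp
    next
      case 2
      then show ?thesis using mid[of w a] by simp
    next
      case 3
      have "\<psi> b = 0"
      proof (rule tendsto_unique)
        show "(\<psi> \<longlongrightarrow> \<psi> b) (at_right b)" using cont by (simp add: continuous_on_eq_continuous_at isCont_def filterlim_at_split)
        show "(\<psi> \<longlongrightarrow> 0) (at_right b)"
          by (rule tendsto_eventually) (auto simp: eventually_at_filter zero)
      qed simp
      then have "\<psi> v = 0" if "v \<in> {b..w}" for v using that zero[of v] by (cases "v = b") auto
      then have "\<phi> b = \<phi> w" using 3 by (intro const) auto
      then show ?thesis using ab by simp
    qed
  qed
  with \<phi> show thesis by (rule that)
qed

text \<open>Dynkin's argument with the open intervals as intersection-stable generator. Complements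
  require the total integral, which is a limit over growing intervals.\<close>

lemma set_integral_vimage_zero:
  fixes D W :: "'a \<Rightarrow> real"
  assumes W[measurable]: "W \<in> borel_measurable M" and D: "integrable M D"
    and interval: "\<And>a b. a < b \<Longrightarrow> (LINT \<omega>|M. indicator {a<..<b} (W \<omega>) * D \<omega>) = 0"
    and A: "A \<in> sets borel"
  shows "(LINT \<omega>:(W -` A \<inter> space M)|M. D \<omega>) = 0"
proof -
  have [measurable]: "D \<in> borel_measurable M" using D by auto
  have si: "set_integrable M S D" if "S \<in> sets M" for S
    using D that unfolding set_integrable_def by (rule integrable_mult_indicator[rotated])
  have set_eq: "(LINT \<omega>:(W -` A \<inter> space M)|M. D \<omega>) = (LINT \<omega>|M. indicator A (W \<omega>) * D \<omega>)" for A
    unfolding set_lebesgue_integral_def by (intro Bochner_Integration.integral_cong) (auto simp: indicator_def)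
  have total: "(LINT \<omega>|M. D \<omega>) = 0"
  proof (rule LIMSEQ_unique)
    show "(\<lambda>k. LINT \<omega>|M. indicator {- real (Suc k)<..<real (Suc k)} (W \<omega>) * D \<omega>) \<longlonglongrightarrow> (LINT \<omega>|M. D \<omega>)"
    proof (rule integral_dominated_convergence[where w="\<lambda>\<omega>. \<bar>D \<omega>\<bar>"])
      show "AE \<omega> in M. (\<lambda>k. indicator {- real (Suc k)<..<real (Suc k)} (W \<omega>) * D \<omega>) \<longlonglongrightarrow> D \<omega>"
      proof (rule AE_I2, rule tendsto_eventually)
        fix \<omega>
        obtain n where n: "\<bar>W \<omega>\<bar> < real n" using reals_Archimedean2 by blast
        show "\<forall>\<^sub>F k in sequentially. indicator {- real (Suc k)<..<real (Suc k)} (W \<omega>) * D \<omega> = D \<omega>"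
          using eventually_ge_at_top[of n] by eventually_elim (use n in \<open>auto simp: indicator_def\<close>)
      qed
    qed (use D in \<open>auto simp: indicator_def\<close>)
    show "(\<lambda>k. LINT \<omega>|M. indicator {- real (Suc k)<..<real (Suc k)} (W \<omega>) * D \<omega>) \<longlonglongrightarrow> 0"
      by (subst interval) auto
  qed
  have borel_eq: "sets (borel :: real measure) = sigma_sets UNIV (range (\<lambda>(a, b). {a<..<b}))"
    by (subst borel_eq_box) (simp add: sets_measure_of box_real[abs_def])
  have Int: "Int_stable (range (\<lambda>(a, b). {a<..<b :: real}))"
  proof (rule Int_stableI)
    fix S T assume "S \<in> range (\<lambda>(a, b). {a<..<b :: real})" "T \<in> range (\<lambda>(a, b). {a<..<b :: real})"
    then obtain a b c d where "S = {a<..<b}" "T = {c<..<d}" by auto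
    \<comment> \<open>If the two intervals are disjoint, the endpoints are in the wrong order and
      the interval on the right is empty too.\<close>
    then have "S \<inter> T = (\<lambda>(a, b). {a<..<b}) (max a c, min b d)" by auto
    then show "S \<inter> T \<in> range (\<lambda>(a, b). {a<..<b})" by blast
  qed
  have A': "A \<in> sigma_sets UNIV (range (\<lambda>(a, b). {a<..<b :: real}))" using A borel_eq by simp
  have Pow: "range (\<lambda>(a, b). {a<..<b :: real}) \<subseteq> Pow UNIV" by simp
  from Int Pow A' show ?thesis
  proof (induction rule: sigma_sets_induct_disjoint)
    case (basic A)
    then obtain a b where ab: "A = {a<..<b}" by auto
    show ?case
    proof (cases "a < b")
      case True then show ?thesis unfolding set_eq ab by (rule interval)
    qed (simp add: ab set_lebesgue_integral_def)
  next
    case empty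
    show ?case by (simp add: set_lebesgue_integral_def)
  next
    case (compl A)
    then have [measurable]: "A \<in> sets borel" using borel_eq by simp
    have i: "integrable M (\<lambda>\<omega>. indicator A (W \<omega>) * D \<omega>)"
      by (rule Bochner_Integration.integrable_bound[OF D]) (auto simp: indicator_def)
    have "(LINT \<omega>|M. indicator (UNIV - A) (W \<omega>) * D \<omega>) = (LINT \<omega>|M. D \<omega> - indicator A (W \<omega>) * D \<omega>)"
      by (intro Bochner_Integration.integral_cong) (auto simp: indicator_def)
    also have "\<dots> = 0" using compl total D i unfolding set_eq by simp
    finally show ?case unfolding set_eq .
  next
    case (union A)
    have Ab: "A i \<in> sets borel" for i using union borel_eq by auto
    have S: "W -` A i \<inter> space M \<in> sets M" for i using Ab[of i] by measurable
    have "(LINT \<omega>:(\<Union>i. W -` A i \<inter> space M)|M. D \<omega>) = (\<Sum>i. (LINT \<omega>:(W -` A i \<inter> space M)|M. D \<omega>))"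
    proof (rule lebesgue_integral_countable_add)
      show "(W -` A i \<inter> space M) \<inter> (W -` A j \<inter> space M) = {}" if "i \<noteq> j" for i j
        using union(1) that unfolding disjoint_family_on_def by blast
      show "set_integrable M (\<Union>i. W -` A i \<inter> space M) D" using S by (intro si sets.countable_UN') auto
    qed (rule S)
    also have "\<dots> = 0" using union by simp
    also have "(\<Union>i. W -` A i \<inter> space M) = W -` (\<Union>i. A i) \<inter> space M" by auto
    finally show ?case .
  qed
qed

text \<open>Conditioning on W means conditioning on the sigma-algebra it generates, and equality
  holds almost surely. The two assumptions on T spell out what the formula presupposes: its
  integrals exist at almost every sample of X, and the result is integrable, so that it has a
  conditional expectation.\<close>

theorem lemma1p1:
  fixes M :: "'a measure"
    and X :: "'a \<Rightarrow> real ^ 'n::finite"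
    and g :: "real ^ 'n \<Rightarrow> real"
    and W :: "'a \<Rightarrow> real"
    and h :: "real \<Rightarrow> real"
  assumes prob: "prob_space M"
    and gaussian: "std_gaussian_vector M X"
    and ac: "absolutely_continuous_fun g"
    and W: "W = (\<lambda>\<omega>. g (X \<omega>))"
    and mean: "(LINT \<omega>|M. W \<omega>) = 0"
    and var: "(LINT \<omega>|M. (W \<omega>)\<^sup>2) = 1"
    and T_ex: "AE \<omega> in M. T_exists M X g (X \<omega>)"
    and T_int: "integrable M (\<lambda>\<omega>. T_fun M X g (X \<omega>))"
    and h_meas: "h \<in> borel_measurable borel"
    and h: "\<And>\<phi> :: real \<Rightarrow> real. (\<exists>L. L-lipschitz_on UNIV \<phi>) \<Longrightarrow>
              (LINT \<omega>|M. \<phi> (W \<omega>) * W \<omega>) = (LINT \<omega>|M. deriv \<phi> (W \<omega>) * h (W \<omega>))"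
  shows "AE \<omega> in M. h (W \<omega>) =
           real_cond_exp M (vimage_algebra (space M) W borel) (\<lambda>\<omega>. T_fun M X g (X \<omega>)) \<omega>"
proof -
  interpret prob_space M by fact
  note law = std_gaussian_vector_law[OF prob gaussian]
  have Xm[measurable]: "X \<in> borel_measurable M" by (rule law(1))
  have g_cont: "continuous_on UNIV g" using ac by (simp add: absolutely_continuous_fun_def)
  have gm[measurable]: "g \<in> borel_measurable borel" using g_cont by (rule borel_measurable_continuous_onI)
  have Wm[measurable]: "W \<in> borel_measurable M" unfolding W by measurable
  have [measurable]: "h \<in> borel_measurable borel" by (rule h_meas)
  \<comment> \<open>A non-integrable square would have integral 0 by convention, not 1.\<close>
  have W2: "integrable M (\<lambda>\<omega>. (W \<omega>)\<^sup>2)"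
    using var not_integrable_integral_eq by fastforce
  interpret gaussian_sobolev g
  proof
    show "integrable std_gaussian (\<lambda>z. (g z)\<^sup>2)"
      unfolding law(2)[symmetric] using W2 by (subst integrable_distr_eq) (auto simp: W)
  qed (fact g_cont ac)+
  have g_mean: "(LINT z|std_gaussian. g z) = 0"
    unfolding law(2)[symmetric] using mean by (subst integral_distr) (auto simp: W)
  define D where "D \<omega> = h (W \<omega>) - T_fun M X g (X \<omega>)" for \<omega>
  \<comment> \<open>With the identity as test function the hypothesis gives
    \<open>h (W \<omega>)\<close> the integral 1, which excludes the default value 0.\<close>
  have h_int: "integrable M (\<lambda>\<omega>. h (W \<omega>))"
  proof -
    have "1-lipschitz_on UNIV (\<lambda>w::real. w)" by (rule lipschitz_onI) auto
    then have "(LINT \<omega>|M. W \<omega> * W \<omega>) = (LINT \<omega>|M. deriv (\<lambda>w. w) (W \<omega>) * h (W \<omega>))" by (intro h) blast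
    then have "(LINT \<omega>|M. h (W \<omega>)) = 1" using var by (simp add: power2_eq_square)
    then show ?thesis using not_integrable_integral_eq by fastforce
  qed
  have D_int: "integrable M D" unfolding D_def using h_int T_int by (rule Bochner_Integration.integrable_diff)
  have D_interval: "(LINT \<omega>|M. indicator {a<..<b} (W \<omega>) * D \<omega>) = 0" if "a < b" for a b
  proof -
    \<comment> \<open>Trapezoids of slope \<open>k\<close> below the indicator. Being continuous
      they have C1 antiderivatives, whose \<open>deriv\<close> is \<open>\<psi> k\<close>
      everywhere, and at each point they equal the indicator from some \<open>k\<close> on.\<close>
    define \<psi> where "\<psi> k w = max 0 (min 1 (real k * min (w - a) (b - w)))" for k w
    have \<psi>_cont: "continuous_on UNIV (\<psi> k)" for k unfolding \<psi>_def[abs_def] by (intro continuous_intros)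
    have [measurable]: "\<psi> k \<in> borel_measurable borel" for k using \<psi>_cont by (rule borel_measurable_continuous_onI)
    have \<psi>_bd: "\<bar>\<psi> k w\<bar> \<le> 1" for k w by (auto simp: \<psi>_def)
    have \<psi>_zero: "\<psi> k w = 0" if "w \<notin> {a<..<b}" for k w
    proof -
      have "min (w - a) (b - w) \<le> 0" using that by auto
      then have "real k * min (w - a) (b - w) \<le> 0" by (simp add: mult_nonneg_nonpos)
      then show ?thesis by (simp add: \<psi>_def)
    qed
    have zero: "(LINT \<omega>|M. \<psi> k (W \<omega>) * D \<omega>) = 0" for k
    proof -
      obtain \<phi> B where \<phi>: "\<And>w. (\<phi> has_real_derivative \<psi> k w) (at w)" "\<And>w. \<bar>\<phi> w\<bar> \<le> B"
        by (rule bounded_antiderivative[OF \<psi>_cont[of k] less_imp_le[OF \<open>a < b\<close>] _ \<psi>_bd])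
          (use \<psi>_zero[of _ k] in auto)
      have "1-lipschitz_on UNIV \<phi>"
      proof (rule lipschitz_onI)
        fix u v
        have "norm (\<phi> u - \<phi> v) \<le> 1 * norm (u - v)"
          by (rule field_differentiable_bound[of UNIV \<phi> "\<psi> k"]) (use \<phi>(1) \<psi>_bd in auto)
        then show "dist (\<phi> u) (\<phi> v) \<le> 1 * dist u v" by (simp add: dist_real_def)
      qed simp
      then have "(LINT \<omega>|M. \<phi> (W \<omega>) * W \<omega>) = (LINT \<omega>|M. deriv \<phi> (W \<omega>) * h (W \<omega>))" by (intro h) blast
      also have "deriv \<phi> = \<psi> k" using \<phi>(1) by (auto simp: fun_eq_iff DERIV_imp_deriv)
      finally have 1: "(LINT \<omega>|M. \<phi> (W \<omega>) * W \<omega>) = (LINT \<omega>|M. \<psi> k (W \<omega>) * h (W \<omega>))" .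
      have 2: "(LINT \<omega>|M. \<phi> (W \<omega>) * W \<omega>) = (LINT \<omega>|M. \<psi> k (W \<omega>) * T_fun M X g (X \<omega>))"
        unfolding W by (rule stein_identity[OF prob gaussian g_mean T_ex T_int \<phi>(1) \<psi>_bd _ \<phi>(2)]) measurable
      have bound: "integrable M (\<lambda>\<omega>. \<psi> k (W \<omega>) * f \<omega>)" if "integrable M f" for f
      proof (rule Bochner_Integration.integrable_bound[OF that])
        show "(\<lambda>\<omega>. \<psi> k (W \<omega>) * f \<omega>) \<in> borel_measurable M" using that by measurable
        show "AE \<omega> in M. norm (\<psi> k (W \<omega>) * f \<omega>) \<le> norm (f \<omega>)"
          using \<psi>_bd[of k] by (intro AE_I2) (simp add: abs_mult mult_left_le_one_le)
      qed
      have "(LINT \<omega>|M. \<psi> k (W \<omega>) * D \<omega>) = (LINT \<omega>|M. \<psi> k (W \<omega>) * h (W \<omega>) - \<psi> k (W \<omega>) * T_fun M X g (X \<omega>))"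
        by (simp add: D_def right_diff_distrib)
      also have "\<dots> = 0" using bound[OF h_int] bound[OF T_int] 1 2 by simp
      finally show ?thesis .
    qed
    have "(\<lambda>k. LINT \<omega>|M. \<psi> k (W \<omega>) * D \<omega>) \<longlonglongrightarrow> (LINT \<omega>|M. indicator {a<..<b} (W \<omega>) * D \<omega>)"
    proof (rule integral_dominated_convergence[where w="\<lambda>\<omega>. \<bar>D \<omega>\<bar>"])
      show "AE \<omega> in M. (\<lambda>k. \<psi> k (W \<omega>) * D \<omega>) \<longlonglongrightarrow> indicator {a<..<b} (W \<omega>) * D \<omega>"
      proof (rule AE_I2, rule tendsto_eventually)
        fix \<omega>
        show "\<forall>\<^sub>F k in sequentially. \<psi> k (W \<omega>) * D \<omega> = indicator {a<..<b} (W \<omega>) * D \<omega>"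
        proof (cases "W \<omega> \<in> {a<..<b}")
          case True
          define m where "m = min (W \<omega> - a) (b - W \<omega>)"
          have m: "m > 0" using True by (simp add: m_def)
          obtain n where n: "1 / m < real n" using reals_Archimedean2 by blast
          show ?thesis using eventually_ge_at_top[of n]
          proof eventually_elim
            case (elim k)
            then have "1 / m \<le> real k" using n by linarith
            then have "1 \<le> real k * m" using m by (simp add: field_simps)
            then show ?case using True by (simp add: \<psi>_def m_def)
          qed
        next
          case False
          then show ?thesis using \<psi>_zero by simp
        qed
      qed
      show "AE \<omega> in M. norm (\<psi> k (W \<omega>) * D \<omega>) \<le> \<bar>D \<omega>\<bar>" for k
        using \<psi>_bd[of k] by (intro AE_I2) (simp add: abs_mult mult_left_le_one_le)
    qed (use D_int in auto)
    then show ?thesis unfolding zero by (simp add: LIMSEQ_const_iff)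
  qed
  let ?F = "vimage_algebra (space M) W borel"
  have sets_F: "sets ?F = {W -` A \<inter> space M |A. A \<in> sets borel}" by (rule sets_vimage_algebra2) simp
  interpret finite_measure_subalgebra M ?F
  proof
    show "subalgebra M ?F" unfolding subalgebra_def sets_F by auto
  qed
  have "AE \<omega> in M. real_cond_exp M ?F (\<lambda>\<omega>. T_fun M X g (X \<omega>)) \<omega> = h (W \<omega>)"
  proof (rule real_cond_exp_charact[OF _ T_int h_int])
    fix S assume "S \<in> sets ?F"
    then obtain A where A: "A \<in> sets borel" "S = W -` A \<inter> space M" unfolding sets_F by auto
    have S: "S \<in> sets M" unfolding A(2) by (rule measurable_sets[OF Wm A(1)])
    have si: "set_integrable M S f" if "integrable M f" for f :: "'a \<Rightarrow> real"
      using that S unfolding set_integrable_def by (rule integrable_mult_indicator[rotated])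
    have "(LINT \<omega>:S|M. D \<omega>) = 0" unfolding A(2) by (rule set_integral_vimage_zero[OF Wm D_int D_interval A(1)])
    then show "(LINT \<omega>:S|M. T_fun M X g (X \<omega>)) = (LINT \<omega>:S|M. h (W \<omega>))"
      unfolding D_def using set_integral_diff(2)[OF si[OF h_int] si[OF T_int]] by simp
  next
    have "W \<in> measurable ?F borel" by (rule measurable_vimage_algebra1) simp
    then show "(\<lambda>\<omega>. h (W \<omega>)) \<in> borel_measurable ?F" by measurable
  qed
  then show ?thesis by eventually_elim simp
qed

end
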